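(* Modules of the intermediate series over the loop-Virasoro algebra $\mathcal{L}=\mathrm{Vir}\otimes\mathbb{C}[t^{\pm1}]$ are all evaluation modules of the intermediate series: each is isomorphic to one of $V(a,b)(e)$, $A_a(e)$, $B_a(e)$, $V'(0,0)(e)$ for some $a,b,e\in\mathbb{C}$ with $e\neq0$.
   Context: The Virasoro algebra $\mathrm{Vir}$ is the complex Lie algebra with basis $\{c,d_i : i\in\mathbb{Z}\}$ and brackets $[d_m,d_n]=(n-m)d_{m+n}+\delta_{m,-n}\frac{m^3-m}{12}c$, $[d_m,c]=0$. The loop-Virasoro algebra is $\mathcal{L}=\mathrm{Vir}\otimes\mathbb{C}[t^{\pm1}]$ with brackets $[d_i\otimes t^j,d_k\otimes t^l]=(k-i)\,d_{i+k}\otimes t^{j+l}+\delta_{i+k,0}\frac{i^3-i}{12}\,c\otimes t^{j+l}$, and with $c\otimes t^l$ central. Write $d_i=d_i\otimes 1$. For a module $V$ and $\lambda\in\mathbb{C}$, the weight space is $V_\lambda=\{v\in V: d_0v=\lambda v\}$; $V$ is a weight module if it is the sum of its weight spaces. A module of the intermediate series is an indecomposable weight module all of whose (nonzero) weight spaces are $1$-dimensional. The following are $\mathrm{Vir}$-modules on which $c$ acts by zero: - $V(a,b)$ has basis $\{v_{a+k}: k\in\mathbb{Z}\}$ with $d_iv_{a+k}=(a+k+ib)v_{a+k+i}$; - $A_a$ has basis $\{v_k: k\in\mathbb{Z}\}$ with $d_iv_k=(k+i)v_{k+i}$ for $k\ne0$ and $d_iv_0=i(i+a)v_i$; - $B_a$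 has basis $\{v_k:k\in\mathbb{Z}\}$ with $d_iv_k=kv_{k+i}$ for $k+i\neq0$ and $d_iv_{-i}=-i(i+a)v_0$; - $V'(0,0)=V(0,0)/\mathbb{C}v_0$. For such a $\mathrm{Vir}$-module $V$ and nonzero $e\in\mathbb{C}$, the evaluation module $V(e)$ is the $\mathcal{L}$-module equal to $V$ as a vector space with $(x\otimes t^m)u=e^m\,xu$ for $x\in\mathrm{Vir}$, $m\in\mathbb{Z}$, $u\in V$.
   Formalization: The formal theorem assumes in addition that the action on the module is not identically zero; this excludes exactly the one-dimensional trivial module, which meets the stated definition but is isomorphic to none of the listed infinite-dimensional modules. *)

theory Defs
  imports Complex_Main "HOL-Library.Poly_Mapping"
begin

text \<open>
  The complex vector space with basis \<open>'a\<close> is \<open>'a \<Rightarrow>\<^sub>0 complex\<close>; the basis vector belonging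
  to \<open>k\<close> is \<open>Poly_Mapping.single k 1\<close>.
\<close>

definition fscale :: "complex \<Rightarrow> ('a \<Rightarrow>\<^sub>0 complex) \<Rightarrow> ('a \<Rightarrow>\<^sub>0 complex)" where
  "fscale c = Poly_Mapping.map ((*) c)"

definition lin_ext :: "('a \<Rightarrow> ('b \<Rightarrow>\<^sub>0 complex)) \<Rightarrow> ('a \<Rightarrow>\<^sub>0 complex) \<Rightarrow> ('b \<Rightarrow>\<^sub>0 complex)" where
  "lin_ext h f = (\<Sum>a\<in>Poly_Mapping.keys f. fscale (Poly_Mapping.lookup f a) (h a))"

definition bilin_ext ::
  "('a \<Rightarrow> 'b \<Rightarrow> ('c \<Rightarrow>\<^sub>0 complex)) \<Rightarrow> ('a \<Rightarrow>\<^sub>0 complex) \<Rightarrow> ('b \<Rightarrow>\<^sub>0 complex) \<Rightarrow> ('c \<Rightarrow>\<^sub>0 complex)" where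
  "bilin_ext h f g = lin_ext (\<lambda>a. lin_ext (h a) g) f"

lemma lookup_fscale [simp]: "Poly_Mapping.lookup (fscale c f) k = c * Poly_Mapping.lookup f k"
  by (simp add: fscale_def map.rep_eq when_def)

lemma vector_space_fscale: "vector_space fscale"
  by unfold_locales (auto intro!: poly_mapping_eqI simp: lookup_add algebra_simps)

interpretation fs: vector_space fscale
  by (rule vector_space_fscale)

lemma fscale_single [simp]: "fscale c (Poly_Mapping.single k z) = Poly_Mapping.single k (c * z)"
  by (rule poly_mapping_eqI) (simp add: lookup_single when_def)

lemma poly_mapping_add_induct [case_names zero single add]:
  fixes f :: "'a \<Rightarrow>\<^sub>0 'b::comm_monoid_add"
  assumes "P 0" "\<And>k z. P (Poly_Mapping.single k z)" "\<And>f g. P f \<Longrightarrow> P g \<Longrightarrow> P (f + g)"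
  shows "P f"
proof (induction f rule: update_induct)
  case const
  show ?case using assms(1) by simp
next
  case (update f a b)
  have "Poly_Mapping.update a b f = f + Poly_Mapping.single a b"
    using update(1)
    by (intro poly_mapping_eqI)
       (auto simp: lookup_update lookup_add lookup_single when_def in_keys_iff)
  then show ?case using update assms by simp
qed

lemma lin_ext_single [simp]: "lin_ext h (Poly_Mapping.single a z) = fscale z (h a)"
  by (cases "z = 0") (simp_all add: lin_ext_def)

lemma lin_ext_zero [simp]: "lin_ext h 0 = 0"
  by (simp add: lin_ext_def)

lemma lin_ext_add: "lin_ext h (f + g) = lin_ext h f + lin_ext h g"
  unfolding lin_ext_def
  by (rule setsum_keys_plus_distrib) (simp_all add: fs.scale_left_distrib)

lemma lin_ext_scale: "lin_ext h (fscale c f) = fscale c (lin_ext h f)"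
  by (induction f rule: poly_mapping_add_induct)
     (simp_all add: lin_ext_add fs.scale_right_distrib)

lemma lin_ext_fun_add: "lin_ext (\<lambda>a. h a + h' a) f = lin_ext h f + lin_ext h' f"
  by (simp add: lin_ext_def fs.scale_right_distrib sum.distrib)

lemma lin_ext_fun_scale: "lin_ext (\<lambda>a. fscale c (h a)) f = fscale c (lin_ext h f)"
  by (simp add: lin_ext_def fs.scale_sum_right mult.commute)

lemma bilin_ext_single [simp]:
  "bilin_ext h (Poly_Mapping.single a y) (Poly_Mapping.single b z) = fscale (y * z) (h a b)"
  by (simp add: bilin_ext_def)

lemma bilin_ext_add_left: "bilin_ext h (f + f') g = bilin_ext h f g + bilin_ext h f' g"
  by (simp add: bilin_ext_def lin_ext_add)

lemma bilin_ext_add_right: "bilin_ext h f (g + g') = bilin_ext h f g + bilin_ext h f g'"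
  by (simp add: bilin_ext_def lin_ext_add lin_ext_fun_add)

lemma bilin_ext_scale_left: "bilin_ext h (fscale c f) g = fscale c (bilin_ext h f g)"
  by (simp add: bilin_ext_def lin_ext_scale)

lemma bilin_ext_scale_right: "bilin_ext h f (fscale c g) = fscale c (bilin_ext h f g)"
  by (simp add: bilin_ext_def lin_ext_scale lin_ext_fun_scale)

lemma bilin_ext_zero [simp]: "bilin_ext h 0 g = 0" "bilin_ext h f 0 = 0"
  by (simp_all add: bilin_ext_def lin_ext_def)

locale lie_algebra = vector_space scale
  for scale :: "complex \<Rightarrow> 'g::ab_group_add \<Rightarrow> 'g" +
  fixes bracket :: "'g \<Rightarrow> 'g \<Rightarrow> 'g"
  assumes bracket_add_left: "bracket (x + y) z = bracket x z + bracket y z"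
    and bracket_add_right: "bracket x (y + z) = bracket x y + bracket x z"
    and bracket_scale_left: "bracket (scale c x) y = scale c (bracket x y)"
    and bracket_scale_right: "bracket x (scale c y) = scale c (bracket x y)"
    and bracket_self: "bracket x x = 0"
    and jacobi: "bracket x (bracket y z) + bracket y (bracket z x) + bracket z (bracket x y) = 0"

locale lie_module = lie: lie_algebra lie_scale bracket + vector_space scale
  for lie_scale :: "complex \<Rightarrow> 'g::ab_group_add \<Rightarrow> 'g"
    and bracket :: "'g \<Rightarrow> 'g \<Rightarrow> 'g"
    and scale :: "complex \<Rightarrow> 'v::ab_group_add \<Rightarrow> 'v" +
  fixes act :: "'g \<Rightarrow> 'v \<Rightarrow> 'v"
  assumes act_add_left: "act (x + y) v = act x v + act y v"
    and act_add_right: "act x (v + w) = act x v + act x w"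
    and act_scale_left: "act (lie_scale c x) v = scale c (act x v)"
    and act_scale_right: "act x (scale c v) = scale c (act x v)"
    and act_bracket: "act (bracket x y) v = act x (act y v) - act y (act x v)"
begin

definition submodule :: "'v set \<Rightarrow> bool" where
  "submodule U \<longleftrightarrow> subspace U \<and> (\<forall>x. \<forall>u\<in>U. act x u \<in> U)"

definition indecomposable :: bool where
  "indecomposable \<longleftrightarrow> (UNIV :: 'v set) \<noteq> {0} \<and>
    (\<forall>U W. submodule U \<and> submodule W \<and> U \<inter> W = {0} \<and> {u + w | u w. u \<in> U \<and> w \<in> W} = UNIV
      \<longrightarrow> U = {0} \<or> W = {0})"

end

definition module_isomorphic ::
  "(complex \<Rightarrow> 'v::ab_group_add \<Rightarrow> 'v) \<Rightarrow> ('g \<Rightarrow> 'v \<Rightarrow> 'v) \<Rightarrow>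
   (complex \<Rightarrow> 'w::ab_group_add \<Rightarrow> 'w) \<Rightarrow> ('g \<Rightarrow> 'w \<Rightarrow> 'w) \<Rightarrow> bool" where
  "module_isomorphic scale1 act1 scale2 act2 \<longleftrightarrow>
    (\<exists>\<phi>. Vector_Spaces.linear scale1 scale2 \<phi> \<and> bij \<phi> \<and> (\<forall>x v. \<phi> (act1 x v) = act2 x (\<phi> v)))"

datatype vir_basis = C | D int

type_synonym vir = "vir_basis \<Rightarrow>\<^sub>0 complex"

fun vir_bracket_basis :: "vir_basis \<Rightarrow> vir_basis \<Rightarrow> vir" where
  "vir_bracket_basis (D m) (D n) =
     Poly_Mapping.single (D (m + n)) (of_int (n - m)) +
     (if m = - n then Poly_Mapping.single C ((of_int m ^ 3 - of_int m) / 12) else 0)"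
| "vir_bracket_basis C _ = 0"
| "vir_bracket_basis _ C = 0"

definition vir_bracket :: "vir \<Rightarrow> vir \<Rightarrow> vir" where
  "vir_bracket = bilin_ext vir_bracket_basis"

lemma vir_bracket_basis_swap: "vir_bracket_basis a b = - vir_bracket_basis b a"
  by (cases a; cases b)
     (auto intro!: poly_mapping_eqI
       simp: lookup_add lookup_single when_def add.commute field_simps)

lemma vir_bracket_swap: "vir_bracket x y = - vir_bracket y x"
proof (induction x rule: poly_mapping_add_induct)
  case (single a r)
  show ?case
  proof (induction y rule: poly_mapping_add_induct)
    case (single b s)
    show ?case unfolding vir_bracket_def bilin_ext_single
      by (subst vir_bracket_basis_swap) (simp add: fs.scale_minus_right mult.commute)
  qed (simp_all add: vir_bracket_def bilin_ext_add_left bilin_ext_add_right)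
qed (simp_all add: vir_bracket_def bilin_ext_add_left bilin_ext_add_right)

lemma vir_jacobi_basis:
  "bilin_ext vir_bracket_basis (Poly_Mapping.single a 1) (vir_bracket_basis b c) +
   bilin_ext vir_bracket_basis (Poly_Mapping.single b 1) (vir_bracket_basis c a) +
   bilin_ext vir_bracket_basis (Poly_Mapping.single c 1) (vir_bracket_basis a b) = 0"
proof (cases "\<exists>m n p. a = D m \<and> b = D n \<and> c = D p")
  case True
  then obtain m n p where eq: "a = D m" "b = D n" "c = D p" by blast
  show ?thesis
  proof (cases "m + n + p = 0")
    case True
    then have p: "p = - m - n" by simp
    show ?thesis unfolding eq p
      by (rule poly_mapping_eqI)
         (auto simp: bilin_ext_add_right lookup_add lookup_single when_def
            field_simps power3_eq_cube)
  next
    case False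
    then have "m \<noteq> - (n + p)" "n \<noteq> - (p + m)" "p \<noteq> - (m + n)" by auto
    then show ?thesis unfolding eq
      by (intro poly_mapping_eqI)
         (auto simp: bilin_ext_add_right lookup_add lookup_single when_def algebra_simps)
  qed
next
  case False
  then show ?thesis
    by (cases a; cases b; cases c) (auto simp: bilin_ext_add_right)
qed

lemma add_three:
  fixes a b c :: "'a::ab_group_add"
  assumes "a + b + c = 0" "a' + b' + c' = 0"
  shows "a + a' + (b + b') + (c + c') = 0"
proof -
  have "a + a' + (b + b') + (c + c') = (a + b + c) + (a' + b' + c')"
    by (simp only: add_ac)
  then show ?thesis using assms by simp
qed

lemma vir_jacobi:
  "vir_bracket x (vir_bracket y z) + vir_bracket y (vir_bracket z x)
    + vir_bracket z (vir_bracket x y) = 0"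
proof (induction x rule: poly_mapping_add_induct)
  case x: (single a r)
  show ?case
  proof (induction y rule: poly_mapping_add_induct)
    case y: (single b s)
    show ?case
    proof (induction z rule: poly_mapping_add_induct)
      case z: (single c t)
      have sg: "Poly_Mapping.single k w = fscale w (Poly_Mapping.single k 1)"
        for k :: vir_basis and w by simp
      show ?case
        unfolding vir_bracket_def bilin_ext_single
        unfolding sg[of _ r] sg[of _ s] sg[of _ t]
          bilin_ext_scale_left bilin_ext_scale_right
        using arg_cong[OF vir_jacobi_basis[of a b c], of "fscale (r * s * t)"]
        by (simp add: fs.scale_right_distrib mult_ac)
    qed (simp_all add: vir_bracket_def bilin_ext_add_left bilin_ext_add_right add_three)
  qed (simp_all add: vir_bracket_def bilin_ext_add_left bilin_ext_add_right add_three)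
qed (simp_all add: vir_bracket_def bilin_ext_add_left bilin_ext_add_right add_three)

lemma lie_algebra_vir: "lie_algebra fscale vir_bracket"
proof (intro lie_algebra.intro vector_space_fscale lie_algebra_axioms.intro)
  show "vir_bracket x x = 0" for x
  proof (rule poly_mapping_eqI)
    fix k
    have "Poly_Mapping.lookup (vir_bracket x x) k = - Poly_Mapping.lookup (vir_bracket x x) k"
      by (metis vir_bracket_swap lookup_uminus)
    then show "Poly_Mapping.lookup (vir_bracket x x) k = Poly_Mapping.lookup 0 k" by simp
  qed
qed (simp_all add: vir_jacobi, simp_all add: vir_bracket_def bilin_ext_add_left
       bilin_ext_add_right bilin_ext_scale_left bilin_ext_scale_right)

interpretation vir: lie_algebra fscale vir_bracket
  by (rule lie_algebra_vir)

text \<open>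
  \<open>Vir \<otimes> \<complex>[t\<^sup>\<plusminus>\<^sup>1]\<close> is realised as the space of Laurent polynomials with coefficients in \<open>Vir\<close>;
  \<open>loop_tensor x m\<close> is \<open>x \<otimes> t\<^sup>m\<close>.
\<close>

type_synonym loop_vir = "int \<Rightarrow>\<^sub>0 vir"

definition loop_tensor :: "vir \<Rightarrow> int \<Rightarrow> loop_vir" where
  "loop_tensor x m = Poly_Mapping.single m x"

definition loop_scale :: "complex \<Rightarrow> loop_vir \<Rightarrow> loop_vir" where
  "loop_scale c = Poly_Mapping.map (fscale c)"

definition loop_bracket :: "loop_vir \<Rightarrow> loop_vir \<Rightarrow> loop_vir" where
  "loop_bracket f g =
    (\<Sum>i\<in>Poly_Mapping.keys f. \<Sum>j\<in>Poly_Mapping.keys g.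
      loop_tensor (vir_bracket (Poly_Mapping.lookup f i) (Poly_Mapping.lookup g j)) (i + j))"

lemma vir_bracket_zero [simp]: "vir_bracket 0 y = 0" "vir_bracket x 0 = 0"
  by (simp_all add: vir_bracket_def)

lemma loop_tensor_zero [simp]: "loop_tensor 0 m = 0"
  by (simp add: loop_tensor_def)

lemma loop_tensor_add: "loop_tensor (x + y) m = loop_tensor x m + loop_tensor y m"
  by (simp add: loop_tensor_def single_add)

lemma loop_tensor_uminus: "loop_tensor (- x) m = - loop_tensor x m"
  by (simp add: loop_tensor_def single_uminus)

lemma lookup_loop_scale [simp]:
  "Poly_Mapping.lookup (loop_scale c f) k = fscale c (Poly_Mapping.lookup f k)"
  by (simp add: loop_scale_def map.rep_eq when_def)

lemma vector_space_loop_scale: "vector_space loop_scale"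
  by unfold_locales
     (auto intro!: poly_mapping_eqI[where ?'b = vir]
        simp: lookup_add fs.scale_right_distrib fs.scale_left_distrib)

interpretation ls: vector_space loop_scale
  by (rule vector_space_loop_scale)

lemma loop_scale_tensor: "loop_scale c (loop_tensor x m) = loop_tensor (fscale c x) m"
  by (rule poly_mapping_eqI) (simp add: loop_tensor_def lookup_single when_def)

lemma loop_vir_induct [case_names zero tensor add]:
  fixes f :: loop_vir
  assumes "P 0" "\<And>x m. P (loop_tensor x m)" "\<And>f g. P f \<Longrightarrow> P g \<Longrightarrow> P (f + g)"
  shows "P f"
  using assms by (induction f rule: poly_mapping_add_induct) (simp_all add: loop_tensor_def)

lemma loop_bracket_tensor:
  "loop_bracket (loop_tensor x i) (loop_tensor y j) = loop_tensor (vir_bracket x y) (i + j)"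
  by (cases "x = 0"; cases "y = 0") (simp_all add: loop_bracket_def, simp add: loop_tensor_def)

lemma loop_bracket_basis:
  "loop_bracket (loop_tensor (Poly_Mapping.single (D i) 1) j)
                (loop_tensor (Poly_Mapping.single (D k) 1) l) =
     loop_scale (of_int (k - i)) (loop_tensor (Poly_Mapping.single (D (i + k)) 1) (j + l)) +
     (if i + k = 0
      then loop_scale ((of_int i ^ 3 - of_int i) / 12)
             (loop_tensor (Poly_Mapping.single C 1) (j + l))
      else 0)"
  "loop_bracket (loop_tensor (Poly_Mapping.single C 1) l) f = 0"
proof -
  show "loop_bracket (loop_tensor (Poly_Mapping.single C 1) l) f = 0"
  proof -
    have "vir_bracket (Poly_Mapping.single C 1) x = 0" for x
      unfolding vir_bracket_def bilin_ext_def by (simp add: lin_ext_def)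
    then show ?thesis unfolding loop_bracket_def
      by (simp add: loop_tensor_def)
  qed
qed (auto simp: loop_bracket_tensor vir_bracket_def loop_scale_tensor loop_tensor_add
       eq_neg_iff_add_eq_0)

lemma loop_bracket_zero [simp]: "loop_bracket 0 g = 0" "loop_bracket f 0 = 0"
  by (simp_all add: loop_bracket_def)

lemma loop_bracket_add_left: "loop_bracket (f + f') g = loop_bracket f g + loop_bracket f' g"
  unfolding loop_bracket_def
  by (rule setsum_keys_plus_distrib)
     (simp_all add: vir.bracket_add_left loop_tensor_add sum.distrib)

lemma loop_bracket_add_right: "loop_bracket f (g + g') = loop_bracket f g + loop_bracket f g'"
  unfolding loop_bracket_def sum.distrib[symmetric]
  by (intro sum.cong refl setsum_keys_plus_distrib)
     (simp_all add: vir.bracket_add_right loop_tensor_add)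

lemma loop_bracket_swap: "loop_bracket f g = - loop_bracket g f"
proof (induction f rule: loop_vir_induct)
  case (tensor x m)
  show ?case
  proof (induction g rule: loop_vir_induct)
    case (tensor y n)
    have "loop_tensor (vir_bracket x y) (m + n) = loop_tensor (- vir_bracket y x) (n + m)"
      by (metis vir_bracket_swap add.commute)
    then show ?case by (simp add: loop_bracket_tensor loop_tensor_uminus)
  qed (simp_all add: loop_bracket_add_left loop_bracket_add_right)
qed (simp_all add: loop_bracket_add_left loop_bracket_add_right)

lemma loop_jacobi:
  "loop_bracket x (loop_bracket y z) + loop_bracket y (loop_bracket z x)
    + loop_bracket z (loop_bracket x y) = 0"
proof (induction x rule: loop_vir_induct)
  case x: (tensor a r)
  show ?case
  proof (induction y rule: loop_vir_induct)
    case y: (tensor b s)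
    show ?case
    proof (induction z rule: loop_vir_induct)
      case z: (tensor c t)
      have "s + (t + r) = r + (s + t)" "t + (r + s) = r + (s + t)" by simp_all
      then show ?case
        by (simp only: loop_bracket_tensor loop_tensor_add[symmetric] vir_jacobi loop_tensor_zero)
    qed (simp_all add: loop_bracket_add_left loop_bracket_add_right add_three)
  qed (simp_all add: loop_bracket_add_left loop_bracket_add_right add_three)
qed (simp_all add: loop_bracket_add_left loop_bracket_add_right add_three)

lemma lie_algebra_loop: "lie_algebra loop_scale loop_bracket"
proof (intro lie_algebra.intro vector_space_loop_scale lie_algebra_axioms.intro)
  show "loop_bracket x x = 0" for x
  proof (intro poly_mapping_eqI)
    fix k l
    have "Poly_Mapping.lookup (Poly_Mapping.lookup (loop_bracket x x) k) l =
        - Poly_Mapping.lookup (Poly_Mapping.lookup (loop_bracket x x) k) l"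
      by (metis loop_bracket_swap lookup_uminus)
    then show "Poly_Mapping.lookup (Poly_Mapping.lookup (loop_bracket x x) k) l =
        Poly_Mapping.lookup (Poly_Mapping.lookup 0 k) l" by simp
  qed
  show l: "loop_bracket (loop_scale c x) y = loop_scale c (loop_bracket x y)" for c x y
  proof (induction x rule: loop_vir_induct)
    case (tensor a m)
    then show ?case
      by (induction y rule: loop_vir_induct)
         (simp_all add: loop_bracket_tensor loop_scale_tensor loop_bracket_add_right
            ls.scale_right_distrib vir.bracket_scale_left)
  qed (simp_all add: loop_bracket_add_left ls.scale_right_distrib)
  show "loop_bracket x (loop_scale c y) = loop_scale c (loop_bracket x y)" for c x y
    by (metis l loop_bracket_swap ls.scale_minus_right)
qed (simp_all add: loop_jacobi loop_bracket_add_left loop_bracket_add_right)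

locale loop_vir_module = lie_module loop_scale loop_bracket scale act
  for scale :: "complex \<Rightarrow> 'v::ab_group_add \<Rightarrow> 'v" and act :: "loop_vir \<Rightarrow> 'v \<Rightarrow> 'v"
begin

definition weight_space :: "complex \<Rightarrow> 'v set" where
  "weight_space \<mu> = {v. act (loop_tensor (Poly_Mapping.single (D 0) 1) 0) v = scale \<mu> v}"

definition weight_module :: bool where
  "weight_module \<longleftrightarrow> span (\<Union>\<mu>. weight_space \<mu>) = UNIV"

definition intermediate_series :: bool where
  "intermediate_series \<longleftrightarrow> indecomposable \<and> weight_module \<and>
    (\<forall>\<mu>. weight_space \<mu> \<noteq> {0} \<longrightarrow> dim (weight_space \<mu>) = 1)"

end

text \<open>
  In all four families the underlying space has basis indexed by \<open>int\<close>; for \<open>V(a,b)\<close> the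
  index \<open>k\<close> stands for the basis vector \<open>v\<^sub>a\<^sub>+\<^sub>k\<close>.
\<close>

fun V_basis :: "complex \<Rightarrow> complex \<Rightarrow> vir_basis \<Rightarrow> int \<Rightarrow> (int \<Rightarrow>\<^sub>0 complex)" where
  "V_basis a b (D i) k = Poly_Mapping.single (k + i) (a + of_int k + of_int i * b)"
| "V_basis a b C k = 0"

fun A_basis :: "complex \<Rightarrow> vir_basis \<Rightarrow> int \<Rightarrow> (int \<Rightarrow>\<^sub>0 complex)" where
  "A_basis a (D i) k =
     (if k \<noteq> 0 then Poly_Mapping.single (k + i) (of_int (k + i))
      else Poly_Mapping.single i (of_int i * (of_int i + a)))"
| "A_basis a C k = 0"

fun B_basis :: "complex \<Rightarrow> vir_basis \<Rightarrow> int \<Rightarrow> (int \<Rightarrow>\<^sub>0 complex)" where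
  "B_basis a (D i) k =
     (if k + i \<noteq> 0 then Poly_Mapping.single (k + i) (of_int k)
      else Poly_Mapping.single 0 (- of_int i * (of_int i + a)))"
| "B_basis a C k = 0"

definition V_act :: "complex \<Rightarrow> complex \<Rightarrow> vir \<Rightarrow> (int \<Rightarrow>\<^sub>0 complex) \<Rightarrow> (int \<Rightarrow>\<^sub>0 complex)" where
  "V_act a b = bilin_ext (V_basis a b)"

definition A_act :: "complex \<Rightarrow> vir \<Rightarrow> (int \<Rightarrow>\<^sub>0 complex) \<Rightarrow> (int \<Rightarrow>\<^sub>0 complex)" where
  "A_act a = bilin_ext (A_basis a)"

definition B_act :: "complex \<Rightarrow> vir \<Rightarrow> (int \<Rightarrow>\<^sub>0 complex) \<Rightarrow> (int \<Rightarrow>\<^sub>0 complex)" where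
  "B_act a = bilin_ext (B_basis a)"

text \<open>\<open>V'(0,0) = V(0,0) / \<complex>v\<^sub>0\<close>, the submodule \<open>\<complex>v\<^sub>0\<close> being the range of
  \<open>Poly_Mapping.single 0\<close>.\<close>

quotient_type Vprime =
  "int \<Rightarrow>\<^sub>0 complex" / "\<lambda>f g. \<exists>z. f - g = Poly_Mapping.single 0 z"
proof (rule equivpI)
  show "reflp (\<lambda>f g :: int \<Rightarrow>\<^sub>0 complex. \<exists>z. f - g = Poly_Mapping.single 0 z)"
    by (auto intro!: reflpI exI[of _ 0])
  show "symp (\<lambda>f g :: int \<Rightarrow>\<^sub>0 complex. \<exists>z. f - g = Poly_Mapping.single 0 z)"
    by (rule sympI) (metis minus_diff_eq single_uminus)
  show "transp (\<lambda>f g :: int \<Rightarrow>\<^sub>0 complex. \<exists>z. f - g = Poly_Mapping.single 0 z)"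
    by (rule transpI) (metis diff_add_cancel add_diff_eq single_add)
qed

instantiation Vprime :: ab_group_add
begin

lift_definition zero_Vprime :: Vprime is 0 .

lift_definition plus_Vprime :: "Vprime \<Rightarrow> Vprime \<Rightarrow> Vprime" is "(+)"
  by (clarsimp, metis add_diff_add single_add)

lift_definition uminus_Vprime :: "Vprime \<Rightarrow> Vprime" is uminus
  by (metis minus_diff_minus single_uminus)

lift_definition minus_Vprime :: "Vprime \<Rightarrow> Vprime \<Rightarrow> Vprime" is "(-)"
proof -
  fix f g f' g' :: "int \<Rightarrow>\<^sub>0 complex"
  assume "\<exists>z. f - g = Poly_Mapping.single 0 z" "\<exists>z. f' - g' = Poly_Mapping.single 0 z"
  then obtain z z' where "f - g = Poly_Mapping.single 0 z" "f' - g' = Poly_Mapping.single 0 z'"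
    by blast
  then have "f - f' - (g - g') = Poly_Mapping.single 0 (z - z')"
    by (simp add: single_diff algebra_simps)
  then show "\<exists>z. f - f' - (g - g') = Poly_Mapping.single 0 z" ..
qed

instance
  by standard (transfer, rule exI[of _ 0], simp)+

end

lift_definition Vprime_scale :: "complex \<Rightarrow> Vprime \<Rightarrow> Vprime" is fscale
  by (metis fs.scale_right_diff_distrib fscale_single)

lemma V_act_single_0: "V_act 0 0 x (Poly_Mapping.single 0 z) = 0"
  unfolding V_act_def
proof (induction x rule: poly_mapping_add_induct)
  case (single k w)
  then show ?case by (cases k) simp_all
qed (simp_all add: bilin_ext_add_left)

lift_definition Vprime_act :: "vir \<Rightarrow> Vprime \<Rightarrow> Vprime" is "V_act 0 0"
proof -
  fix x and f g :: "int \<Rightarrow>\<^sub>0 complex"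
  assume "\<exists>z. f - g = Poly_Mapping.single 0 z"
  then obtain z where "f = g + Poly_Mapping.single 0 z"
    by (metis diff_add_cancel add.commute)
  then have "V_act 0 0 x f - V_act 0 0 x g = Poly_Mapping.single 0 0"
    using V_act_single_0[of x z] by (simp add: V_act_def bilin_ext_add_right)
  then show "\<exists>z. V_act 0 0 x f - V_act 0 0 x g = Poly_Mapping.single 0 z" ..
qed

definition eval_act ::
  "(complex \<Rightarrow> 'v::ab_group_add \<Rightarrow> 'v) \<Rightarrow> (vir \<Rightarrow> 'v \<Rightarrow> 'v) \<Rightarrow> complex \<Rightarrow> loop_vir \<Rightarrow> 'v \<Rightarrow> 'v" where
  "eval_act scale act e f u =
    (\<Sum>m\<in>Poly_Mapping.keys f. scale (e powi m) (act (Poly_Mapping.lookup f m) u))"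

lemma eval_act_tensor:
  assumes "lie_module fscale vir_bracket scale act"
  shows "eval_act scale act e (loop_tensor x m) u = scale (e powi m) (act x u)"
proof -
  interpret lie_module fscale vir_bracket scale act by fact
  have "act 0 u = 0" using act_scale_left[of 0 0 u] by simp
  then show ?thesis by (cases "x = 0") (simp_all add: eval_act_def loop_tensor_def)
qed

lemma lie_module_eval:
  assumes "lie_module fscale vir_bracket scale act" "e \<noteq> 0"
  shows "loop_vir_module scale (eval_act scale act e)"
proof -
  interpret lie_module fscale vir_bracket scale act by fact
  let ?a = "eval_act scale act e"
  have z: "act 0 u = 0" for u using act_scale_left[of 0 0 u] by simp
  have z': "act x 0 = 0" for x using act_scale_right[of x 0 0] by simp
  note t = eval_act_tensor[OF assms(1)]
  have al: "?a (f + g) u = ?a f u + ?a g u" for f g u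
    unfolding eval_act_def
    by (rule setsum_keys_plus_distrib) (simp_all add: z act_add_left scale_right_distrib)
  have ar: "?a f (u + w) = ?a f u + ?a f w" for f u w
    by (simp add: eval_act_def act_add_right scale_right_distrib sum.distrib)
  have z0: "?a 0 u = 0" for u by (simp add: eval_act_def)
  have z1: "?a x 0 = 0" for x by (simp add: eval_act_def z')
  have sl: "?a (loop_scale c f) u = scale c (?a f u)" for c f u
    by (induction f rule: loop_vir_induct)
       (simp_all add: al z0 t loop_scale_tensor act_scale_left ls.scale_right_distrib
          scale_right_distrib mult.commute)
  have sr: "?a f (scale c u) = scale c (?a f u)" for c f u
    by (simp add: eval_act_def act_scale_right scale_sum_right mult.commute)
  have br: "?a (loop_bracket f g) u = ?a f (?a g u) - ?a g (?a f u)" for f g u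
  proof (induction f rule: loop_vir_induct)
    case x: (tensor x m)
    show ?case
    proof (induction g rule: loop_vir_induct)
      case (tensor y n)
      show ?case using assms(2)
        by (simp add: t loop_bracket_tensor act_bracket act_scale_right power_int_add
              scale_right_diff_distrib mult.commute)
    qed (simp_all add: al ar z0 z1 loop_bracket_add_right)
  qed (simp_all add: al ar z0 z1 loop_bracket_add_left)
  show ?thesis
    by (intro loop_vir_module.intro lie_module.intro lie_algebra_loop lie_module_axioms.intro
          vector_space_axioms al ar sl sr br)
qed

lemma lie_module_bilin_ext:
  assumes "\<And>x y k. bilin_ext h (vir_bracket_basis x y) (Poly_Mapping.single k 1) =
     bilin_ext h (Poly_Mapping.single x 1) (h y k) - bilin_ext h (Poly_Mapping.single y 1) (h x k)"
  shows "lie_module fscale vir_bracket fscale (bilin_ext h)"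
proof (intro lie_module.intro lie_algebra_vir lie_module_axioms.intro vector_space_fscale)
  show "bilin_ext h (vir_bracket x y) u =
      bilin_ext h x (bilin_ext h y u) - bilin_ext h y (bilin_ext h x u)" for x y u
  proof (induction x rule: poly_mapping_add_induct)
    case x: (single a r)
    show ?case
    proof (induction y rule: poly_mapping_add_induct)
      case y: (single b s)
      show ?case
      proof (induction u rule: poly_mapping_add_induct)
        case (single k w)
        have sg: "Poly_Mapping.single k w = fscale w (Poly_Mapping.single k 1)"
          for k :: "'x" and w by simp
        show ?case
          unfolding vir_bracket_def bilin_ext_single
          unfolding sg[of _ r] sg[of _ s] sg[of _ w] bilin_ext_scale_left bilin_ext_scale_right
            assms
          by (simp add: fs.scale_right_diff_distrib mult_ac)
      qed (simp_all add: bilin_ext_add_right)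
    qed (simp_all add: vir.bracket_add_right bilin_ext_add_right bilin_ext_add_left)
  qed (simp_all add: vir.bracket_add_left bilin_ext_add_right bilin_ext_add_left)
qed (simp_all add: bilin_ext_add_left bilin_ext_add_right bilin_ext_scale_left
       bilin_ext_scale_right)

lemma V_module: "lie_module fscale vir_bracket fscale (V_act a b)"
  unfolding V_act_def
proof (rule lie_module_bilin_ext)
  fix x y k
  show "bilin_ext (V_basis a b) (vir_bracket_basis x y) (Poly_Mapping.single k 1) =
    bilin_ext (V_basis a b) (Poly_Mapping.single x 1) (V_basis a b y k) -
    bilin_ext (V_basis a b) (Poly_Mapping.single y 1) (V_basis a b x k)"
    by (cases x; cases y)
       (auto intro!: poly_mapping_eqI
          simp: bilin_ext_add_left lookup_add lookup_minus lookup_single when_def algebra_simps)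
qed

lemma A_module: "lie_module fscale vir_bracket fscale (A_act a)"
  unfolding A_act_def
proof (rule lie_module_bilin_ext)
  fix x y k
  show "bilin_ext (A_basis a) (vir_bracket_basis x y) (Poly_Mapping.single k 1) =
    bilin_ext (A_basis a) (Poly_Mapping.single x 1) (A_basis a y k) -
    bilin_ext (A_basis a) (Poly_Mapping.single y 1) (A_basis a x k)"
    by (cases x; cases y)
       (auto intro!: poly_mapping_eqI
          simp del: single_one
          simp: bilin_ext_add_left lookup_add lookup_minus lookup_single when_def algebra_simps
            add_eq_0_iff)
qed

lemma B_module: "lie_module fscale vir_bracket fscale (B_act a)"
  unfolding B_act_def
proof (rule lie_module_bilin_ext)
  fix x y and k :: int
  show "bilin_ext (B_basis a) (vir_bracket_basis x y) (Poly_Mapping.single k 1) =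
    bilin_ext (B_basis a) (Poly_Mapping.single x 1) (B_basis a y k) -
    bilin_ext (B_basis a) (Poly_Mapping.single y 1) (B_basis a x k)"
  proof (cases "\<exists>m n. x = D m \<and> y = D n")
    case True
    then obtain m n where eq: "x = D m" "y = D n" by blast
    show ?thesis
    proof (cases "k = - m - n")
      case True
      show ?thesis unfolding eq True
        by (rule poly_mapping_eqI)
           (auto simp del: single_one
              simp: bilin_ext_add_left lookup_add lookup_minus lookup_single when_def algebra_simps)
    next
      case False
      then have "k + (m + n) \<noteq> 0" "k + n + m \<noteq> 0" "k + m + n \<noteq> 0"
        "k + n = 0 \<longleftrightarrow> n = - k" "k + m = 0 \<longleftrightarrow> m = - k" by auto
      then show ?thesis unfolding eq
        by (intro poly_mapping_eqI)
           (auto simp del: single_one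
              simp: bilin_ext_add_left lookup_add lookup_minus lookup_single when_def
                ring_distribs mult_ac add_ac)
    qed
  next
    case False
    then show ?thesis by (cases x; cases y) auto
  qed
qed

lemma Vprime_module: "lie_module fscale vir_bracket Vprime_scale Vprime_act"
proof -
  interpret V: lie_module fscale vir_bracket fscale "V_act 0 0" by (rule V_module)
  show ?thesis
    by (intro lie_module.intro lie_algebra_vir lie_module_axioms.intro vector_space.intro;
        transfer; rule exI[of _ 0];
        simp add: fs.scale_right_distrib fs.scale_left_distrib V.act_add_left V.act_add_right
          V.act_scale_left V.act_scale_right V.act_bracket)
qed

end

(*
  Let w_k span the weight space of weight a + k, so that d_m t^j w_k = F m j k w_(k+m), and put
  f m k = F m 0 k. The products of coefficients along the closed walks k, k+1, k and k, k+2, k and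
  k, k+2, k+1, k (in both directions) do not depend on the choice of the w_k. The brackets of
  d_1, d_-1, d_2, d_-2 make them satisfy first-order difference equations, so they are polynomials
  in the weight, and the identity expressing the product of the two triangles through the
  2-cycles is an identity of polynomials of degree six. Comparing coefficients kills the central
  charge and leaves exactly one free parameter b, with the invariants of V(a,b). The same invariants
  restrict the support to all of a + Z, all nonzero integers, or {0}. Rescaling the w_k then
  recovers f, except that for b in {0,1} and a = 0 the coefficients into and out of w_0 are a
  cocycle, which gives A_a, B_a and V'(0,0).

  For the loop variable, [d_0 t^i, d_m t^j] = m d_m t^(i+j) shows that along every edge k -> k+m
  with f m k nonzero the coefficients are geometric in j. The ratios of the three edges of a triangle
  agree, because a weighted mean of two geometric sequences with nonzero weights is geometric only
  if they coincide. Since almost all pairs of vertices are joined by an edge, there is a single ratio e.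
*)

theory Submission
  imports Defs "HOL-Computational_Algebra.Polynomial"
begin

section \<open>Coefficients of weight modules and their scaling invariants\<close>

text \<open>Any single \<open>f m k\<close> may vanish, and all of them change under rescaling, so
  nothing can be divided by or normalised at the outset; products along closed walks avoid both
  problems and obey recurrences up to the edge of the support. Indices without a weight vector are
  kept: \<open>S\<close> consists of the others, and every coefficient touching the complement is 0.
  The integration constants \<open>q\<close> of \<open>P1\<close> and \<open>x\<close>,
  \<open>- x\<close> of the two triangles end up on the nodal cubic x^2 = q^2 (1 - 4 q),
  parametrised by q = b - b^2, x = q (1 - 2 b). This rational parameter is the \<open>b\<close> of
  V(a,b). The node q = x = 0 is reached by both b = 0 and b = 1: there the invariants cannot tell
  V(a,0) from V(a,1), and this is where the further modules appear. A missing weight 0 is repaired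
  by adjoining a trivial line, so that only full support has to be classified. Indecomposability
  enters twice: it keeps all weights in one coset of the integers, and it excludes V'(0,0) plus a
  trivial line.\<close>

locale weight_coeffs =
  fixes S :: "int set" and a :: complex and f :: "int \<Rightarrow> int \<Rightarrow> complex" and z :: "int \<Rightarrow> complex"
  assumes d0: "k \<in> S \<Longrightarrow> f 0 k = a + of_int k"
    and supp: "k \<notin> S \<or> k + m \<notin> S \<Longrightarrow> f m k = 0"
    and bracket: "k \<in> S \<Longrightarrow> f m (k + n) * f n k - f n (k + m) * f m k =
      of_int (n - m) * f (m + n) k + (if m = - n then (of_int m ^ 3 - of_int m) / 12 * z k else 0)"
    and central: "z (k + m) * f m k = z k * f m k"
begin

definition wt :: "int \<Rightarrow> complex" where "wt k = a + of_int k"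
text \<open>These products are unchanged when the basis vectors are rescaled.\<close>

definition P1 :: "int \<Rightarrow> complex" where "P1 k = f (-1) (k + 1) * f 1 k"
definition P2 :: "int \<Rightarrow> complex" where "P2 k = f (-2) (k + 2) * f 2 k"
definition X :: "int \<Rightarrow> complex" where "X k = f (-1) (k + 1) * f (-1) (k + 2) * f 2 k"
definition Y :: "int \<Rightarrow> complex" where "Y k = f (-2) (k + 2) * f 1 (k + 1) * f 1 k"

lemma P1_step: "k \<in> S \<Longrightarrow> P1 k - P1 (k - 1) = 2 * wt k"
  using bracket[of k "-1" 1] d0[of k] by (simp add: P1_def wt_def algebra_simps)

lemma P2_step: "k \<in> S \<Longrightarrow> P2 k - P2 (k - 2) = 4 * wt k - z k / 2"
  using bracket[of k "-2" 2] d0[of k] by (simp add: P2_def wt_def algebra_simps)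

text \<open>The relation [d_-1, d_2] = 3 d_1 at \<open>k\<close>, closed up to a walk by
  d_-1.\<close>

lemma X_step:
  assumes "k \<in> S" shows "X k - X (k - 1) = 3 * P1 k"
proof -
  have "f (-1) (k + 2) * f 2 k - f 2 (k - 1) * f (-1) k = 3 * f 1 k"
    using bracket[OF assms, of "-1" 2] by simp
  from arg_cong[OF this, of "\<lambda>t. f (-1) (k + 1) * t"] show ?thesis
    by (simp add: X_def P1_def algebra_simps)
qed

text \<open>The relation [d_-2, d_1] = 3 d_-1 is used at \<open>k + 1\<close>, after the step d_1
  out of \<open>k\<close>. If \<open>k + 1\<close> is outside the support, the common factor
  \<open>f 1 k\<close> makes all terms 0.\<close>

lemma Y_step:
  assumes "k \<in> S" shows "Y k - Y (k - 1) = 3 * P1 k"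
proof (cases "k + 1 \<in> S")
  case True
  have "f (-2) (k + 2) * f 1 (k + 1) - f 1 (k - 1) * f (-2) (k + 1) = 3 * f (-1) (k + 1)"
    using bracket[OF True, of "-2" 1] by (simp add: add.commute)
  from arg_cong[OF this, of "\<lambda>t. t * f 1 k"] show ?thesis
    by (simp add: Y_def P1_def algebra_simps)
next
  case False
  then show ?thesis using supp[of k 1] by (simp add: Y_def P1_def)
qed

text \<open>Both sides run once through the same six directed edges of the triangle
  \<open>k\<close>, \<open>k + 1\<close>, \<open>k + 2\<close>. This relation is what later
  constrains the integration constants.\<close>

lemma XY: "X k * Y k = P1 k * P1 (k + 1) * P2 k"
  by (simp add: X_def Y_def P1_def P2_def algebra_simps)

text \<open>The automorphism d_m -> - d_(-m), c -> - c of the Virasoro algebra reverses the weights,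
  so results on right tails carry over to left tails.\<close>

lemma mirror: "weight_coeffs (uminus ` S) (- a) (\<lambda>m k. - f (- m) (- k)) (\<lambda>k. - z (- k))"
proof
  have mem: "k \<in> uminus ` S \<longleftrightarrow> - k \<in> S" for k
    by (metis (no_types, opaque_lifting) add.inverse_inverse image_iff)
  fix k m n :: int
  show "k \<in> uminus ` S \<Longrightarrow> - f (- 0) (- k) = - a + of_int k"
    using d0[of "- k"] by (simp add: mem)
  show "k \<notin> uminus ` S \<or> k + m \<notin> uminus ` S \<Longrightarrow> - f (- m) (- k) = 0"
    using supp[of "- k" "- m"] by (simp add: mem)
  show "- z (- (k + m)) * - f (- m) (- k) = - z (- k) * - f (- m) (- k)"
    using central[of "- k" "- m"] by simp
  show "k \<in> uminus ` S \<Longrightarrow> - f (- m) (- (k + n)) * - f (- n) (- k) - - f (- n) (- (k + m)) * - f (- m) (- k) =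
      of_int (n - m) * - f (- (m + n)) (- k) +
      (if m = - n then (of_int m ^ 3 - of_int m) / 12 * - z (- k) else 0)"
    using bracket[of "- k" "- m" "- n"] by (auto simp add: mem algebra_simps)
qed

lemma P1_form_step:
  assumes "k \<in> S"
  shows "P1 k - (wt k ^ 2 + wt k) = P1 (k - 1) - (wt (k - 1) ^ 2 + wt (k - 1))"
  using P1_step[OF assms] by (simp add: wt_def power2_eq_square algebra_simps)

text \<open>Put m = \<open>wt k + 1\<close>, the weight of the middle vertex of the triangle. The
  backward difference of m^3 + (3 q - 1) m is 3 (m^2 - m + q) = 3 \<open>P1 k\<close>, as required
  by both recurrences; \<open>X\<close> and \<open>Y\<close> can thus differ only in their
  constants.\<close>

lemma cubic_step:
  assumes "k \<in> S" "P1 k = wt k ^ 2 + wt k + q"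
  shows "X k - ((wt k + 1) ^ 3 + (3 * q - 1) * (wt k + 1)) =
      X (k - 1) - ((wt (k - 1) + 1) ^ 3 + (3 * q - 1) * (wt (k - 1) + 1))"
    "Y k - ((wt k + 1) ^ 3 + (3 * q - 1) * (wt k + 1)) =
      Y (k - 1) - ((wt (k - 1) + 1) ^ 3 + (3 * q - 1) * (wt (k - 1) + 1))"
  using X_step[OF assms(1)] Y_step[OF assms(1)] assms(2)
  by (simp_all add: wt_def power2_eq_square power3_eq_cube algebra_simps)

definition forms :: "complex \<Rightarrow> complex \<Rightarrow> complex \<Rightarrow> int \<Rightarrow> bool" where
  "forms q x y k \<longleftrightarrow> P1 k = wt k ^ 2 + wt k + q \<and>
    X k = (wt k + 1) ^ 3 + (3 * q - 1) * (wt k + 1) + x \<and>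
    Y k = (wt k + 1) ^ 3 + (3 * q - 1) * (wt k + 1) + y"

text \<open>The recurrence at \<open>N\<close> already involves \<open>N - 1\<close>, so the
  formulas hold one step before the range known to lie in \<open>S\<close>.
  \<open>right_tail\<close> evaluates them exactly at this boundary index.\<close>

lemma forms_exist_above:
  assumes "\<And>k. k \<ge> N \<Longrightarrow> k \<in> S"
  shows "\<exists>q x y. \<forall>k \<ge> N - 1. forms q x y k"
proof -
  define q where "q = P1 (N - 1) - (wt (N - 1) ^ 2 + wt (N - 1))"
  let ?T = "\<lambda>k. (wt k + 1) ^ 3 + (3 * q - 1) * (wt k + 1)"
  have 1: "P1 k = wt k ^ 2 + wt k + q" if "k \<ge> N - 1" for k
    using that
  proof (induction k rule: int_ge_induct)
    case (step k)
    then have "k + 1 \<in> S" using assms by simp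
    from P1_form_step[OF this] step.IH show ?case by (simp add: algebra_simps)
  qed (simp add: q_def)
  have 2: "X k = ?T k + (X (N - 1) - ?T (N - 1)) \<and> Y k = ?T k + (Y (N - 1) - ?T (N - 1))"
    if "k \<ge> N - 1" for k
    using that
  proof (induction k rule: int_ge_induct)
    case (step k)
    then have "k + 1 \<in> S" using assms by simp
    from cubic_step[OF this 1] step show ?case by (simp add: algebra_simps)
  qed simp
  show ?thesis unfolding forms_def using 1 2 by blast
qed

lemma forms_exist_full:
  assumes "S = UNIV"
  shows "\<exists>q x y. \<forall>k. forms q x y k"
proof -
  have const: "g k = g 0" if "\<And>k. g k = g (k - 1)" for g :: "int \<Rightarrow> complex" and k
  proof (induction k rule: int_induct[of _ 0])
    case (step1 i)
    then show ?case using that[of "i + 1"] by simp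
  next
    case (step2 i)
    then show ?case using that[of i] by simp
  qed simp
  define q where "q = P1 0 - (wt 0 ^ 2 + wt 0)"
  have 1: "P1 k = wt k ^ 2 + wt k + q" for k
    using const[of "\<lambda>k. P1 k - (wt k ^ 2 + wt k)" k] P1_form_step assms
    by (simp add: q_def algebra_simps)
  let ?T = "\<lambda>k. (wt k + 1) ^ 3 + (3 * q - 1) * (wt k + 1)"
  have 2: "X k - ?T k = X 0 - ?T 0" for k
    by (rule const, rule cubic_step(1)) (use 1 assms in auto)
  have 3: "Y k - ?T k = Y 0 - ?T 0" for k
    by (rule const, rule cubic_step(2)) (use 1 assms in auto)
  have "forms q (X 0 - ?T 0) (Y 0 - ?T 0) k" for k
    unfolding forms_def using 1[of k] 2[of k] 3[of k] by (simp add: algebra_simps)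
  then show ?thesis by blast
qed

end

text \<open>The sample points advance by 2 because \<open>P2_step\<close> links indices of equal
  parity only. Degree five is enough: the terms of degree six in the triangle identity
  cancel.\<close>

lemma quintic_zero:
  fixes c0 c1 c2 c3 c4 c5 :: complex
  assumes "\<And>n::nat. c0 + c1 * (s + 2 * of_nat n) + c2 * (s + 2 * of_nat n) ^ 2
    + c3 * (s + 2 * of_nat n) ^ 3 + c4 * (s + 2 * of_nat n) ^ 4 + c5 * (s + 2 * of_nat n) ^ 5 = 0"
  shows "c0 = 0 \<and> c1 = 0 \<and> c2 = 0 \<and> c3 = 0 \<and> c4 = 0 \<and> c5 = 0"
proof -
  let ?p = "[:c0, c1, c2, c3, c4, c5:]"
  have "range (\<lambda>n::nat. s + 2 * of_nat n) \<subseteq> {x. poly ?p x = 0}"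
    using assms by (auto simp: algebra_simps eval_nat_numeral)
  moreover have "infinite (range (\<lambda>n::nat. s + 2 * of_nat n :: complex))"
    by (rule range_inj_infinite) (auto simp: inj_def)
  ultimately have "infinite {x. poly ?p x = 0}" using infinite_super by blast
  then have "?p = 0" using poly_roots_finite by blast
  then show ?thesis by simp
qed

lemma quadratic_finite_roots:
  fixes a q :: complex
  obtains K where "\<And>k. k \<ge> K \<Longrightarrow> (a + of_int k) ^ 2 + (a + of_int k) + q \<noteq> 0"
proof -
  let ?p = "[:a ^ 2 + a + q, 2 * a + 1, 1:]"
  have "finite {x. poly ?p x = 0}" by (rule poly_roots_finite) simp
  moreover have "of_int ` {k. (a + of_int k) ^ 2 + (a + of_int k) + q = 0} \<subseteq> {x. poly ?p x = 0}"
    by (auto simp: power2_eq_square algebra_simps)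
  ultimately have "finite ((of_int :: int \<Rightarrow> complex) ` {k. (a + of_int k) ^ 2 + (a + of_int k) + q = 0})"
    using finite_subset by blast
  then have "finite {k. (a + of_int k) ^ 2 + (a + of_int k) + q = 0}"
    by (rule finite_imageD) (simp add: inj_on_def)
  then obtain B where "\<And>k. k \<in> {k. (a + of_int k) ^ 2 + (a + of_int k) + q = 0} \<Longrightarrow> k \<le> B"
    by (metis bdd_above.E bdd_above_finite)
  then show thesis by (intro that[of "B + 1"]) force
qed

context weight_coeffs
begin

text \<open>With m = \<open>wt k + 1\<close>, the relation between \<open>x\<close> and
  \<open>q\<close> makes \<open>X k * Y k\<close> divisible by the two values of \<open>P1\<close>:
  (m^3 + (3 q - 1) m)^2 + q^2 (4 q - 1) = (m^2 - m + q) (m^2 + m + q) (m^2 + 4 q - 1).\<close>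

lemma P2_of_forms:
  assumes "forms q x (- x) k" "forms q x (- x) (k + 1)" "- x\<^sup>2 = q\<^sup>2 * (4 * q - 1)"
    "P1 k \<noteq> 0" "P1 (k + 1) \<noteq> 0"
  shows "P2 k = (wt k + 1) ^ 2 + 4 * q - 1"
proof -
  let ?m = "wt k + 1"
  have w: "wt (k + 1) = ?m" by (simp add: wt_def)
  have p: "P1 k = ?m ^ 2 - ?m + q" "P1 (k + 1) = ?m ^ 2 + ?m + q"
    using assms(1,2) w by (simp_all add: forms_def power2_eq_square algebra_simps)
  have "X k * Y k = (?m ^ 3 + (3 * q - 1) * ?m) ^ 2 + - x\<^sup>2"
  proof -
    have XYk: "X k = ?m ^ 3 + (3 * q - 1) * ?m + x" "Y k = ?m ^ 3 + (3 * q - 1) * ?m + - x"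
      using assms(1) by (simp_all add: forms_def)
    show ?thesis unfolding XYk by (simp only: power2_eq_square) (simp add: algebra_simps)
  qed
  also have "\<dots> = (?m ^ 2 - ?m + q) * (?m ^ 2 + ?m + q) * (?m ^ 2 + 4 * q - 1)"
    unfolding assms(3) by (simp add: power2_eq_square power3_eq_cube algebra_simps)
  finally have "P1 k * P1 (k + 1) * P2 k = P1 k * P1 (k + 1) * (?m ^ 2 + 4 * q - 1)"
    unfolding XY p .
  then show ?thesis using assms(4,5) by simp
qed

text \<open>All four products are polynomials in m = \<open>wt k + 1\<close> along a tail, so
  \<open>XY\<close> can be compared coefficientwise: m^5 gives \<gamma> = 0, m^4 gives \<kappa> = 4
  q - 1, then m^3 gives y = - x, and the constant term gives the cubic relation.\<close>

lemma tail_coeffs: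
  assumes S: "\<And>k. k \<ge> N \<Longrightarrow> k \<in> S" and forms: "\<And>k. k \<ge> N \<Longrightarrow> forms q x y k"
  shows "y = - x" "- x\<^sup>2 = q\<^sup>2 * (4 * q - 1)" "\<exists>K. \<forall>k\<ge>K. z k = 0"
proof -
  obtain K0 where K0: "\<And>k. k \<ge> K0 \<Longrightarrow> (a + of_int k) ^ 2 + (a + of_int k) + q \<noteq> 0"
    using quadratic_finite_roots by blast
  define K where "K = max K0 N"
  have nz: "f 1 k \<noteq> 0" if "k \<ge> K" for k
    using K0[of k] forms[of k] that by (auto simp: K_def forms_def P1_def wt_def)
  have zc: "z k = z K" if "k \<ge> K" for k
    using that
  proof (induction k rule: int_ge_induct)
    case (step k)
    then show ?case using central[of k 1] nz[of k] by simp
  qed simp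
  \<comment> \<open>Far out \<open>z\<close> is constant, and \<open>P2\<close> grows by 4
    \<open>wt k\<close> - z/2 per step of 2; the polynomial m^2 - \<gamma> m + \<kappa> grows by 4
    \<open>wt k\<close> - 2 \<gamma>, whence \<gamma> = z/4.\<close>
  define \<gamma> where "\<gamma> = z K / 4"
  define s where "s = wt K + 1"
  define \<kappa> where "\<kappa> = P2 K - s ^ 2 + \<gamma> * s"
  have P2: "P2 (K + 2 * int n) = (s + 2 * of_nat n) ^ 2 - \<gamma> * (s + 2 * of_nat n) + \<kappa>" for n
  proof (induction n)
    case 0
    then show ?case by (simp add: \<kappa>_def)
  next
    case (Suc n)
    let ?k = "K + 2 * int (Suc n)"
    have "?k \<in> S" by (rule S) (simp add: K_def)
    from P2_step[OF this] have "P2 ?k = P2 (K + 2 * int n) + 4 * wt ?k - 2 * \<gamma>"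
      using zc[of ?k] by (simp add: \<gamma>_def algebra_simps)
    then show ?case unfolding Suc by (simp add: s_def wt_def power2_eq_square algebra_simps)
  qed
  have "(x * y - q\<^sup>2 * \<kappa>) + ((3 * q - 1) * (x + y) + \<gamma> * q\<^sup>2) * m
      + ((3 * q - 1) ^ 2 - q\<^sup>2 - \<kappa> * (2 * q - 1)) * m ^ 2
      + (x + y + \<gamma> * (2 * q - 1)) * m ^ 3 + (2 * (3 * q - 1) - (2 * q - 1) - \<kappa>) * m ^ 4
      + \<gamma> * m ^ 5 = 0" if m: "m = s + 2 * of_nat n" for n m
  proof -
    let ?k = "K + 2 * int n"
    have wk: "wt ?k + 1 = m" "wt (?k + 1) = m" by (simp_all add: m s_def wt_def)
    have fk: "forms q x y ?k" "forms q x y (?k + 1)" by (auto intro!: forms simp: K_def)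
    have p: "P1 ?k = m ^ 2 - m + q" "P1 (?k + 1) = m ^ 2 + m + q"
      using fk wk(2) unfolding forms_def wk(1)[symmetric] by (simp_all add: power2_eq_square algebra_simps)
    have "(m ^ 3 + (3 * q - 1) * m + x) * (m ^ 3 + (3 * q - 1) * m + y) =
      (m ^ 2 - m + q) * (m ^ 2 + m + q) * (m ^ 2 - \<gamma> * m + \<kappa>)"
      using XY[of ?k] P2[of n] fk p unfolding m[symmetric] forms_def wk by simp
    then show ?thesis by (simp add: eval_nat_numeral algebra_simps)
  qed
  from quintic_zero[OF this, OF refl]
  have *: "x * y - q\<^sup>2 * \<kappa> = 0" "x + y + \<gamma> * (2 * q - 1) = 0"
    "2 * (3 * q - 1) - (2 * q - 1) - \<kappa> = 0" "\<gamma> = 0"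
    by blast+
  then show y: "y = - x" by (simp add: add_eq_0_iff)
  have "\<kappa> = 4 * q - 1" using *(3) by (simp add: algebra_simps)
  then show "- x\<^sup>2 = q\<^sup>2 * (4 * q - 1)" using *(1) y by (simp add: power2_eq_square)
  have "z K = 0" using *(4) by (simp add: \<gamma>_def)
  then show "\<exists>K. \<forall>k\<ge>K. z k = 0" using zc by metis
qed

end

section \<open>The support\<close>

context weight_coeffs
begin

lemma wt_add: "wt (k + n) = wt k + of_int n"
  by (simp add: wt_def)

lemma supp_endpoints [simp]:
  assumes "k \<notin> S"
  shows "f m k = 0" "f m (k - m) = 0"
  using assms supp[of k m] supp[of "k - m" m] by auto

text \<open>Let n be the length of the run. \<open>P1\<close> vanishes just before the run and at
  its end, which makes the weights symmetric about 0; \<open>X\<close> then vanishes just before the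
  run and at \<open>y - 1\<close>, which forces (n - 1) n (n + 1) = 0.\<close>

lemma finite_run_trivial:
  assumes run: "\<And>k. x \<le> k \<Longrightarrow> k \<le> y \<Longrightarrow> k \<in> S" and "x \<le> y" "x - 1 \<notin> S" "y + 1 \<notin> S"
  shows "y = x \<and> wt x = 0"
proof -
  have P1: "P1 (x - 1 + int n) = of_nat n * (2 * wt x + of_nat n - 1)" if "n \<le> nat (y - x + 1)" for n
    using that
  proof (induction n)
    case 0
    then show ?case using assms by (simp add: P1_def)
  next
    case (Suc n)
    have "x - 1 + int (Suc n) \<in> S" using Suc.prems \<open>x \<le> y\<close> by (intro run) auto
    from P1_step[OF this] Suc show ?case by (simp add: wt_def algebra_simps)
  qed
  define n where "n = nat (y - x + 1)"
  have n: "x - 1 + int n = y" "n \<ge> 1" using \<open>x \<le> y\<close> by (simp_all add: n_def)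
  have "P1 y = 0" using assms by (simp add: P1_def)
  then have "of_nat n * (2 * wt x + of_nat n - 1) = 0" using P1[of n] n by (simp add: n_def)
  then have "2 * wt x + of_nat n - 1 = 0" using n(2) by simp
  then have w: "2 * wt x = 1 - of_nat n" by (simp add: algebra_simps)
  have X: "2 * X (x - 1 + int i) = of_nat i * (of_nat i + 1) * (2 * of_nat i + 1 - 3 * of_nat n)" if "i \<le> n" for i
    using that
  proof (induction i)
    case 0
    then show ?case using assms by (simp add: X_def)
  next
    case (Suc i)
    have "x - 1 + int (Suc i) \<in> S" using Suc.prems n \<open>x \<le> y\<close> by (intro run) auto
    from X_step[OF this] have X: "X (x - 1 + int (Suc i)) = X (x - 1 + int i) + 3 * P1 (x - 1 + int (Suc i))"
      by (simp add: algebra_simps)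
    have p: "P1 (x - 1 + int (Suc i)) = of_nat (Suc i) * (of_nat (Suc i) - of_nat n)"
      using P1[of "Suc i"] Suc.prems w unfolding n_def[symmetric] by simp
    then show ?case unfolding X p distrib_left using Suc by (simp add: algebra_simps)
  qed
  have "X (y - 1) = 0" using supp_endpoints(2)[of "y + 1" 2] assms by (simp add: X_def)
  moreover have "2 * X (y - 1) = of_nat (n - 1) * (of_nat (n - 1) + 1) * (2 * of_nat (n - 1) + 1 - 3 * of_nat n)"
    using X[of "n - 1"] n by (simp add: of_nat_diff algebra_simps)
  ultimately have "of_nat (n - 1) * of_nat n * (of_nat n + 1 :: complex) = 0"
    using n(2) by (simp add: of_nat_diff algebra_simps)
  then have "n = 1" using n(2) by (simp add: add_eq_0_iff)
     (metis of_nat_1 of_nat_add of_nat_eq_0_iff add.commute neg_eq_iff_add_eq_0 add_is_0 one_neq_zero)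
  then show ?thesis using n w by simp
qed

text \<open>All four products vanish at the boundary index \<open>x - 1\<close>. For
  \<open>P1\<close>, \<open>X\<close>, \<open>Y\<close> this leaves only 0, 1, 1/2 as the weight of
  \<open>x\<close>, and \<open>P2\<close> rules out all but 1. Then \<open>P2 (x - 2)\<close> = -1,
  so the support resumes beyond the gap.\<close>

lemma right_tail:
  assumes run: "\<And>k. x \<le> k \<Longrightarrow> k \<in> S" and x: "x - 1 \<notin> S"
  shows "wt x = 1 \<and> x - 2 \<in> S"
proof -
  define l where "l = wt x"
  have w: "wt (x - 1) = l - 1" "wt (x + 1) = l + 1" "wt (x + 2) = l + 2"
    by (simp_all add: wt_def l_def)
  obtain q s t where F: "\<And>k. k \<ge> x - 1 \<Longrightarrow> forms q s t k"
    using forms_exist_above[of x] run by blast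
  have F': "\<And>k. k \<ge> x \<Longrightarrow> forms q s t k" using F by simp
  note tc = tail_coeffs[of x, OF run F']
  have 0: "P1 (x - 1) = 0" "X (x - 1) = 0" "Y (x - 1) = 0"
    using x by (simp_all add: P1_def X_def Y_def)
  have "s = t" using F[of "x - 1"] 0 unfolding forms_def by (metis add_left_cancel order_refl)
  then have s: "s = 0" "t = 0" using tc(1) by (simp_all add: eq_neg_iff_add_eq_0)
  have q: "q = - (l\<^sup>2 - l)" using F[of "x - 1"] 0 by (simp add: forms_def w power2_eq_square algebra_simps)
  have "q * (4 * q - 1) = 0" using tc(2) s by auto
  then have "(l * (l - 1)) * (2 * l - 1) ^ 2 = 0" unfolding q
    by (simp add: power2_eq_square algebra_simps)
  then have l: "l = 0 \<or> l = 1 \<or> l = 1 / 2" by (auto simp: field_simps)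
  have P1nz: "P1 k \<noteq> 0" if "k \<ge> x + 1" for k
  proof -
    define n where "n = nat (k - x)"
    have n: "wt k = l + of_nat n" "n \<ge> 1" using that by (simp_all add: n_def l_def wt_def)
    have "P1 k = (2 * l + of_nat n) * (of_nat n + 1)"
      using F[of k] that by (simp add: forms_def n q power2_eq_square algebra_simps)
    moreover obtain j :: nat where "2 * l = of_nat j"
      using l by (elim disjE) (auto intro: that[of 0] that[of 1] that[of 2])
    then have "2 * l + of_nat n = of_nat (j + n)" by simp
    then have "2 * l + of_nat n \<noteq> 0" using n(2) by (metis add_is_0 not_one_le_zero of_nat_eq_0_iff)
    moreover have "(of_nat n + 1 :: complex) \<noteq> 0"
      by (metis of_nat_eq_0_iff of_nat_Suc add.commute nat.distinct(1))
    ultimately show ?thesis by simp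
  qed
  obtain K where K: "\<And>k. k \<ge> K \<Longrightarrow> z k = 0" using tc(3) by blast
  \<comment> \<open>The eigenvalue of c is constant along nonzero d_1 edges and 0 far out. The first
    edge, at \<open>x\<close>, is the only one of the tail that may vanish.\<close>
  have z0: "z k = 0" if "P1 k \<noteq> 0" "k \<ge> x" for k
  proof -
    have "z (k + int n) = z k" for n
    proof (induction n)
      case (Suc n)
      have "P1 (k + int n) \<noteq> 0" using that P1nz[of "k + int n"] by (cases n) auto
      then have "f 1 (k + int n) \<noteq> 0" by (auto simp: P1_def)
      then show ?case using central[of "k + int n" 1] Suc by (simp add: ac_simps)
    qed simp
    from this[of "nat (K - k)"] K[of "k + int (nat (K - k))"] show ?thesis by simp
  qed
  have P2x: "P2 k = (wt k + 1) ^ 2 + 4 * q - 1" if "P1 k \<noteq> 0" "k \<ge> x" for k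
    by (rule P2_of_forms[of q s]) (use F that P1nz[of "k + 1"] tc(1,2) in auto)
  have "P2 (x - 1) = 0" using x by (simp add: P2_def)
  moreover have "P2 (x + 1) - P2 (x - 1) = 4 * (l + 1)"
    using P2_step[of "x + 1"] run[of "x + 1"] z0[of "x + 1"] P1nz[of "x + 1"] w by simp
  moreover have "P2 (x + 1) = (l + 2) ^ 2 + 4 * q - 1"
    using P2x[of "x + 1"] P1nz[of "x + 1"] w by (simp add: algebra_simps)
  \<comment> \<open>With q = l - l^2 this says (l - 1) (3 l - 1) = 0, so only l = 1 survives among
    the three candidates.\<close>
  ultimately have "(l + 2) ^ 2 + 4 * q - 1 = 4 * (l + 1)" by simp
  then have l1: "l = 1" using l unfolding q by (elim disjE) (simp_all add: power2_eq_square)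
  have "P1 x \<noteq> 0" using F[of x] l1 by (simp add: forms_def q l_def[symmetric])
  from P2x[OF this] z0[OF this] have "P2 x = 3" "z x = 0"
    using l1 by (simp_all add: q l_def[symmetric])
  then have "1 + P2 (x - 2) = 0" using P2_step[of x] run[of x] l1 by (simp add: l_def[symmetric] algebra_simps)
  then have "P2 (x - 2) \<noteq> 0" by auto
  then have "x - 2 \<in> S" using supp_endpoints(1)[of "x - 2" 2] unfolding P2_def by (metis mult_zero_right)
  then show ?thesis using l1 by (simp add: l_def)
qed

end

section \<open>Maximal runs in a set of integers\<close>

lemma run_right:
  fixes S :: "int set"
  assumes "s \<in> S"
  shows "(\<forall>k\<ge>s. k \<in> S) \<or> (\<exists>y\<ge>s. y + 1 \<notin> S \<and> (\<forall>k. s \<le> k \<and> k \<le> y \<longrightarrow> k \<in> S))"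
proof (cases "\<forall>k\<ge>s. k \<in> S")
  case False
  then obtain k where k: "k \<ge> s" "k \<notin> S" by blast
  define n where "n = (LEAST n. s + int n \<notin> S)"
  have ex: "s + int (nat (k - s)) \<notin> S" using k by simp
  have n: "s + int n \<notin> S" unfolding n_def by (rule LeastI[of "\<lambda>n. s + int n \<notin> S", OF ex])
  have less: "s + int i \<in> S" if "i < n" for i
    using not_less_Least[OF that[unfolded n_def]] by simp
  have "n \<noteq> 0" using n assms by (cases n) auto
  then have "\<forall>k. s \<le> k \<and> k \<le> s + int n - 1 \<longrightarrow> k \<in> S"
    using less[of "nat (k - s)" for k] by (metis (no_types, opaque_lifting) add_diff_cancel_left' add.commute diff_add_cancel int_nat_eq less nat_less_iff zle_diff1_eq diff_ge_0_iff_ge diff_less_eq)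
  then show ?thesis using n \<open>n \<noteq> 0\<close> by (intro disjI2 exI[of _ "s + int n - 1"]) auto
qed simp

lemma run_left:
  fixes S :: "int set"
  assumes "s \<in> S"
  shows "(\<forall>k\<le>s. k \<in> S) \<or> (\<exists>x\<le>s. x - 1 \<notin> S \<and> (\<forall>k. x \<le> k \<and> k \<le> s \<longrightarrow> k \<in> S))"
proof -
  have mem: "k \<in> uminus ` S \<longleftrightarrow> - k \<in> S" for k
    by (metis (no_types, opaque_lifting) add.inverse_inverse image_iff)
  from run_right[of "- s" "uminus ` S"] assms consider
    "\<forall>k\<ge>-s. - k \<in> S" | y where "y \<ge> - s" "- (y + 1) \<notin> S" "\<forall>k. - s \<le> k \<and> k \<le> y \<longrightarrow> - k \<in> S"
    unfolding mem by auto
  then show ?thesis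
  proof cases
    case 1
    then show ?thesis by (metis add.inverse_inverse neg_le_iff_le)
  next
    case 2
    have "k \<in> S" if "- y \<le> k \<and> k \<le> s" for k
      using 2(3)[rule_format, of "- k"] that by simp
    then show ?thesis using 2 by (intro disjI2 exI[of _ "- y"]) auto
  qed
qed

context weight_coeffs
begin

lemma wt_inj: "wt j = wt k \<longleftrightarrow> j = k"
  by (simp add: wt_def)

text \<open>If the part left of the gap were bounded below, the run ending at \<open>x - 2\<close>
  would be finite and so a point of weight 0; but \<open>x - 2\<close> has weight -1.\<close>

lemma right_tail_support:
  assumes run: "\<And>k. x \<le> k \<Longrightarrow> k \<in> S" and x: "x - 1 \<notin> S"
  shows "wt (x - 1) = 0 \<and> S = - {x - 1}"
proof -
  from right_tail[OF assms] have w: "wt x = 1" and s: "x - 2 \<in> S" by auto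
  have "k \<in> S" if "k \<le> x - 2" for k
  proof (cases "\<forall>k\<le>x - 2. k \<in> S")
    case False
    then obtain y where y: "y \<le> x - 2" "y - 1 \<notin> S" "\<And>k. y \<le> k \<Longrightarrow> k \<le> x - 2 \<Longrightarrow> k \<in> S"
      using run_left[OF s] by blast
    have "x - 2 = y \<and> wt y = 0"
      by (rule finite_run_trivial) (use x y in \<open>auto simp: algebra_simps\<close>)
    then have "wt (x - 2) = 0" by simp
    then show ?thesis using w wt_add[of "x - 2" 2] by simp
  qed (use that in auto)
  then have "S = - {x - 1}" using run x by (auto) (metis add_le_cancel_right diff_add_cancel diff_diff_eq linorder_not_le one_add_one order_less_le zle_diff1_eq)
  then show ?thesis using w wt_add[of "x - 1" 1] by simp
qed

text \<open>An infinite tail that ends does so at a hole of weight 0, left tails being treated by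
  \<open>mirror\<close>. If there is no such tail and \<open>S\<close> is not everything, all runs
  are finite, hence points of weight 0, and distinct indices have distinct weights.\<close>

lemma support:
  assumes "S \<noteq> {}"
  shows "S = UNIV \<or> (\<exists>x. wt x = 0 \<and> (S = {x} \<or> S = - {x}))"
proof (cases "\<exists>x. (\<forall>k\<ge>x. k \<in> S) \<and> x - 1 \<notin> S")
  case True
  then show ?thesis using right_tail_support by blast
next
  case R: False
  show ?thesis
  proof (cases "\<exists>y. (\<forall>k\<le>y. k \<in> S) \<and> y + 1 \<notin> S")
    case True
    then obtain y where y: "\<And>k. k \<le> y \<Longrightarrow> k \<in> S" "y + 1 \<notin> S" by blast
    interpret m: weight_coeffs "uminus ` S" "- a" "\<lambda>m k. - f (- m) (- k)" "\<lambda>k. - z (- k)"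
      by (rule mirror)
    have mem: "k \<in> uminus ` S \<longleftrightarrow> - k \<in> S" for k
      by (metis (no_types, opaque_lifting) add.inverse_inverse image_iff)
    have "m.wt (- y - 1) = 0 \<and> uminus ` S = - {- y - 1}"
      by (rule m.right_tail_support) (use y in \<open>auto simp: mem add.commute\<close>)
    moreover have "m.wt (- y - 1) = - wt (y + 1)" by (simp add: wt_def m.wt_def)
    ultimately have "wt (y + 1) = 0" and 1: "uminus ` S = - {- y - 1}" by auto
    moreover have "k \<in> S \<longleftrightarrow> k \<noteq> y + 1" for k
      using mem[of "- k"] unfolding 1 by auto
    then have "S = - {y + 1}" by auto
    ultimately show ?thesis by blast
  next
    case L: False
    show ?thesis
    proof (cases "S = UNIV")
      case False
      have *: "wt s = 0 " if sS: "s \<in> S" for s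
      proof -
        have "\<not> (\<forall>k\<ge>s. k \<in> S)"
        proof
          assume r: "\<forall>k\<ge>s. k \<in> S"
          consider "\<forall>k\<le>s. k \<in> S" | x where "x \<le> s" "x - 1 \<notin> S" "\<forall>k. x \<le> k \<and> k \<le> s \<longrightarrow> k \<in> S"
            using run_left[OF sS] by blast
          then show False
          proof cases
            case 1
            with r have "S = UNIV" by (auto) (meson linear)
            with False show ?thesis by simp
          next
            case 2
            with r R show ?thesis by (meson linear)
          qed
        qed
        then obtain y where y: "y \<ge> s" "y + 1 \<notin> S" "\<forall>k. s \<le> k \<and> k \<le> y \<longrightarrow> k \<in> S"
          using run_right[OF sS] by blast
        have "\<not> (\<forall>k\<le>s. k \<in> S)"
          using y L by (meson linear)
        then obtain x where x: "x \<le> s" "x - 1 \<notin> S" "\<forall>k. x \<le> k \<and> k \<le> s \<longrightarrow> k \<in> S"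
          using run_left[OF sS] by blast
        have "y = x \<and> wt x = 0"
          by (rule finite_run_trivial) (use x y in \<open>auto intro: linear, meson linear\<close>)
        then show ?thesis using x y by auto
      qed
      obtain s where s: "s \<in> S" using assms by blast
      have "S = {s}" using * s wt_inj by (metis (no_types, opaque_lifting) is_singletonI' is_singleton_the_elem singletonD empty_iff)
      then show ?thesis using * s by blast
    qed simp
  qed
qed

end

section \<open>Normalising the invariants\<close>

text \<open>This adjoins a trivial one-dimensional summand of weight 0. All coefficients touching
  index 0 are 0 already; only the value of \<open>z\<close> there has to be reset.\<close>

lemma weight_coeffs_fill_zero:
  assumes "weight_coeffs (- {0}) 0 f z"
  shows "weight_coeffs UNIV 0 f (z(0 := 0))"
proof -
  interpret weight_coeffs "- {0}" 0 f z by fact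
  have 0: "f m 0 = 0" "f m (- m) = 0" for m using supp[of 0 m] supp[of "- m" m] by auto
  have "f m (k + n) * f n k - f n (k + m) * f m k =
      of_int (n - m) * f (m + n) k + (if m = - n then (of_int m ^ 3 - of_int m) / 12 * (z(0 := 0)) k else 0)"
    for k m n
    by (cases "k = 0") (use bracket[of k m n] 0 in auto)
  moreover have "f 0 k = 0 + of_int k" for k
    by (cases "k = 0") (use d0[of k] 0 in auto)
  moreover have "(z(0 := 0)) (k + m) * f m k = (z(0 := 0)) k * f m k" for k m
  proof (cases "k = 0 \<or> k + m = 0")
    case True
    then have "f m k = 0" using 0(1)[of m] 0(2)[of m] by (auto simp: add_eq_0_iff2)
    then show ?thesis by simp
  qed (use central[of k m] in auto)
  ultimately show ?thesis by unfold_locales auto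
qed

text \<open>\<open>z\<close> is 0 far out on both sides. If \<open>z k\<close> were nonzero,
  commuting with c would make d_m and d_-m kill w_k for all large m, and [d_-m, d_m] would give 24
  \<open>wt k\<close> = (m^2 - 1) \<open>z k\<close> for all these m.\<close>

lemma central_zero:
  assumes "weight_coeffs UNIV a f z"
  shows "z k = 0"
proof -
  interpret weight_coeffs UNIV a f z by fact
  have right: "\<exists>K. \<forall>k\<ge>K. z k = 0" if "weight_coeffs UNIV a f z" for a f z
  proof -
    interpret w: weight_coeffs UNIV a f z by fact
    obtain q x y where "\<And>k. w.forms q x y k" using w.forms_exist_full by blast
    then show ?thesis using w.tail_coeffs(3)[of 0 q x y] by simp
  qed
  obtain K where K: "\<And>k. k \<ge> K \<Longrightarrow> z k = 0" using right[OF assms] by blast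
  have "surj (uminus :: int \<Rightarrow> int)" by (rule surjI[of _ uminus]) simp
  then have "weight_coeffs UNIV (- a) (\<lambda>m k. - f (- m) (- k)) (\<lambda>k. - z (- k))"
    using mirror by simp
  from right[OF this] obtain L where "\<And>k. k \<ge> L \<Longrightarrow> - z (- k) = 0" by blast
  then have L: "z k = 0" if "k \<le> - L" for k using that by (metis add.inverse_inverse le_minus_iff neg_equal_0_iff_equal)
  show ?thesis
  proof (rule ccontr)
    assume zk: "z k \<noteq> 0"
    define n where "n = max 1 (max (K - k) (k + L))"
    have eq: "24 * wt k = (of_int m ^ 2 - 1) * z k" if "m \<ge> n" for m
    proof -
      have "m \<noteq> 0" using that by (simp add: n_def)
      have "z (k + m) = 0" "z (k - m) = 0" using K[of "k + m"] L[of "k - m"] that by (simp_all add: n_def)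
      then have "f m k = 0" "f (- m) k = 0"
        using central[of k m] central[of k "- m"] zk by auto
      then have "2 * of_int m * wt k + ((- of_int m) ^ 3 - (- of_int m)) / 12 * z k = 0"
        using bracket[of k "- m" m] d0[of k] by (simp add: wt_def)
      then have *: "2 * of_int m * wt k = (of_int m ^ 3 - of_int m) / 12 * z k"
        by (simp add: field_simps)
      have "of_int m * (24 * wt k) = 12 * (2 * of_int m * wt k)" by simp
      also have "\<dots> = (of_int m ^ 3 - of_int m) * z k" unfolding * by simp
      also have "\<dots> = of_int m * ((of_int m ^ 2 - 1) * z k)"
        by (simp add: power2_eq_square power3_eq_cube algebra_simps)
      finally have "of_int m * (24 * wt k) = of_int m * ((of_int m ^ 2 - 1) * z k)" .
      then show ?thesis using \<open>m \<noteq> 0\<close> by simp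
    qed
    have "(of_int (n + 1) ^ 2 - of_int n ^ 2) * z k = 0"
      using eq[of n] eq[of "n + 1"] by (auto simp: algebra_simps)
    then have "of_int (2 * n + 1) * z k = 0" by (simp add: power2_eq_square algebra_simps)
    then have "of_int (2 * n + 1) = (0 :: complex)" using zk by (metis mult_eq_0_iff)
    then show False by (simp only: of_int_eq_0_iff) presburger
  qed
qed

text \<open>The right-hand sides are the products computed for V(a,b), where the coefficient of d_m
  at \<open>k\<close> is \<open>wt k\<close> + m b.\<close>

locale normal_invariants = weight_coeffs UNIV a f z for a f z +
  fixes b :: complex
  assumes inv1: "f (-1) (k + 1) * f 1 k = (wt k + b) * (wt k + 1 - b)"
    and invX: "f (-1) (k + 1) * f (-1) (k + 2) * f 2 k = (wt k + 2 * b) * (wt k + 1 - b) * (wt k + 2 - b)"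
    and invY: "f (-2) (k + 2) * f 1 (k + 1) * f 1 k = (wt k + 2 - 2 * b) * (wt k + b) * (wt k + 1 + b)"
    and inv2: "f (-2) (k + 2) * f 2 k = (wt k + 2 * b) * (wt k + 2 - 2 * b)"

lemma normal_invariants_exist:
  assumes "weight_coeffs UNIV a f z"
  shows "\<exists>b. normal_invariants a f z b"
proof -
  interpret weight_coeffs UNIV a f z by fact
  obtain q x y where F: "\<And>k. forms q x y k" using forms_exist_full by blast
  have y: "y = - x" and x: "- x\<^sup>2 = q\<^sup>2 * (4 * q - 1)"
    using tail_coeffs(1,2)[of 0 q x y] F by auto
  \<comment> \<open>The relation between \<open>x\<close> and \<open>q\<close> fixes
    \<open>x\<close> only up to sign. The root of 1 - 4 q, that is, \<open>b\<close> rather than 1 -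
    b, is chosen to match that sign.\<close>
  define r where "r = csqrt (1 - 4 * q)"
  have r: "r\<^sup>2 = 1 - 4 * q" by (simp add: r_def)
  have "x\<^sup>2 = (q * r)\<^sup>2" using x by (simp add: power_mult_distrib r algebra_simps)
  then have "x = q * r \<or> x = - (q * r)" by (simp only: power2_eq_iff)
  then obtain e where e: "e = r \<or> e = - r" "x = - q * e"
    by (metis minus_minus mult_minus_left mult_minus_right)
  define b where "b = (1 + e) / 2"
  have "b - b\<^sup>2 = (1 - e\<^sup>2) / 4" by (simp add: b_def power2_eq_square field_simps)
  also have "e\<^sup>2 = r\<^sup>2" using e(1) by auto
  finally have q: "q = b - b\<^sup>2" unfolding r by simp
  have xb: "x = - q * (2 * b - 1)" using e(2) by (simp add: b_def field_simps)
  have P2: "P2 k = (wt k + 2 * b) * (wt k + 2 - 2 * b)" for k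
  proof -
    \<comment> \<open>\<open>P2_of_forms\<close> needs nonzero \<open>P1\<close> and is applied only
      far to the right; the error term \<open>?D\<close> has period 2, so it vanishes
      everywhere.\<close>
    let ?D = "\<lambda>k. P2 k - (wt k + 2 * b) * (wt k + 2 - 2 * b)"
    have step: "?D k = ?D (k - 2)" for k
      using P2_step[of k] central_zero[OF assms, of k]
      by (simp add: wt_def algebra_simps)
    have D: "?D (k + 2 * int n) = ?D k" for n
    proof (induction n)
      case (Suc n)
      have "k + 2 * int (Suc n) - 2 = k + 2 * int n" by simp
      then show ?case using step[of "k + 2 * int (Suc n)"] Suc by metis
    qed simp
    obtain K where K: "\<And>k. k \<ge> K \<Longrightarrow> (a + of_int k) ^ 2 + (a + of_int k) + q \<noteq> 0"
      using quadratic_finite_roots by blast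
    have nz: "P1 k \<noteq> 0" if "k \<ge> K" for k using K[OF that] F[of k] by (simp add: forms_def wt_def)
    define n where "n = nat (K - k)"
    let ?k = "k + 2 * int n"
    have "P2 ?k = (wt ?k + 1) ^ 2 + 4 * q - 1"
      by (rule P2_of_forms[of q x]) (use F y x in \<open>auto intro!: nz simp: n_def\<close>)
    then have "?D ?k = 0" unfolding q by (simp add: power2_eq_square algebra_simps)
    then show ?thesis using D by simp
  qed
  have "normal_invariants_axioms a f b"
  proof
    fix k
    show "f (-1) (k + 1) * f 1 k = (wt k + b) * (wt k + 1 - b)"
      using F[of k] q by (simp add: forms_def P1_def power2_eq_square algebra_simps)
    show "f (-1) (k + 1) * f (-1) (k + 2) * f 2 k = (wt k + 2 * b) * (wt k + 1 - b) * (wt k + 2 - b)"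
      using F[of k] unfolding forms_def X_def xb q by (simp add: power2_eq_square power3_eq_cube algebra_simps)
    show "f (-2) (k + 2) * f 1 (k + 1) * f 1 k = (wt k + 2 - 2 * b) * (wt k + b) * (wt k + 1 + b)"
      using F[of k] unfolding forms_def Y_def y xb q by (simp add: power2_eq_square power3_eq_cube algebra_simps)
    show "f (-2) (k + 2) * f 2 k = (wt k + 2 * b) * (wt k + 2 - 2 * b)"
      using P2[of k] by (simp add: P2_def)
  qed
  then show ?thesis unfolding normal_invariants_def using assms by blast
qed

section \<open>Rescaling the basis vectors\<close>

text \<open>The coefficients with respect to the rescaled basis \<open>u k w\<^sub>k\<close>.\<close>

definition regauge :: "(int \<Rightarrow> complex) \<Rightarrow> (int \<Rightarrow> int \<Rightarrow> complex) \<Rightarrow> int \<Rightarrow> int \<Rightarrow> complex" where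
  "regauge u f m k = f m k * u k / u (k + m)"

lemma weight_coeffs_regauge:
  assumes "weight_coeffs UNIV a f z" and u: "\<And>k. u k \<noteq> 0"
  shows "weight_coeffs UNIV a (regauge u f) z"
proof -
  interpret weight_coeffs UNIV a f z by fact
  show ?thesis
  proof
    fix k m n
    have "regauge u f m (k + n) * regauge u f n k - regauge u f n (k + m) * regauge u f m k =
       (f m (k + n) * f n k - f n (k + m) * f m k) * (u k / u (k + (m + n)))"
      using u by (simp add: regauge_def field_simps)
    also have "\<dots> = of_int (n - m) * regauge u f (m + n) k +
           (if m = - n then (of_int m ^ 3 - of_int m) / 12 * z k else 0)"
      unfolding bracket[OF UNIV_I] distrib_right using u by (cases "m = - n") (auto simp: regauge_def)
    finally show "regauge u f m (k + n) * regauge u f n k - regauge u f n (k + m) * regauge u f m k =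
       of_int (n - m) * regauge u f (m + n) k +
           (if m = - n then (of_int m ^ 3 - of_int m) / 12 * z k else 0)" .
  qed (use d0 central u in \<open>auto simp: regauge_def\<close>)
qed

lemma normal_invariants_regauge:
  assumes "normal_invariants a f z b" and u: "\<And>k. u k \<noteq> 0"
  shows "normal_invariants a (regauge u f) z b"
proof -
  interpret normal_invariants a f z b by fact
  interpret g: weight_coeffs UNIV a "regauge u f" z
    by (rule weight_coeffs_regauge) (use u weight_coeffs_axioms in auto)
  have k: "k + 1 + 1 = k + 2" "k + 2 - 1 = k + 1" for k :: int by simp_all
  show ?thesis
  proof
    fix k
    show "regauge u f (-1) (k + 1) * regauge u f 1 k = (wt k + b) * (wt k + 1 - b)"
      unfolding inv1[symmetric] using u by (simp add: regauge_def field_simps)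
    show "regauge u f (-1) (k + 1) * regauge u f (-1) (k + 2) * regauge u f 2 k =
        (wt k + 2 * b) * (wt k + 1 - b) * (wt k + 2 - b)"
      unfolding invX[symmetric] using u by (simp add: regauge_def k field_simps)
    show "regauge u f (-2) (k + 2) * regauge u f 1 (k + 1) * regauge u f 1 k =
        (wt k + 2 - 2 * b) * (wt k + b) * (wt k + 1 + b)"
      unfolding invY[symmetric] using u by (simp add: regauge_def k field_simps)
    show "regauge u f (-2) (k + 2) * regauge u f 2 k = (wt k + 2 * b) * (wt k + 2 - 2 * b)"
      unfolding inv2[symmetric] using u by (simp add: regauge_def field_simps)
  qed
qed

lemma regauge_regauge:
  assumes "\<And>k. u k \<noteq> 0" "\<And>k. v k \<noteq> 0"
  shows "regauge v (regauge u f) = regauge (\<lambda>k. u k * v k) f"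
  using assms by (simp add: fun_eq_iff regauge_def field_simps)

text \<open>The recurrence is solved in both directions from \<open>u 0 = 1\<close>. Having a factor
  on either side lets each edge be normalised through whichever of its coefficients is
  nonzero.\<close>

lemma gauge_exists:
  fixes x y :: "int \<Rightarrow> complex"
  assumes "\<And>k. x k \<noteq> 0" "\<And>k. y k \<noteq> 0"
  obtains u where "\<And>k. u k \<noteq> 0" "\<And>k. x k * u k = y k * u (k + 1)"
proof -
  define r where "r k = x k / y k" for k
  have r: "r k \<noteq> 0" for k using assms by (simp add: r_def)
  define u where "u k = (if k \<ge> 0 then \<Prod>i<nat k. r (int i) else \<Prod>i<nat (- k). 1 / r (- 1 - int i))" for k
  have "u (k + 1) = r k * u k" for k
  proof (cases "k \<ge> 0")
    case True
    then show ?thesis by (simp add: u_def nat_add_distrib lessThan_Suc)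
  next
    case False
    define n where "n = nat (- k - 1)"
    have k: "k = - 1 - int n" using False by (simp add: n_def)
    have "u k = (\<Prod>i<Suc n. 1 / r (- 1 - int i))" using k by (simp add: u_def nat_add_distrib)
    moreover have "u (k + 1) = (\<Prod>i<n. 1 / r (- 1 - int i))" using k by (cases n) (simp_all add: u_def nat_add_distrib)
    ultimately show ?thesis using r[of "- 1 - int n"] k by simp
  qed
  moreover have "u k \<noteq> 0" for k using r by (auto simp: u_def)
  ultimately show ?thesis using assms by (intro that[of u]) (auto simp: r_def)
qed

text \<open>The Witt algebra is generated by \<open>d\<^sub>1, d\<^sub>-\<^sub>1, d\<^sub>2, d\<^sub>-\<^sub>2\<close>.\<close>

lemma weight_coeffs_eqI:
  assumes "weight_coeffs UNIV a f z" "weight_coeffs UNIV a g z'"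
    and "f 1 = g 1" "f (-1) = g (-1)" "f 2 = g 2" "f (-2) = g (-2)"
  shows "f = g"
proof -
  interpret f: weight_coeffs UNIV a f z by fact
  interpret g: weight_coeffs UNIV a g z' by fact
  \<comment> \<open>The factor in [d_1, d_m] = (m - 1) d_(m+1) vanishes at m = 1, so d_2 cannot be
    reached from d_1 and belongs to the start of the induction.\<close>
  have pos: "f (int n + 1) = g (int n + 1) \<and> f (int n + 2) = g (int n + 2)" for n
  proof (induction n)
    case (Suc n)
    let ?m = "int n + 2"
    have "of_int (?m - 1) * f (1 + ?m) k = of_int (?m - 1) * g (1 + ?m) k" for k
      using f.bracket[of k 1 ?m] g.bracket[of k 1 ?m] Suc assms(3) by auto
    moreover have "of_int (?m - 1) \<noteq> (0 :: complex)" by (simp only: of_int_eq_0_iff)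
    ultimately have "f (1 + ?m) = g (1 + ?m)" by (auto simp: fun_eq_iff)
    then show ?case using Suc by (simp add: algebra_simps)
  qed (use assms in simp)
  have neg: "f (- (int n + 1)) = g (- (int n + 1)) \<and> f (- (int n + 2)) = g (- (int n + 2))" for n
  proof (induction n)
    case (Suc n)
    let ?m = "- (int n + 2)"
    have "of_int (?m + 1) * f (-1 + ?m) k = of_int (?m + 1) * g (-1 + ?m) k" for k
      using f.bracket[of k "-1" ?m] g.bracket[of k "-1" ?m] Suc assms(4) by auto
    moreover have "of_int (?m + 1) \<noteq> (0 :: complex)" by (simp only: of_int_eq_0_iff)
    ultimately have "f (-1 + ?m) = g (-1 + ?m)" by (auto simp: fun_eq_iff)
    then show ?case using Suc by (simp add: algebra_simps)
  qed (use assms in simp)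
  have "f m = g m" for m
  proof (cases m "0 :: int" rule: linorder_cases)
    case less
    then show ?thesis using neg[of "nat (- m - 1)"] by simp
  next
    case equal
    then show ?thesis using f.d0 g.d0 by (auto simp: fun_eq_iff)
  next
    case greater
    then show ?thesis using pos[of "nat (m - 1)"] by simp
  qed
  then show ?thesis by blast
qed

section \<open>Coefficients of the families V, A and B\<close>

definition V_coeff :: "complex \<Rightarrow> complex \<Rightarrow> int \<Rightarrow> int \<Rightarrow> complex" where
  "V_coeff a b m k = a + of_int k + of_int m * b"

text \<open>Homogeneous version of A_a: rescaling w_0 multiplies (\<alpha>, \<beta>) by a scalar.
  The pair (a, 1) is A_a, and (1, 0) is V(0,1).\<close>

definition A_coeff :: "complex \<Rightarrow> complex \<Rightarrow> int \<Rightarrow> int \<Rightarrow> complex" where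
  "A_coeff \<alpha> \<beta> m k = (if k = 0 then of_int m * (\<alpha> + \<beta> * of_int m) else of_int (k + m))"

text \<open>Here (-a, -1) is B_a, (-1, 0) is V(0,0), and (0, 0) is V'(0,0) plus a trivial
  line.\<close>

definition B_coeff :: "complex \<Rightarrow> complex \<Rightarrow> int \<Rightarrow> int \<Rightarrow> complex" where
  "B_coeff \<alpha> \<beta> m k = (if k + m = 0 then of_int m * (\<alpha> + \<beta> * of_int m) else of_int k)"

lemma weight_coeffs_V: "weight_coeffs UNIV a (V_coeff a b) (\<lambda>_. 0)"
  by unfold_locales (auto simp: V_coeff_def algebra_simps)

lemma weight_coeffs_A: "weight_coeffs UNIV 0 (A_coeff \<alpha> \<beta>) (\<lambda>_. 0)"
proof
  fix k m n :: int
  show "A_coeff \<alpha> \<beta> m (k + n) * A_coeff \<alpha> \<beta> n k - A_coeff \<alpha> \<beta> n (k + m) * A_coeff \<alpha> \<beta> m k =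
       of_int (n - m) * A_coeff \<alpha> \<beta> (m + n) k +
           (if m = - n then (of_int m ^ 3 - of_int m) / 12 * 0 else 0)"
  proof (cases "k = 0")
    case True
    then show ?thesis by (auto simp: A_coeff_def algebra_simps)
  next
    case False
    have "A_coeff \<alpha> \<beta> m (k + n) * A_coeff \<alpha> \<beta> n k = of_int (k + n + m) * of_int (k + n)"
     "A_coeff \<alpha> \<beta> n (k + m) * A_coeff \<alpha> \<beta> m k = of_int (k + n + m) * of_int (k + m)"
      using False by (auto simp: A_coeff_def algebra_simps simp flip: of_int_add)
    then show ?thesis using False by (auto simp: A_coeff_def algebra_simps)
  qed
qed (auto simp: A_coeff_def)

lemma weight_coeffs_B: "weight_coeffs UNIV 0 (B_coeff \<alpha> \<beta>) (\<lambda>_. 0)"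
proof
  fix k m n :: int
  show "B_coeff \<alpha> \<beta> m (k + n) * B_coeff \<alpha> \<beta> n k - B_coeff \<alpha> \<beta> n (k + m) * B_coeff \<alpha> \<beta> m k =
       of_int (n - m) * B_coeff \<alpha> \<beta> (m + n) k +
           (if m = - n then (of_int m ^ 3 - of_int m) / 12 * 0 else 0)"
  proof (cases "k + m + n = 0")
    case True
    then have k: "k = - m - n" by simp
    show ?thesis unfolding k by (auto simp: B_coeff_def algebra_simps)
  next
    case False
    have "B_coeff \<alpha> \<beta> m (k + n) * B_coeff \<alpha> \<beta> n k = of_int (k + n) * of_int k"
     "B_coeff \<alpha> \<beta> n (k + m) * B_coeff \<alpha> \<beta> m k = of_int (k + m) * of_int k"
      using False by (auto simp: B_coeff_def algebra_simps simp flip: of_int_add)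
    then show ?thesis using False by (auto simp: B_coeff_def algebra_simps)
  qed
qed (auto simp: B_coeff_def)

section \<open>Recovering \<open>V(a,b)\<close>\<close>

context normal_invariants
begin

text \<open>\<open>invX\<close> yields d_2 wherever the two d_-1 steps are nonzero. At the
  exceptional indices \<open>invY\<close> still yields a nonzero d_-2 coefficient, by the condition
  on \<open>b\<close>, and \<open>inv2\<close> gives d_2 from it; d_-2 is treated
  symmetrically.\<close>

lemma eq_V_generic:
  assumes 1: "\<And>k. f 1 k = wt k + b" "\<And>k. f (-1) (k + 1) = wt k + 1 - b"
    and b: "b \<noteq> 0 \<and> b \<noteq> 1 \<and> b \<noteq> 1/2 \<or> (\<forall>k. wt k \<noteq> - b \<and> wt k \<noteq> b - 1)"
  shows "f = V_coeff a b"
proof -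
  have w: "wt (k + 1) = wt k + 1" for k by (simp add: wt_def)
  have f1: "f 1 (k + 1) = wt k + 1 + b" "f (-1) (k + 2) = wt k + 2 - b" for k
    using 1(1)[of "k + 1"] 1(2)[of "k + 1"] by (simp_all add: w add.assoc)
  have up: "f 2 k = wt k + 2 * b" if "wt k + 1 - b \<noteq> 0" "wt k + 2 - b \<noteq> 0" for k
    using invX[of k] that by (simp add: 1 f1 w)
  have down: "f (-2) (k + 2) = wt k + 2 - 2 * b" if "wt k + b \<noteq> 0" "wt k + 1 + b \<noteq> 0" for k
    using invY[of k] that by (simp add: 1 f1 w)
  have nz: "b \<noteq> 0 \<and> b \<noteq> 1 \<and> b \<noteq> 1/2" if "wt k + b = 0 \<or> wt k + 1 + b = 0 \<or> wt k + 1 - b = 0 \<or> wt k + 2 - b = 0" for k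
  proof -
    have "wt k = - b \<or> wt (k + 1) = - b \<or> wt k = b - 1 \<or> wt (k + 1) = b - 1"
      using that by (elim disjE) (simp_all add: w eq_neg_iff_add_eq_0 eq_diff_eq add.assoc)
    then show ?thesis using b by blast
  qed
  have f2: "f 2 k = wt k + 2 * b" for k
  proof (cases "wt k + 1 - b = 0 \<or> wt k + 2 - b = 0")
    case True
    then have k: "wt k = b - 1 \<or> wt k = b - 2" by (auto simp: algebra_simps)
    have "b - 1 + b \<noteq> 0" "b - 2 + b \<noteq> 0" "b - 1 + 1 + b \<noteq> 0" "b - 2 + 1 + b \<noteq> 0"
      "b - 1 + 2 - 2 * b \<noteq> 0" "b - 2 + 2 - 2 * b \<noteq> 0"
      using nz[of k] True by (auto simp: field_simps)
    then have "wt k + b \<noteq> 0" "wt k + 1 + b \<noteq> 0" "wt k + 2 - 2 * b \<noteq> 0"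
      using k by (elim disjE; simp)+
    then show ?thesis using inv2[of k] down[of k] by simp
  qed (use up in auto)
  have f2': "f (-2) (k + 2) = wt k + 2 - 2 * b" for k
  proof (cases "wt k + b = 0 \<or> wt k + 1 + b = 0")
    case True
    then have k: "wt k = - b \<or> wt k = - b - 1"
      by (elim disjE) (simp_all add: eq_neg_iff_add_eq_0 eq_diff_eq)
    have "- b + 1 - b \<noteq> 0" "- b - 1 + 1 - b \<noteq> 0" "- b + 2 - b \<noteq> 0" "- b - 1 + 2 - b \<noteq> 0"
      "- b + 2 * b \<noteq> 0" "- b - 1 + 2 * b \<noteq> 0"
      using nz[of k] True by (auto simp: field_simps)
    then have "wt k + 1 - b \<noteq> 0" "wt k + 2 - b \<noteq> 0" "wt k + 2 * b \<noteq> 0"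
      using k by (elim disjE; simp)+
    then show ?thesis using inv2[of k] up[of k] by simp
  qed (use down in auto)
  show ?thesis
  proof (rule weight_coeffs_eqI[OF weight_coeffs_axioms weight_coeffs_V])
    show "f 1 = V_coeff a b 1" "f 2 = V_coeff a b 2" by (simp_all add: fun_eq_iff V_coeff_def 1 f2 wt_def)
    show "f (-1) = V_coeff a b (-1)"
      using 1(2)[of "k - 1" for k] by (simp add: fun_eq_iff V_coeff_def wt_def)
    show "f (-2) = V_coeff a b (-2)"
      using f2'[of "k - 2" for k] by (simp add: fun_eq_iff V_coeff_def wt_def)
  qed
qed

text \<open>On the edge from \<open>k\<close> to \<open>k + 1\<close> the coefficient of d_1 is
  normalised, except for \<open>wt k\<close> = - b, where that of d_-1 is. Where \<open>inv1\<close>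
  is 0 on the edge, \<open>invY\<close> or \<open>invX\<close> shows that the chosen coefficient is
  nonzero.\<close>

lemma regauge_V_generic:
  assumes b: "b \<noteq> 0 \<and> b \<noteq> 1 \<and> b \<noteq> 1/2 \<or> (\<forall>k. wt k \<noteq> - b \<and> wt k \<noteq> b - 1)"
  shows "\<exists>u. (\<forall>k. u k \<noteq> 0) \<and> regauge u f = V_coeff a b"
proof -
  have up: "f 1 k \<noteq> 0" if "wt k + b \<noteq> 0" for k
  proof (cases "wt k + 1 - b = 0")
    case True
    then have k: "wt k = b - 1" by (simp add: algebra_simps)
    then have "b \<noteq> 0 \<and> b \<noteq> 1 \<and> b \<noteq> 1/2" using b by auto
    then have "wt k + 2 - 2 * b \<noteq> 0" "wt k + b \<noteq> 0" "wt k + 1 + b \<noteq> 0"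
      unfolding k by (auto simp: field_simps)
    then show ?thesis using invY[of k] by auto
  qed (use inv1[of k] that in auto)
  have down: "f (-1) (k + 1) \<noteq> 0 \<and> wt k + 1 - b \<noteq> 0" if "wt k + b = 0" for k
  proof -
    have k: "wt k = - b" using that by (simp add: add_eq_0_iff2)
    then have "b \<noteq> 0 \<and> b \<noteq> 1 \<and> b \<noteq> 1/2" using b by auto
    then have "wt k + 2 * b \<noteq> 0" "wt k + 1 - b \<noteq> 0" "wt k + 2 - b \<noteq> 0"
      unfolding k by (auto simp: field_simps)
    then show ?thesis using invX[of k] by auto
  qed
  define x where "x k = (if wt k + b = 0 then wt k + 1 - b else f 1 k)" for k
  define y where "y k = (if wt k + b = 0 then f (-1) (k + 1) else wt k + b)" for k
  have "x k \<noteq> 0" "y k \<noteq> 0" for k using up down by (auto simp: x_def y_def)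
  from gauge_exists[of x y, OF this]
  obtain u where u: "\<And>k. u k \<noteq> 0" and xy: "\<And>k. x k * u k = y k * u (k + 1)" by blast
  interpret g: normal_invariants a "regauge u f" z b
    by (rule normal_invariants_regauge) (use u normal_invariants_axioms in auto)
  have 1: "regauge u f 1 k = wt k + b \<and> regauge u f (-1) (k + 1) = wt k + 1 - b" for k
  proof (cases "wt k + b = 0")
    case True
    have "regauge u f (-1) (k + 1) = wt k + 1 - b"
      using xy[of k] u[of k] True by (simp add: regauge_def x_def y_def field_simps)
    then show ?thesis using g.inv1[of k] down[OF True] True by auto
  next
    case False
    have "regauge u f 1 k = wt k + b"
      using xy[of k] u[of "k + 1"] False by (simp add: regauge_def x_def y_def field_simps)
    then show ?thesis using g.inv1[of k] False by auto
  qed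
  have "regauge u f = V_coeff a b" by (rule g.eq_V_generic) (use 1 b in auto)
  then show ?thesis using u by blast
qed

text \<open>For \<open>b = 1/2\<close> the edge between the weights \<open>-1/2\<close> and \<open>1/2\<close> is annihilated by both
  \<open>d\<^sub>1\<close> and \<open>d\<^sub>-\<^sub>1\<close>, so the two half-lines are glued along \<open>d\<^sub>2\<close> instead.\<close>

lemma eq_V_half:
  assumes b: "b = 1/2" and j: "wt j = - 1/2"
    and 1: "\<And>k. k \<noteq> j \<Longrightarrow> f 1 k = wt k + 1/2" and 2: "f 2 j = 1/2"
  shows "f = V_coeff a b"
proof -
  have w: "wt (k + n) = wt k + of_int n" for k n by (simp add: wt_def)
  have a: "a = - 1/2 - of_int j" using j by (simp add: wt_def eq_diff_eq)
  have "wt k + 1/2 = of_int (k - j)" "wt k + 3/2 = of_int (k - (j - 1))" for k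
    unfolding wt_def by (simp_all add: a)
  then have wj': "wt k + 1/2 = 0 \<longleftrightarrow> k = j" and wj1: "wt k + 3/2 = 0 \<longleftrightarrow> k = j - 1" for k
    by (simp_all only: of_int_eq_0_iff) auto
  have "wt k + 1 - b = wt k + 1/2" for k by (simp add: b)
  then have inv1h: "f (-1) (k + 1) * f 1 k = (wt k + 1/2) * (wt k + 1/2)" for k
    using inv1[of k] by (simp only: b)
  have m1: "f (-1) (k + 1) = wt k + 1/2" if "k \<noteq> j" for k
    using inv1h[of k] wj'[of k] that unfolding 1[OF that] mult_cancel_right by blast
  have h: "wt (k + 1) + 1/2 = wt k + 3/2" for k by (simp add: wt_def)
  have m1': "f (-1) (k + 2) = wt k + 3/2" if "k \<noteq> j - 1" for k
    using m1[of "k + 1"] that unfolding h by (auto simp: add.assoc)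
  have p1': "f 1 (k + 1) = wt k + 3/2" if "k \<noteq> j - 1" for k
    using 1[of "k + 1"] that unfolding h by auto
  have hb: "wt k + 2 * b = wt k + 1" "wt k + 1 - b = wt k + 1/2" "wt k + 2 - b = wt k + 3/2"
    "wt k + 2 - 2 * b = wt k + 1" "wt k + b = wt k + 1/2" "wt k + 1 + b = wt k + 3/2" for k
    by (simp_all add: b)
  have up: "f 2 k = wt k + 1" if "k \<noteq> j" "k \<noteq> j - 1" for k
  proof -
    have "(wt k + 1/2) * (wt k + 3/2) * f 2 k = (wt k + 1/2) * (wt k + 3/2) * (wt k + 1)"
      using invX[of k] unfolding m1[OF that(1)] m1'[OF that(2)] hb by (simp only: ac_simps)
    then show ?thesis using wj'[of k] wj1[of k] that by simp
  qed
  have down: "f (-2) (k + 2) = wt k + 1" if "k \<noteq> j" "k \<noteq> j - 1" for k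
  proof -
    have "(wt k + 1/2) * (wt k + 3/2) * f (-2) (k + 2) = (wt k + 1/2) * (wt k + 3/2) * (wt k + 1)"
      using invY[of k] unfolding 1[OF that(1)] p1'[OF that(2)] hb by (simp only: ac_simps)
    then show ?thesis using wj'[of k] wj1[of k] that by simp
  qed
  have two': "f (-2) (j + 2) = 1/2" using inv2[of j] 2 by (simp add: b j mult.commute)
  \<comment> \<open>Open are the edges between \<open>j - 1\<close> and \<open>j + 1\<close> and
    between \<open>j\<close> and \<open>j + 1\<close>. Two brackets express the latter by 3
    \<open>f 1 j\<close> = t + 1/2 and 3 \<open>f (-1) (j + 1)\<close> = s + 1/2. Their product is 0
    by \<open>inv1\<close>, so s or t is -1/2, and s t = 1/4 gives the other.\<close>
  define s where "s = f (-2) (j + 1)"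
  define t where "t = f 2 (j - 1)"
  have st: "s * t = 1/4"
    using inv2[of "j - 1"] w[of j "-1"] j by (simp add: b s_def t_def add.commute)
  have vals: "f (-1) (j + 2) = 1" "f (-1) j = - 1" "f 1 (j + 1) = 1" "f 1 (j - 1) = - 1"
    using m1'[of j] m1[of "j - 1"] p1'[of j] 1[of "j - 1"] w[of j "-1"] j by simp_all
  have x: "1/2 + t = 3 * f 1 j"
    using bracket[of j "-1" 2] 2 vals by (simp add: t_def)
  have "f 1 (j - 1) * s - f (-2) (j + 2) * f 1 (j + 1) = - (3 * f (-1) (j + 1))"
    using bracket[of "j + 1" 1 "-2"] by (simp add: s_def add.commute)
  then have "3 * f (-1) (j + 1) = - (f 1 (j - 1) * s - f (-2) (j + 2) * f 1 (j + 1))" by simp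
  also have "\<dots> = s + 1/2" unfolding vals two' by simp
  finally have y: "s + 1/2 = 3 * f (-1) (j + 1)" by (rule sym)
  have xy: "f (-1) (j + 1) * f 1 j = 0" using inv1[of j] by (simp add: b j)
  have "(s + 1/2) * (1/2 + t) = 0" unfolding x y using xy by simp
  then have "s + 1/2 = 0 \<or> 1/2 + t = 0" by (simp only: mult_eq_0_iff)
  moreover have "s = (s + 1/2) + - 1/2" "t = (1/2 + t) + - 1/2" by simp_all
  ultimately have "s = - 1/2 \<or> t = - 1/2" by (metis add_0)
  moreover have "t = - 1/2" if "s = - 1/2"
  proof -
    have "t = - 2 * (s * t)" unfolding that by simp
    then show ?thesis unfolding st by simp
  qed
  moreover have "s = - 1/2" if "t = - 1/2"
  proof -
    have "s = - 2 * (s * t)" unfolding that by simp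
    then show ?thesis unfolding st by simp
  qed
  ultimately have s: "s = - 1/2" and t: "t = - 1/2" by blast+
  have "f 1 j = 0" "f (-1) (j + 1) = 0" using x y s t by simp_all
  then have "f 1 k = wt k + 1/2" "f (-1) (k + 1) = wt k + 1/2" for k
    using 1[of k] m1[of k] j by (cases "k = j"; simp)+
  moreover have "f 2 k = wt k + 1 \<and> f (-2) (k + 2) = wt k + 1" for k
  proof -
    consider "k = j" | "k = j - 1" | "k \<noteq> j" "k \<noteq> j - 1" by blast
    then show ?thesis
    proof cases
      case 1
      show ?thesis unfolding 1 j 2 two' by simp
    next
      case 2
      have "wt (j - 1) = - 3/2" using w[of j "-1"] j by simp
      moreover have "j - 1 + 2 = j + 1" by simp
      ultimately show ?thesis unfolding 2 using s t by (simp add: s_def t_def add.commute)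
    next
      case 3
      then show ?thesis using up down by blast
    qed
  qed
  ultimately have *: "f 1 k = wt k + 1/2" "f (-1) (k + 1) = wt k + 1/2" "f 2 k = wt k + 1"
     "f (-2) (k + 2) = wt k + 1" for k by auto
  show ?thesis unfolding b
  proof (rule weight_coeffs_eqI[OF weight_coeffs_axioms weight_coeffs_V])
    show "f 1 = V_coeff a (1/2) 1" "f 2 = V_coeff a (1/2) 2" by (simp_all add: fun_eq_iff V_coeff_def * wt_def)
    show "f (-1) = V_coeff a (1/2) (-1)"
      using *(2)[of "k - 1" for k] by (simp add: fun_eq_iff V_coeff_def wt_def)
    show "f (-2) = V_coeff a (1/2) (-2)"
      using *(4)[of "k - 2" for k] by (simp add: fun_eq_iff V_coeff_def wt_def)
  qed
qed

lemma regauge_V_half: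
  assumes b: "b = 1/2" and j: "wt j = - 1/2"
  shows "\<exists>u. (\<forall>k. u k \<noteq> 0) \<and> regauge u f = V_coeff a b"
proof -
  have a: "a = - 1/2 - of_int j" using j by (simp add: wt_def eq_diff_eq)
  have "wt k + 1/2 = of_int (k - j)" for k unfolding wt_def by (simp add: a)
  then have wj: "wt k + 1/2 = 0 \<longleftrightarrow> k = j" for k by (simp only: of_int_eq_0_iff) auto
  have "wt k + 1 - b = wt k + 1/2" for k by (simp add: b)
  then have inv1h: "f (-1) (k + 1) * f 1 k = (wt k + 1/2) * (wt k + 1/2)" for k
    using inv1[of k] by (simp only: b)
  have nz: "f 1 k \<noteq> 0" if "k \<noteq> j" for k
    using inv1h[of k] wj[of k] that by (metis mult_eq_0_iff)
  have nz2: "f 2 j \<noteq> 0" using inv2[of j] by (auto simp: b j)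
  define x where "x k = (if k = j then f 2 j else f 1 k)" for k
  \<comment> \<open>The target is 1/2, the coefficient of d_2 at weight -1/2 in V(a,1/2). The edge
    from \<open>j + 1\<close> to \<open>j + 2\<close> is normalised to 1, so
    \<open>u (j + 2) = f 1 (j + 1) * u (j + 1)\<close>, and the target becomes a condition on
    \<open>u j\<close> and \<open>u (j + 1)\<close>.\<close>
  define y where "y k = (if k = j then f 1 (j + 1) / 2 else wt k + 1/2)" for k
  have "x k \<noteq> 0" "y k \<noteq> 0" for k using nz nz2 wj by (auto simp: x_def y_def)
  from gauge_exists[of x y, OF this]
  obtain u where u: "\<And>k. u k \<noteq> 0" and xy: "\<And>k. x k * u k = y k * u (k + 1)" by blast
  interpret g: normal_invariants a "regauge u f" z b
    by (rule normal_invariants_regauge) (use u normal_invariants_axioms in auto)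
  have 1: "regauge u f 1 k = wt k + 1/2" if "k \<noteq> j" for k
    using xy[of k] u[of "k + 1"] that by (simp add: regauge_def x_def y_def field_simps)
  have "f 2 j * u j = f 1 (j + 1) / 2 * u (j + 1)" using xy[of j] by (simp add: x_def y_def)
  also have "wt (j + 1) + 1/2 = 1" unfolding wt_def by (simp add: a)
  then have "f 1 (j + 1) * u (j + 1) = u (j + 2)"
    using xy[of "j + 1"] by (simp add: x_def y_def add.assoc)
  then have "f 1 (j + 1) / 2 * u (j + 1) = u (j + 2) / 2" by simp
  finally have 2: "regauge u f 2 j = 1/2" using u by (simp add: regauge_def field_simps)
  have "regauge u f = V_coeff a b" by (rule g.eq_V_half[OF b j 1 2])
  then show ?thesis using u by blast
qed

end

section \<open>The singular cases \<open>b \<in> {0, 1}\<close>\<close>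

lemma of_int_plus_eq_0:
  "of_int k + 1 = (0 :: complex) \<longleftrightarrow> k = -1" "of_int k + 2 = (0 :: complex) \<longleftrightarrow> k = -2"
proof -
  have "of_int k + 1 = (of_int (k + 1) :: complex)" "of_int k + 2 = (of_int (k + 2) :: complex)"
    by simp_all
  then show "of_int k + 1 = (0 :: complex) \<longleftrightarrow> k = -1" "of_int k + 2 = (0 :: complex) \<longleftrightarrow> k = -2"
    by (simp_all only: of_int_eq_0_iff) auto
qed

text \<open>Here \<open>d\<^sub>1, d\<^sub>-\<^sub>1\<close> do not connect \<open>v\<^sub>0\<close> to its neighbours in both directions; the half-lines
  are glued along \<open>d\<^sub>2 v\<^sub>-\<^sub>1 = v\<^sub>1\<close>, and the coefficients into and out of \<open>v\<^sub>0\<close> stay undetermined.\<close>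

locale singular_coeffs = weight_coeffs UNIV 0 f z for f z +
  assumes p1: "k \<noteq> -1 \<Longrightarrow> k \<noteq> 0 \<Longrightarrow> f 1 k = of_int (k + 1)"
    and m1: "k \<noteq> -1 \<Longrightarrow> k \<noteq> 0 \<Longrightarrow> f (-1) (k + 1) = of_int k"
    and p2: "k \<noteq> -2 \<Longrightarrow> k \<noteq> 0 \<Longrightarrow> f 2 k = of_int (k + 2)"
    and m2: "k \<noteq> -2 \<Longrightarrow> k \<noteq> 0 \<Longrightarrow> f (-2) (k + 2) = of_int k"
begin

lemma m1': "k \<noteq> 1 \<Longrightarrow> k \<noteq> 0 \<Longrightarrow> f (-1) k = of_int (k - 1)"
  and m2': "k \<noteq> 2 \<Longrightarrow> k \<noteq> 0 \<Longrightarrow> f (-2) k = of_int (k - 2)"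
  using m1[of "k - 1"] m2[of "k - 2"] by simp_all

text \<open>The first four come from brackets expressing the d_2, d_-2 edges at 0 through the d_1,
  d_-1 edges. In each of the others one of the two paths of a bracket passes through 0; the other
  path alone already gives the right-hand side, so the path through 0 contributes nothing.\<close>

lemma zero_relations:
  "f 2 0 = 3 * f 1 0 + f (-1) 0" "f (-2) 0 = f 1 0 + 3 * f (-1) 0"
  "2 * f 2 (-2) = 3 * f 1 (-1) - f (-1) 1" "2 * f (-2) 2 = 3 * f (-1) 1 - f 1 (-1)"
  "f 1 0 * f (-1) 1 = 0" "f (-1) 0 * f 1 (-1) = 0"
  "f 2 0 * f (-1) 1 = 0" "f (-2) 0 * f 1 (-1) = 0"
  "f 1 0 * f (-2) 2 = 0" "f (-1) 0 * f 2 (-2) = 0"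
  "f 2 0 * f (-2) 2 = 0" "f (-2) 0 * f 2 (-2) = 0"
proof -
  show "f 2 0 = 3 * f 1 0 + f (-1) 0"
    using bracket[of 0 "-1" 2] m1'[of 2] p2[of "-1"] by (simp add: algebra_simps)
  show "f (-2) 0 = f 1 0 + 3 * f (-1) 0"
    using bracket[of 0 1 "-2"] p1[of "-2"] m2'[of 1] by (simp add: algebra_simps)
  show "2 * f 2 (-2) = 3 * f 1 (-1) - f (-1) 1"
    using bracket[of "-1" "-1" 2] p2[of "-1"] m1'[of "-1"] by (simp add: algebra_simps)
  show "2 * f (-2) 2 = 3 * f (-1) 1 - f 1 (-1)"
    using bracket[of 1 1 "-2"] m2'[of 1] p1[of 1] by (simp add: algebra_simps)
  show "f 1 0 * f (-1) 1 = 0"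
    using bracket[of 1 "-1" 1] p1[of 1] m1'[of 2] d0[of 1] by simp
  show "f (-1) 0 * f 1 (-1) = 0"
    using bracket[of "-1" "-1" 1] p1[of "-2"] m1'[of "-1"] d0[of "-1"] by simp
  show "f 2 0 * f (-1) 1 = 0"
    using bracket[of 1 "-1" 2] p2[of 1] m1'[of 3] p1[of 1] by simp
  show "f (-2) 0 * f 1 (-1) = 0"
    using bracket[of "-1" 1 "-2"] m2'[of "-1"] p1[of "-3"] m1'[of "-1"] by simp
  show "f 1 0 * f (-2) 2 = 0"
    using bracket[of 2 1 "-2"] p1[of 2] m2'[of 3] m1'[of 2] by simp
  show "f (-1) 0 * f 2 (-2) = 0"
    using bracket[of "-2" "-1" 2] m1'[of "-2"] p2[of "-3"] p1[of "-2"] by simp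
  show "f 2 0 * f (-2) 2 = 0"
    using bracket[of 2 2 "-2"] p2[of 2] m2'[of 4] d0[of 2] central_zero[OF weight_coeffs_axioms] by simp
  show "f (-2) 0 * f 2 (-2) = 0"
    using bracket[of "-2" 2 "-2"] m2'[of "-2"] p2[of "-4"] d0[of "-2"]
      central_zero[OF weight_coeffs_axioms] by simp
qed

text \<open>A nonzero edge out of 0 forces the edges into 0 to vanish, by
  \<open>zero_relations\<close>. The parameters solve m (\<alpha> + \<beta> m) =
  \<open>f m 0\<close> for m = 1 and m = -1.\<close>

lemma eq_A:
  assumes "f 1 0 \<noteq> 0 \<or> f (-1) 0 \<noteq> 0"
  shows "f = A_coeff ((f 1 0 - f (-1) 0) / 2) ((f 1 0 + f (-1) 0) / 2)"
proof -
  note z = zero_relations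
  have in0: "f 1 (-1) = 0" "f (-1) 1 = 0" "f 2 (-2) = 0" "f (-2) 2 = 0"
    using assms z(3-10) by auto
  have *: "f 1 k = of_int (k + 1)" "f (-1) k = of_int (k - 1)" "f 2 k = of_int (k + 2)"
    "f (-2) k = of_int (k - 2)" if "k \<noteq> 0" for k
    using that in0 p1[of k] m1'[of k] p2[of k] m2'[of k]
    by (cases "k = 1"; cases "k = 2"; cases "k = -1"; cases "k = -2"; simp)+
  show ?thesis
    by (rule weight_coeffs_eqI[OF weight_coeffs_axioms weight_coeffs_A])
       (auto simp: fun_eq_iff A_coeff_def * z(1,2) field_simps)
qed

lemma regauge_B:
  assumes "f 1 0 = 0" "f (-1) 0 = 0"
  shows "\<exists>u. (\<forall>k. u k \<noteq> 0) \<and> (\<exists>\<alpha> \<beta>. regauge u f = B_coeff \<alpha> \<beta>)"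
proof -
  note z = zero_relations
  \<comment> \<open>Rescaling by k turns the coefficients k + m between nonzero indices into the
    coefficients k of B_a.\<close>
  define u :: "int \<Rightarrow> complex" where "u k = (if k = 0 then 1 else of_int k)" for k
  have u: "u k \<noteq> 0" for k by (simp add: u_def)
  define \<alpha> where "\<alpha> = - (f 1 (-1) + f (-1) 1) / 2"
  define \<beta> where "\<beta> = (f (-1) 1 - f 1 (-1)) / 2"
  have out0: "f 2 0 = 0" "f (-2) 0 = 0" using assms z(1,2) by simp_all
  have in1: "- f 1 (-1) = \<alpha> + \<beta>" "f (-1) 1 = \<beta> - \<alpha>"
    by (simp_all add: \<alpha>_def \<beta>_def field_simps)
  have in2: "- f 2 (-2) * 2 = 2 * (\<alpha> + \<beta> * 2)" "f (-2) 2 * 2 = - 2 * (\<alpha> - \<beta> * 2)"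
  proof -
    have "- f 2 (-2) * 2 = - (2 * f 2 (-2))" by simp
    also have "\<dots> = 2 * (\<alpha> + \<beta> * 2)" unfolding z(3) by (simp add: \<alpha>_def \<beta>_def field_simps)
    finally show "- f 2 (-2) * 2 = 2 * (\<alpha> + \<beta> * 2)" .
    have "f (-2) 2 * 2 = 2 * f (-2) 2" by simp
    also have "\<dots> = - 2 * (\<alpha> - \<beta> * 2)" unfolding z(4) by (simp add: \<alpha>_def \<beta>_def field_simps)
    finally show "f (-2) 2 * 2 = - 2 * (\<alpha> - \<beta> * 2)" .
  qed
  have wc: "weight_coeffs UNIV 0 (regauge u f) z"
    by (rule weight_coeffs_regauge[OF weight_coeffs_axioms u])
  have "regauge u f 1 k = B_coeff \<alpha> \<beta> 1 k" for k
    using p1[of k] assms in1 by (cases "k = 0"; cases "k = -1") (auto simp: of_int_plus_eq_0 regauge_def B_coeff_def u_def)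
  moreover have "regauge u f 2 k = B_coeff \<alpha> \<beta> 2 k" for k
    using p2[of k] out0 in2(1) by (cases "k = 0"; cases "k = -2") (auto simp: of_int_plus_eq_0 regauge_def B_coeff_def u_def)
  moreover have "regauge u f (-1) k = B_coeff \<alpha> \<beta> (-1) k" for k
    using m1'[of k] assms in1 by (cases "k = 0"; cases "k = 1") (auto simp: regauge_def B_coeff_def u_def)
  moreover have "regauge u f (-2) k = B_coeff \<alpha> \<beta> (-2) k" for k
    using m2'[of k] out0 in2(2) by (cases "k = 0"; cases "k = 2") (auto simp: regauge_def B_coeff_def u_def)
  ultimately have "regauge u f = B_coeff \<alpha> \<beta>"
    by (intro weight_coeffs_eqI[OF wc weight_coeffs_B]) (auto simp: fun_eq_iff)
  then show ?thesis using u by blast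
qed

end

text \<open>For a = 0 the two values of \<open>b\<close> give identical invariants, so both lead to
  the same normal form.\<close>

lemma regauge_singular:
  assumes "normal_invariants 0 f z b" and b: "b = 0 \<or> b = 1"
  shows "\<exists>u. (\<forall>k. u k \<noteq> 0) \<and> singular_coeffs (regauge u f) z"
proof -
  interpret normal_invariants 0 f z b by fact
  have w: "wt k = of_int k" for k by (simp add: wt_def)
  note k0 = of_int_plus_eq_0
  have nz: "f 1 k \<noteq> 0" if "k \<noteq> -1" "k \<noteq> 0" for k
  proof -
    have "f (-1) (k + 1) * f 1 k \<noteq> 0" unfolding inv1 using that b by (auto simp: w k0)
    then show ?thesis by auto
  qed
  have nz2: "f 2 (-1) \<noteq> 0" using inv2[of "-1"] b by (auto simp: w)
  \<comment> \<open>The edge at -1 sets \<open>u 0 = u (-1)\<close>, an arbitrary choice; the edge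
    at 0 then sets \<open>u 1 = f 2 (-1) * u (-1)\<close>, which normalises the d_2 edge from -1 to
    1.\<close>
  define x where "x k = (if k = -1 then 1 else if k = 0 then f 2 (-1) else f 1 k)" for k
  define y :: "int \<Rightarrow> complex" where "y k = (if k = -1 \<or> k = 0 then 1 else of_int (k + 1))" for k
  have "x k \<noteq> 0" "y k \<noteq> 0" for k using nz nz2 by (auto simp: x_def y_def k0)
  from gauge_exists[of x y, OF this]
  obtain u where u: "\<And>k. u k \<noteq> 0" and xy: "\<And>k. x k * u k = y k * u (k + 1)" by blast
  interpret g: normal_invariants 0 "regauge u f" z b
    by (rule normal_invariants_regauge) (use u normal_invariants_axioms in auto)
  let ?g = "regauge u f"
  have p1: "?g 1 k = of_int k + 1" if "k \<noteq> -1" "k \<noteq> 0" for k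
    using xy[of k] u[of "k + 1"] that by (simp add: regauge_def x_def y_def field_simps)
  have m1: "?g (-1) (k + 1) = of_int k" if "k \<noteq> -1" "k \<noteq> 0" for k
  proof -
    have "?g (-1) (k + 1) * (of_int k + 1) = of_int k * (of_int k + 1)"
      using g.inv1[of k] p1[OF that] b by (auto simp: w algebra_simps)
    then show ?thesis using that k0[of k] by simp
  qed
  have g2: "?g 2 (-1) = 1" using xy[of "-1"] xy[of 0] u[of 1] by (simp add: regauge_def x_def y_def)
  have p2: "?g 2 k = of_int k + 2" if "k \<noteq> -2" "k \<noteq> 0" for k
  proof (cases "k = -1")
    case False
    have "of_int k * (of_int k + 1) * ?g 2 k = of_int k * (of_int k + 1) * (of_int k + 2)"
      using g.invX[of k] m1[of k] m1[of "k + 1"] that False b by (auto simp: w add.assoc algebra_simps)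
    then show ?thesis using that False k0[of k] by simp
  qed (use g2 in simp)
  have m2: "?g (-2) (k + 2) = of_int k" if "k \<noteq> -2" "k \<noteq> 0" for k
  proof -
    have "?g (-2) (k + 2) * (of_int k + 2) = of_int k * (of_int k + 2)"
      using g.inv2[of k] p2[OF that] b by (auto simp: w algebra_simps)
    then show ?thesis using that k0[of k] by simp
  qed
  have "singular_coeffs ?g z"
    by (intro singular_coeffs.intro g.weight_coeffs_axioms singular_coeffs_axioms.intro)
       (simp_all add: p1 m1 p2 m2)
  then show ?thesis using u by blast
qed

theorem weight_coeffs_classification:
  assumes "weight_coeffs UNIV a f z" and a: "a = 0 \<or> a \<notin> \<int>"
  shows "\<exists>u. (\<forall>k. u k \<noteq> 0) \<and> ((\<exists>b. regauge u f = V_coeff a b) \<or>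
    a = 0 \<and> (\<exists>\<alpha> \<beta>. (\<alpha> \<noteq> 0 \<or> \<beta> \<noteq> 0) \<and> regauge u f = A_coeff \<alpha> \<beta>) \<or> a = 0 \<and> (\<exists>\<alpha> \<beta>. regauge u f = B_coeff \<alpha> \<beta>))"
proof -
  obtain b where "normal_invariants a f z b" using normal_invariants_exist[OF assms(1)] by blast
  then interpret normal_invariants a f z b .
  \<comment> \<open>If the first case fails, some weight is - b or b - 1 with b in {0, 1, 1/2}. For
    b = 1/2 that weight is -1/2; for b in {0, 1} it is 0 or -1, so a is an integer and hence
    0.\<close>
  consider "b \<noteq> 0 \<and> b \<noteq> 1 \<and> b \<noteq> 1/2 \<or> (\<forall>k. wt k \<noteq> - b \<and> wt k \<noteq> b - 1)"
    | j where "b = 1/2" "wt j = - 1/2" | "b = 0 \<or> b = 1" "a = 0"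
  proof -
    have "a = 0" if "wt k = - b \<or> wt k = b - 1" "b = 0 \<or> b = 1" for k
    proof -
      have "a + of_int k = 0 \<or> a + of_int k = -1" using that by (auto simp: wt_def)
      then have "a = of_int (- k) \<or> a = of_int (- 1 - k)" by (auto simp: algebra_simps add_eq_0_iff2)
      then have "a \<in> \<int>" by auto
      then show ?thesis using a by simp
    qed
    then show thesis using that by (cases "b = 1/2") auto
  qed
  then show ?thesis
  proof cases
    case 1
    from regauge_V_generic[OF this] show ?thesis by blast
  next
    case 2
    from regauge_V_half[OF this] show ?thesis by blast
  next
    case 3
    have "normal_invariants 0 f z b" using normal_invariants_axioms 3 by simp
    from regauge_singular[OF this 3(1)] obtain u
      where u: "\<And>k. u k \<noteq> 0" and "singular_coeffs (regauge u f) z" by blast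
    then interpret s: singular_coeffs "regauge u f" z by blast
    show ?thesis
    proof (cases "regauge u f 1 0 = 0 \<and> regauge u f (-1) 0 = 0")
      case True
      then obtain v \<alpha> \<beta> where v: "\<And>k. v k \<noteq> 0" "regauge v (regauge u f) = B_coeff \<alpha> \<beta>"
        using s.regauge_B by blast
      have "regauge (\<lambda>k. u k * v k) f = B_coeff \<alpha> \<beta>"
        using v(2) by (simp only: regauge_regauge[of u v, OF u v(1)])
      moreover have "\<forall>k. u k * v k \<noteq> 0" using u v(1) by simp
      ultimately show ?thesis using 3 by (intro exI[of _ "\<lambda>k. u k * v k"]) auto
    next
      case False
      define \<alpha> where "\<alpha> = (regauge u f 1 0 - regauge u f (-1) 0) / 2"
      define \<beta> where "\<beta> = (regauge u f 1 0 + regauge u f (-1) 0) / 2"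
      have "regauge u f = A_coeff \<alpha> \<beta>" unfolding \<alpha>_def \<beta>_def by (rule s.eq_A) (use False in blast)
      moreover have "\<alpha> \<noteq> 0 \<or> \<beta> \<noteq> 0" using False by (auto simp: \<alpha>_def \<beta>_def eq_neg_iff_add_eq_0)
      ultimately show ?thesis using 3 u by blast
    qed
  qed
qed

section \<open>Evaluation at a single point\<close>

lemma regauge_A_coeff:
  assumes "c \<noteq> 0"
  shows "regauge (\<lambda>k. if k = 0 then c else 1) (A_coeff \<alpha> \<beta>) = A_coeff (c * \<alpha>) (c * \<beta>)"
  using assms by (auto simp: fun_eq_iff regauge_def A_coeff_def algebra_simps simp del: of_int_add)

lemma regauge_B_coeff:
  assumes "c \<noteq> 0"
  shows "regauge (\<lambda>k. if k = 0 then c else 1) (B_coeff \<alpha> \<beta>) = B_coeff (\<alpha> / c) (\<beta> / c)"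
  using assms by (auto simp: fun_eq_iff regauge_def B_coeff_def field_simps)

lemma A_coeff_eq_V: "A_coeff 1 0 = V_coeff 0 1"
  by (auto simp: fun_eq_iff A_coeff_def V_coeff_def)

lemma B_coeff_eq_V: "B_coeff (- 1) 0 = V_coeff 0 0"
  by (auto simp: fun_eq_iff B_coeff_def V_coeff_def add_eq_0_iff2)

text \<open>Rescaling w_0 alone moves (\<alpha>, \<beta>) along a line through the origin, so
  \<beta> can be made 1 for A and -1 for B; the lines with \<beta> = 0 give V(0,1) and V(0,0), and
  the origin of B remains.\<close>

theorem weight_coeffs_normal_form:
  assumes "weight_coeffs UNIV a f z" and a: "a = 0 \<or> a \<notin> \<int>"
  shows "\<exists>u. (\<forall>k. u k \<noteq> 0) \<and> ((\<exists>b. regauge u f = V_coeff a b) \<or>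
    a = 0 \<and> (\<exists>\<alpha>. regauge u f = A_coeff \<alpha> 1) \<or> a = 0 \<and> (\<exists>\<alpha>. regauge u f = B_coeff (- \<alpha>) (- 1)) \<or>
    a = 0 \<and> regauge u f = B_coeff 0 0)"
proof -
  obtain u where u: "\<And>k. u k \<noteq> 0" and cases: "(\<exists>b. regauge u f = V_coeff a b) \<or>
    a = 0 \<and> (\<exists>\<alpha> \<beta>. (\<alpha> \<noteq> 0 \<or> \<beta> \<noteq> 0) \<and> regauge u f = A_coeff \<alpha> \<beta>) \<or> a = 0 \<and> (\<exists>\<alpha> \<beta>. regauge u f = B_coeff \<alpha> \<beta>)"
    using weight_coeffs_classification[OF assms] by blast
  have again: ?thesis if "\<And>k. v k \<noteq> 0" "(\<exists>b. regauge v (regauge u f) = V_coeff a b) \<or>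
    a = 0 \<and> (\<exists>\<alpha>. regauge v (regauge u f) = A_coeff \<alpha> 1) \<or>
    a = 0 \<and> (\<exists>\<alpha>. regauge v (regauge u f) = B_coeff (- \<alpha>) (- 1)) \<or>
    a = 0 \<and> regauge v (regauge u f) = B_coeff 0 0" for v
    using that(2) u that(1) unfolding regauge_regauge[of u v, OF u that(1)]
    by (intro exI[of _ "\<lambda>k. u k * v k"]) simp
  from cases consider "\<exists>b. regauge u f = V_coeff a b"
    | \<alpha> \<beta> where "a = 0" "\<alpha> \<noteq> 0 \<or> \<beta> \<noteq> 0" "regauge u f = A_coeff \<alpha> \<beta>"
    | \<alpha> \<beta> where "a = 0" "regauge u f = B_coeff \<alpha> \<beta>" by blast
  then show ?thesis
  proof cases
    case 1
    then show ?thesis using u by blast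
  next
    case 2
    define c where "c = (if \<beta> = 0 then 1 / \<alpha> else 1 / \<beta>)"
    have c: "c \<noteq> 0" using 2 by (auto simp: c_def)
    have "A_coeff (c * \<alpha>) (c * \<beta>) = (if \<beta> = 0 then V_coeff 0 1 else A_coeff (\<alpha> / \<beta>) 1)"
      using 2(2) by (auto simp: c_def simp flip: A_coeff_eq_V)
    then show ?thesis
      by (intro again[of "\<lambda>k. if k = 0 then c else 1"])
         (use 2 c in \<open>auto simp: regauge_A_coeff[OF c]\<close>)
  next
    case 3
    define c where "c = (if \<beta> \<noteq> 0 then - \<beta> else if \<alpha> \<noteq> 0 then - \<alpha> else 1)"
    have c: "c \<noteq> 0" by (auto simp: c_def)
    have "B_coeff (\<alpha> / c) (\<beta> / c) = (if \<beta> \<noteq> 0 then B_coeff (- (\<alpha> / \<beta>)) (- 1)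
        else if \<alpha> \<noteq> 0 then V_coeff 0 0 else B_coeff 0 0)"
      by (auto simp: c_def simp flip: B_coeff_eq_V)
    then have "(\<exists>b. B_coeff (\<alpha> / c) (\<beta> / c) = V_coeff 0 b) \<or>
        (\<exists>\<gamma>. B_coeff (\<alpha> / c) (\<beta> / c) = B_coeff (- \<gamma>) (- 1)) \<or> B_coeff (\<alpha> / c) (\<beta> / c) = B_coeff 0 0"
      by (cases "\<beta> = 0"; cases "\<alpha> = 0"; simp only: if_True if_False not_True_eq_False simp_thms; blast)
    with 3(1) show ?thesis
      by (intro again[of "\<lambda>k. if k = 0 then c else 1"], unfold 3(2) regauge_B_coeff[OF c])
         (use c in simp, blast)
  qed
qed

section \<open>The graph of nonzero coefficients\<close>

definition adjacent :: "(int \<Rightarrow> int \<Rightarrow> complex) \<Rightarrow> int \<Rightarrow> int \<Rightarrow> bool" where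
  "adjacent f k l \<longleftrightarrow> k \<noteq> l \<and> (f (l - k) k \<noteq> 0 \<or> f (k - l) l \<noteq> 0)"

lemma adjacent_sym: "adjacent f k l \<longleftrightarrow> adjacent f l k"
  by (auto simp: adjacent_def)

lemma adjacent_regauge:
  assumes "\<And>k. u k \<noteq> 0"
  shows "adjacent (regauge u f) = adjacent f"
  using assms by (auto simp: fun_eq_iff adjacent_def regauge_def)

text \<open>The two coefficients between \<open>k\<close> and \<open>l\<close> add up to 2 a + k +
  l, since \<open>b\<close> cancels; so both vanish for at most one \<open>l\<close> other than
  \<open>k\<close>.\<close>

lemma finite_nonadjacent_V: "finite {l. \<not> adjacent (V_coeff a b) k l}"
proof (rule finite_subset)
  show "finite ({k} \<union> {l. 2 * a + of_int k + of_int l = 0})"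
  proof -
    have "{l. 2 * a + of_int k + of_int l = 0} \<subseteq> {l}" if "2 * a + of_int k + of_int l = 0" for l
      using that by auto (metis add_left_cancel of_int_eq_iff)
    then show ?thesis
      by (cases "\<exists>l. 2 * a + of_int k + of_int l = 0") (auto intro: finite_subset)
  qed
  show "{l. \<not> adjacent (V_coeff a b) k l} \<subseteq> {k} \<union> {l. 2 * a + of_int k + of_int l = 0}"
  proof
    fix l assume "l \<in> {l. \<not> adjacent (V_coeff a b) k l}"
    moreover have "V_coeff a b (l - k) k + V_coeff a b (k - l) l = 2 * a + of_int k + of_int l"
      by (simp add: V_coeff_def algebra_simps)
    ultimately show "l \<in> {k} \<union> {l. 2 * a + of_int k + of_int l = 0}"
      by (auto simp: adjacent_def)
  qed
qed

lemma finite_linear_roots: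
  assumes "\<alpha> \<noteq> 0 \<or> \<beta> \<noteq> (0 :: complex)"
  shows "finite {m :: int. \<alpha> + \<beta> * of_int m = 0}"
proof (cases "\<beta> = 0")
  case False
  then have "{m :: int. \<alpha> + \<beta> * of_int m = 0} \<subseteq> {m}" if "\<alpha> + \<beta> * of_int m = 0" for m
    using that by auto (metis add_left_cancel mult_cancel_left of_int_eq_iff)
  then show ?thesis
    by (cases "\<exists>m :: int. \<alpha> + \<beta> * of_int m = 0") (auto intro: finite_subset)
qed (use assms in auto)

lemma finite_nonadjacent_A:
  assumes "\<alpha> \<noteq> 0 \<or> \<beta> \<noteq> 0"
  shows "finite {l. \<not> adjacent (A_coeff \<alpha> \<beta>) k l}"
proof (rule finite_subset)
  show "finite ({0, k} \<union> {m :: int. \<alpha> + \<beta> * of_int m = 0})"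
    using finite_linear_roots[OF assms] by simp
qed (auto simp: adjacent_def A_coeff_def)

lemma finite_nonadjacent_B:
  assumes "k \<noteq> 0 \<or> \<alpha> \<noteq> 0 \<or> \<beta> \<noteq> 0"
  shows "finite {l. \<not> adjacent (B_coeff \<alpha> \<beta>) k l}"
proof (cases "k = 0")
  case True
  show ?thesis
  proof (rule finite_subset)
    show "finite ({0} \<union> {m :: int. \<alpha> + - \<beta> * of_int m = 0})"
      using finite_linear_roots[of \<alpha> "- \<beta>"] assms True by simp
    show "{l. \<not> adjacent (B_coeff \<alpha> \<beta>) k l} \<subseteq> {0} \<union> {m :: int. \<alpha> + - \<beta> * of_int m = 0}"
      using True by (auto simp: adjacent_def B_coeff_def)
  qed
next
  case False
  then have "{l. \<not> adjacent (B_coeff \<alpha> \<beta>) k l} \<subseteq> {0, k}"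
    by (auto simp: adjacent_def B_coeff_def)
  then show ?thesis by (rule finite_subset) simp
qed

lemma isolated_B: "\<not> adjacent (B_coeff 0 0) 0 l"
  by (auto simp: adjacent_def B_coeff_def)

section \<open>The loop variable and the evaluation point\<close>

locale loop_coeffs =
  fixes S :: "int set" and a :: complex and F :: "int \<Rightarrow> int \<Rightarrow> int \<Rightarrow> complex"
    and Z :: "int \<Rightarrow> int \<Rightarrow> complex"
  assumes F_d0: "k \<in> S \<Longrightarrow> F 0 0 k = a + of_int k"
    and F_supp: "k \<notin> S \<or> k + m \<notin> S \<Longrightarrow> F m j k = 0"
    and F_bracket: "k \<in> S \<Longrightarrow> F m i (k + n) * F n j k - F n j (k + m) * F m i k =
      of_int (n - m) * F (m + n) (i + j) k +
      (if m = - n then (of_int m ^ 3 - of_int m) / 12 * Z (i + j) k else 0)"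
    and F_central: "Z j (k + m) * F m i k = Z j k * F m i k"
begin

lemma weight_coeffs: "weight_coeffs S a (\<lambda>m. F m 0) (Z 0)"
proof
  fix k m n
  show "k \<in> S \<Longrightarrow> F m 0 (k + n) * F n 0 k - F n 0 (k + m) * F m 0 k =
       of_int (n - m) * F (m + n) 0 k +
           (if m = - n then (of_int m ^ 3 - of_int m) / 12 * Z 0 k else 0)"
    using F_bracket[of k m 0 n 0] by simp
qed (use F_d0 F_supp F_central in auto)

lemma shift:
  "of_int m * F m (i + j) k = (F 0 i (k + m) - F 0 i k) * F m j k"
proof (cases "k \<in> S")
  case True
  from F_bracket[OF this, of 0 i m j] show ?thesis by (simp add: algebra_simps)
qed (simp add: F_supp)

text \<open>By \<open>shift\<close>, the factor \<open>r\<close> with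
  \<open>F m (i + j) k = r i * F m j k\<close> is a homomorphism from the integers to the nonzero
  complex numbers, hence a power function.\<close>

lemma edge_ratio:
  assumes "m \<noteq> 0" "F m 0 k \<noteq> 0"
  shows "\<exists>\<rho>. \<rho> \<noteq> 0 \<and> (\<forall>j. F 0 j (k + m) - F 0 j k = of_int m * \<rho> powi j)"
proof -
  define r where "r j = (F 0 j (k + m) - F 0 j k) / of_int m" for j
  have F: "F m (i + j) k = r i * F m j k" for i j
    using shift[of m i j k] assms(1) by (simp add: r_def field_simps)
  have "k \<in> S" "k + m \<in> S" using assms(2) F_supp by blast+
  then have "r 0 = 1" using assms(1) by (simp add: r_def F_d0)
  have mult: "r (i + j) = r i * r j" for i j
    using F[of "i + j" 0] F[of i j] F[of j 0] assms(2) by simp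
  have r1: "r 1 \<noteq> 0" using mult[of 1 "-1"] \<open>r 0 = 1\<close> by auto
  have "r j = r 1 powi j" for j
  proof (induction j rule: int_induct[of _ 0])
    case (step1 i)
    then show ?case using mult[of i 1] r1 by (simp add: power_int_add)
  next
    case (step2 i)
    then show ?case using mult[of "i - 1" 1] r1 by (simp add: power_int_diff field_simps)
  qed (simp add: \<open>r 0 = 1\<close>)
  then have "F 0 j (k + m) - F 0 j k = of_int m * r 1 powi j" for j
    using assms(1) unfolding r_def by (metis nonzero_mult_div_cancel_left of_int_eq_0_iff times_divide_eq_right)
  then show ?thesis using r1 by blast
qed

text \<open>Stated through eigenvalue differences of d_0 t^j instead of coefficients of d_m t^j, it
  does not depend on the direction of the edge and adds up around triangles.\<close>

definition ratio :: "int \<Rightarrow> int \<Rightarrow> complex \<Rightarrow> bool" where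
  "ratio k l \<rho> \<longleftrightarrow> (\<forall>j. F 0 j l - F 0 j k = of_int (l - k) * \<rho> powi j)"

lemma ratio_sym: "ratio k l \<rho> \<longleftrightarrow> ratio l k \<rho>"
proof -
  have "F 0 j l - F 0 j k = of_int (l - k) * \<rho> powi j \<longleftrightarrow> F 0 j k - F 0 j l = of_int (k - l) * \<rho> powi j" for j
    by (metis (no_types, opaque_lifting) minus_diff_eq mult_minus_left neg_equal_iff_equal of_int_minus)
  then show ?thesis by (simp add: ratio_def)
qed

abbreviation adj :: "int \<Rightarrow> int \<Rightarrow> bool" where "adj \<equiv> adjacent (\<lambda>m. F m 0)"

lemma adj_ratio:
  assumes "adj k l"
  shows "\<exists>\<rho>. \<rho> \<noteq> 0 \<and> ratio k l \<rho>"
proof -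
  have "l - k \<noteq> 0" "k - l \<noteq> 0" using assms by (simp_all add: adjacent_def)
  then show ?thesis
    using assms edge_ratio[of "l - k" k] edge_ratio[of "k - l" l] ratio_sym[of l k]
    by (auto simp: adjacent_def ratio_def)
qed

lemma triangle:
  assumes "k \<noteq> l" "l \<noteq> t" "k \<noteq> t" and 1: "ratio k l \<rho>" and 2: "ratio l t \<sigma>" and 3: "ratio k t \<tau>"
  shows "\<rho> = \<sigma> \<and> \<sigma> = \<tau>"
proof -
  define x where "x = (of_int (l - k) :: complex)"
  define y where "y = (of_int (t - l) :: complex)"
  have nz: "x \<noteq> 0" "y \<noteq> 0" "x + y \<noteq> 0"
    using assms by (simp_all add: x_def y_def)
  have "x * \<rho> powi j + y * \<sigma> powi j = (x + y) * \<tau> powi j" for j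
  proof -
    have "x * \<rho> powi j = F 0 j l - F 0 j k" using 1 by (simp add: ratio_def x_def)
    moreover have "y * \<sigma> powi j = F 0 j t - F 0 j l" using 2 by (simp add: ratio_def y_def)
    moreover have "x + y = of_int (t - k)" by (simp add: x_def y_def)
    moreover from this have "(x + y) * \<tau> powi j = F 0 j t - F 0 j k" using 3 by (simp add: ratio_def)
    ultimately show ?thesis by simp
  qed
  from this[of 1] this[of 2] have e1: "x * \<rho> + y * \<sigma> = (x + y) * \<tau>"
    and e2: "x * \<rho> ^ 2 + y * \<sigma> ^ 2 = (x + y) * \<tau> ^ 2" by simp_all
  \<comment> \<open>The exponents 1 and 2 suffice: this is the unnormalised variance of two values
    with masses x and y.\<close>
  have "x * y * (\<rho> - \<sigma>) ^ 2 = (x + y) * (x * \<rho> ^ 2 + y * \<sigma> ^ 2) - (x * \<rho> + y * \<sigma>) ^ 2"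
    by (simp add: power2_eq_square algebra_simps)
  also have "\<dots> = 0" unfolding e1 e2 by (simp add: power2_eq_square algebra_simps)
  finally have "\<rho> = \<sigma>" using nz by simp
  moreover from this have "\<sigma> = \<tau>" using e1 nz(3) by (simp flip: distrib_right)
  ultimately show ?thesis by simp
qed

lemma common_neighbour:
  assumes "finite K" "\<And>k. k \<in> K \<Longrightarrow> finite {l. \<not> adj k l}"
  shows "\<exists>t. t \<notin> K \<and> (\<forall>k\<in>K. adj k t)"
proof -
  have "finite (K \<union> (\<Union>k\<in>K. {l. \<not> adj k l}))" using assms by blast
  then obtain t where "t \<notin> K \<union> (\<Union>k\<in>K. {l. \<not> adj k l})"
    using ex_new_if_finite infinite_UNIV_int by blast
  then show ?thesis by blast
qed

lemma constant_ratio: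
  assumes fin: "\<And>k l. adj k l \<Longrightarrow> finite {l. \<not> adj k l}"
  shows "\<exists>e. e \<noteq> 0 \<and> (\<forall>k l. adj k l \<longrightarrow> ratio k l e)"
proof (cases "\<exists>k l. adj k l")
  case False
  then show ?thesis by (intro exI[of _ 1]) auto
next
  case True
  then obtain k0 l0 where 0: "adj k0 l0" by blast
  then obtain e where e: "e \<noteq> 0" "ratio k0 l0 e" using adj_ratio by blast
  have "ratio k l e" if kl: "adj k l" for k l
  proof -
    have f: "finite {l. \<not> adj i l}" if "i \<in> {k0, l0, k, l}" for i
      using that 0 kl fin adjacent_sym by blast
    \<comment> \<open>The two edges are compared along the triangles k0 l0 t, l0 t s, k t s, k l t.
      The second apex \<open>s\<close> is there because \<open>l0\<close> and \<open>k\<close> may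
      coincide or fail to be adjacent.\<close>
    obtain t where t: "t \<notin> {k0, l0, k, l}" "adj k0 t" "adj l0 t" "adj k t" "adj l t"
      using common_neighbour[of "{k0, l0, k, l}", OF _ f] by auto
    have f': "finite {l. \<not> adj i l}" if "i \<in> {l0, k, t}" for i
      using that f t fin adjacent_sym by blast
    obtain s where s: "s \<notin> {l0, k, t}" "adj l0 s" "adj k s" "adj t s"
      using common_neighbour[of "{l0, k, t}", OF _ f'] by auto
    have ne: "k0 \<noteq> l0" "k \<noteq> l" using 0 kl by (auto simp: adjacent_def)
    obtain \<rho> where \<rho>: "ratio k l \<rho>" using adj_ratio[OF kl] by blast
    obtain r1 where r1: "ratio k0 t r1" using adj_ratio[OF t(2)] by blast
    obtain r2 where r2: "ratio l0 t r2" using adj_ratio[OF t(3)] by blast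
    obtain r3 where r3: "ratio k t r3" using adj_ratio[OF t(4)] by blast
    obtain r4 where r4: "ratio l t r4" using adj_ratio[OF t(5)] by blast
    obtain r5 where r5: "ratio l0 s r5" using adj_ratio[OF s(2)] by blast
    obtain r6 where r6: "ratio k s r6" using adj_ratio[OF s(3)] by blast
    obtain r7 where r7: "ratio t s r7" using adj_ratio[OF s(4)] by blast
    have "e = r2" using triangle[OF _ _ _ e(2) r2 r1] t(1) ne by blast
    moreover have "r2 = r7" using triangle[OF _ _ _ r2 r7 r5] t(1) s(1) by blast
    moreover have "r3 = r7" using triangle[OF _ _ _ r3 r7 r6] t(1) s(1) by blast
    moreover have "\<rho> = r3" using triangle[OF _ _ _ \<rho> r4 r3] t(1) ne by blast
    ultimately show ?thesis using \<rho> by simp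
  qed
  then show ?thesis using e by blast
qed

text \<open>For m nonzero this is \<open>shift\<close>. The rest follows from [d_1 t^j, d_-1] = -2
  d_0 t^j and [d_2 t^j, d_-2] = -4 d_0 t^j + (1/2) c t^j.\<close>

lemma evaluation:
  assumes ratio: "\<And>k l. adj k l \<Longrightarrow> ratio k l e"
  shows "F m j k = e powi j * F m 0 k" "k \<in> S \<Longrightarrow> Z j k = e powi j * Z 0 k"
proof -
  have nz: "F m j k = e powi j * F m 0 k" if "m \<noteq> 0" for m j k
  proof (cases "F m 0 k = 0")
    case True
    then show ?thesis using shift[of m j 0 k] that by simp
  next
    case False
    then have "adj k (k + m)" using that by (simp add: adjacent_def)
    then have "F 0 j (k + m) - F 0 j k = of_int m * e powi j" using ratio[of k "k + m"] by (simp add: ratio_def)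
    then show ?thesis using shift[of m j 0 k] that by simp
  qed
  have zero: "F 0 j k = e powi j * F 0 0 k" for j k
  proof (cases "k \<in> S")
    case True
    have "- 2 * F 0 j k = F 1 j (k - 1) * F (-1) 0 k - F (-1) 0 (k + 1) * F 1 j k"
      using F_bracket[OF True, of 1 j "-1" 0] by simp
    also have "\<dots> = e powi j * (F 1 0 (k - 1) * F (-1) 0 k - F (-1) 0 (k + 1) * F 1 0 k)"
      by (simp add: nz[of 1 j] algebra_simps)
    also have "F 1 0 (k - 1) * F (-1) 0 k - F (-1) 0 (k + 1) * F 1 0 k = - 2 * F 0 0 k"
      using F_bracket[OF True, of 1 0 "-1" 0] by simp
    finally show ?thesis by simp
  qed (simp add: F_supp)
  show "F m j k = e powi j * F m 0 k" using nz zero by (cases "m = 0") blast+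
  show "Z j k = e powi j * Z 0 k" if "k \<in> S"
  proof -
    have "Z j k / 2 = F 2 j (k - 2) * F (-2) 0 k - F (-2) 0 (k + 2) * F 2 j k + 4 * F 0 j k"
      using F_bracket[OF that, of 2 j "-2" 0] by simp
    also have "\<dots> = e powi j * (F 2 0 (k - 2) * F (-2) 0 k - F (-2) 0 (k + 2) * F 2 0 k + 4 * F 0 0 k)"
      by (simp add: nz[of 2 j] zero[of j] algebra_simps)
    also have "F 2 0 (k - 2) * F (-2) 0 k - F (-2) 0 (k + 2) * F 2 0 k + 4 * F 0 0 k = Z 0 k / 2"
      using F_bracket[OF that, of 2 0 "-2" 0] by simp
    finally show ?thesis by simp
  qed
qed

end

theorem (in loop_coeffs) loop_normal_form:
  assumes "S \<noteq> {}" and a: "a = 0 \<or> a \<notin> \<int>"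
    and nontrivial: "(\<exists>m j k. F m j k \<noteq> 0) \<or> (\<exists>j k. k \<in> S \<and> Z j k \<noteq> 0)"
  shows "\<exists>e u. e \<noteq> 0 \<and> (\<forall>k. u k \<noteq> 0) \<and> (\<forall>k\<in>S. \<forall>j. Z j k = 0) \<and>
     (\<exists>g. (\<forall>m j k. F m j k * u k = e powi j * g m k * u (k + m)) \<and>
     (S = UNIV \<and> (\<exists>b. g = V_coeff a b) \<or> S = UNIV \<and> a = 0 \<and> (\<exists>\<alpha>. g = A_coeff \<alpha> 1) \<or>
      S = UNIV \<and> a = 0 \<and> (\<exists>\<alpha>. g = B_coeff (- \<alpha>) (- 1)) \<or>
      (S = UNIV \<or> S = - {0}) \<and> a = 0 \<and> g = B_coeff 0 0))"
proof -
  interpret f: weight_coeffs S a "\<lambda>m. F m 0" "Z 0" by (rule weight_coeffs)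
  let ?f = "\<lambda>m. F m 0"
  have a0: "a = 0 \<and> k = 0" if "f.wt k = 0" for k
  proof -
    have "a = of_int (- k)" using that by (simp add: f.wt_def eq_neg_iff_add_eq_0)
    then have "a \<in> \<int>" by auto
    then have "a = 0" using a by simp
    then show ?thesis using that unfolding f.wt_def by simp
  qed
  \<comment> \<open>On a single weight line all d_m t^j with m nonzero act by 0, and so do d_0 t^j
    and c t^j, which are obtained from their brackets.\<close>
  have notsing: "S \<noteq> {0}"
  proof
    assume S: "S = {0}"
    have F0: "F m j k = 0" if "m \<noteq> 0" for m j k
      using F_supp[of k m j] that by (auto simp: S)
    have "- 2 * F 0 j 0 = 0" for j
      using F_bracket[of 0 1 j "-1" 0] S by (simp add: F0)
    then have Fj: "F m j k = 0" for m j k using F0[of m j k] F_supp[of k m j] S by (cases "m = 0"; cases "k = 0") auto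
    have "Z j 0 = 0" for j
      using F_bracket[of 0 2 j "-2" 0] S by (simp add: Fj)
    then show False using nontrivial Fj S by auto
  qed
  have S: "S = UNIV \<or> a = 0 \<and> S = - {0}"
    using f.support[OF assms(1)] a0 notsing by blast
  define z where "z = (if S = UNIV then Z 0 else (Z 0)(0 := 0))"
  have full: "weight_coeffs UNIV a ?f z"
  proof (cases "S = UNIV")
    case True
    then show ?thesis using weight_coeffs by (simp add: z_def)
  next
    case False
    then show ?thesis using S weight_coeffs weight_coeffs_fill_zero[of ?f "Z 0"] by (auto simp: z_def)
  qed
  have Z0: "Z 0 k = 0" if "k \<in> S" for k
    using central_zero[OF full, of k] that S by (auto simp: z_def split: if_splits)
  obtain u where u: "\<And>k. u k \<noteq> 0" and cases: "(\<exists>b. regauge u ?f = V_coeff a b) \<or>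
    a = 0 \<and> (\<exists>\<alpha>. regauge u ?f = A_coeff \<alpha> 1) \<or> a = 0 \<and> (\<exists>\<alpha>. regauge u ?f = B_coeff (- \<alpha>) (- 1)) \<or>
    a = 0 \<and> regauge u ?f = B_coeff 0 0"
    using weight_coeffs_normal_form[OF full a] by blast
  define g where "g = regauge u ?f"
  have adj: "adj = adjacent g" unfolding g_def by (rule adjacent_regauge[symmetric]) (use u in auto)
  have fin: "finite {l. \<not> adj k l}" if "adj k l" for k l
  proof (cases "k = 0 \<and> g = B_coeff 0 0")
    case True
    then show ?thesis using that isolated_B[of l] by (simp add: adj)
  next
    case False
    then show ?thesis unfolding adj
      using cases finite_nonadjacent_V finite_nonadjacent_A[of _ 1] finite_nonadjacent_B[of k]
      unfolding g_def[symmetric] by (auto simp: adjacent_def)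
  qed
  have "\<exists>e. e \<noteq> 0 \<and> (\<forall>k l. adj k l \<longrightarrow> ratio k l e)" by (rule constant_ratio) (rule fin)
  then obtain e where e: "e \<noteq> 0" "\<And>k l. adj k l \<Longrightarrow> ratio k l e" by (elim exE conjE) simp
  have ev: "F m j k = e powi j * F m 0 k" for m j k using e(2) by (rule evaluation(1))
  have evZ: "Z j k = e powi j * Z 0 k" if "k \<in> S" for j k using e(2) that by (rule evaluation(2))
  have Fg: "F m j k * u k = e powi j * g m k * u (k + m)" for m j k
  proof -
    have "F m 0 k * u k = g m k * u (k + m)" unfolding g_def regauge_def using u by simp
    then show ?thesis using ev[of m j k] by (metis mult.assoc)
  qed
  have Zj: "Z j k = 0" if "k \<in> S" for j k using evZ[OF that, of j] Z0[OF that] by simp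
  \<comment> \<open>Nothing leads into or out of index 0, and among the normal forms only this one
    has that property.\<close>
  have g0: "g = B_coeff 0 0" if nS: "S \<noteq> UNIV"
  proof -
    have out: "g m 0 = 0" and into: "g m (- m) = 0" for m
      using S nS F_supp[of 0 m 0] F_supp[of "- m" m 0] by (auto simp: g_def regauge_def)
    from cases consider b where "g = V_coeff 0 b" | \<alpha> where "g = A_coeff \<alpha> 1" | \<alpha> where "g = B_coeff (- \<alpha>) (- 1)"
      | "g = B_coeff 0 0" using S nS unfolding g_def[symmetric] by auto
    then show ?thesis
    proof cases
      case 1
      then show ?thesis using out[of 1] into[of 1] by (simp add: V_coeff_def)
    next
      case 2
      then show ?thesis using out[of 1] out[of 2] by (auto simp: A_coeff_def add_eq_0_iff2)
    next
      case 3
      then show ?thesis using into[of 1] into[of 2] by (auto simp: B_coeff_def)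
    qed
  qed
  have "S = UNIV \<and> (\<exists>b. g = V_coeff a b) \<or> S = UNIV \<and> a = 0 \<and> (\<exists>\<alpha>. g = A_coeff \<alpha> 1) \<or>
      S = UNIV \<and> a = 0 \<and> (\<exists>\<alpha>. g = B_coeff (- \<alpha>) (- 1)) \<or>
      (S = UNIV \<or> S = - {0}) \<and> a = 0 \<and> g = B_coeff 0 0"
    using cases g0 S unfolding g_def[symmetric] by blast
  then show ?thesis using e(1) u Fg Zj by blast
qed

section \<open>Weight spaces of modules over the loop-Virasoro algebra\<close>

definition gen_d :: "int \<Rightarrow> int \<Rightarrow> loop_vir" where
  "gen_d m j = loop_tensor (Poly_Mapping.single (D m) 1) j"

definition gen_c :: "int \<Rightarrow> loop_vir" where
  "gen_c j = loop_tensor (Poly_Mapping.single C 1) j"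

lemma loop_vir_basis_induct [case_names zero add scale d c]:
  assumes "P 0" "\<And>x y. P x \<Longrightarrow> P y \<Longrightarrow> P (x + y)" "\<And>z x. P x \<Longrightarrow> P (loop_scale z x)"
    "\<And>m j. P (gen_d m j)" "\<And>j. P (gen_c j)"
  shows "P x"
proof (induction x rule: loop_vir_induct)
  case (tensor x j)
  show ?case
  proof (induction x rule: poly_mapping_add_induct)
    case (single k z)
    have "loop_tensor (Poly_Mapping.single k z) j = loop_scale z (loop_tensor (Poly_Mapping.single k 1) j)"
      by (simp add: loop_scale_tensor)
    then show ?case using assms(3-5) by (cases k) (simp_all add: gen_d_def gen_c_def)
  qed (use assms in \<open>simp_all add: loop_tensor_add\<close>)
qed (use assms in auto)

context loop_vir_module
begin

lemma act_0_left [simp]: "act 0 v = 0"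
  using act_scale_left[of 0 0 v] by simp

lemma act_0_right [simp]: "act x 0 = 0"
  using act_scale_right[of x 0 0] by simp

lemma act_sum_right: "act x (\<Sum>i\<in>I. g i) = (\<Sum>i\<in>I. act x (g i))"
  by (induction I rule: infinite_finite_induct) (simp_all add: act_add_right)

lemma act_d_d:
  "act (gen_d m i) (act (gen_d n j) v) - act (gen_d n j) (act (gen_d m i) v) =
     scale (of_int (n - m)) (act (gen_d (m + n) (i + j)) v) +
     (if m = - n then scale ((of_int m ^ 3 - of_int m) / 12) (act (gen_c (i + j)) v) else 0)"
  unfolding act_bracket[symmetric] gen_d_def gen_c_def loop_bracket_basis
  by (simp add: act_add_left act_scale_left eq_neg_iff_add_eq_0)

lemma act_c: "act (gen_c j) (act x v) = act x (act (gen_c j) v)"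
  using act_bracket[of "gen_c j" x v] by (simp add: gen_c_def loop_bracket_basis)

lemma weight_iff: "v \<in> weight_space \<mu> \<longleftrightarrow> act (gen_d 0 0) v = scale \<mu> v"
  by (simp add: weight_space_def gen_d_def)

lemma subspace_weight: "subspace (weight_space \<mu>)"
  unfolding subspace_def by (auto simp: weight_iff act_add_right act_scale_right scale_right_distrib mult.commute)

lemma act_d_weight:
  assumes "v \<in> weight_space \<mu>"
  shows "act (gen_d m j) v \<in> weight_space (\<mu> + of_int m)"
proof -
  have "act (gen_d 0 0) (act (gen_d m j) v) - act (gen_d m j) (act (gen_d 0 0) v) = scale (of_int m) (act (gen_d m j) v)"
    using act_d_d[of 0 0 m j v] by simp
  then have "act (gen_d 0 0) (act (gen_d m j) v) = scale (of_int m) (act (gen_d m j) v) + scale \<mu> (act (gen_d m j) v)"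
    using assms by (simp add: weight_iff act_scale_right algebra_simps)
  then show ?thesis by (simp add: weight_iff scale_left_distrib add.commute)
qed

lemma act_c_weight:
  assumes "v \<in> weight_space \<mu>"
  shows "act (gen_c j) v \<in> weight_space \<mu>"
  using assms by (simp add: weight_iff act_c[symmetric] act_scale_right)

lemma weight_vectors_independent:
  assumes "finite I" "\<And>\<mu>. \<mu> \<in> I \<Longrightarrow> v \<mu> \<in> weight_space \<mu>" "(\<Sum>\<mu>\<in>I. v \<mu>) = 0" "\<mu> \<in> I"
  shows "v \<mu> = 0"
  using assms
proof (induction I arbitrary: v \<mu> rule: finite_induct)
  case (insert \<nu> I)
  have "0 = act (gen_d 0 0) (\<Sum>\<mu>\<in>insert \<nu> I. v \<mu>) - scale \<nu> (\<Sum>\<mu>\<in>insert \<nu> I. v \<mu>)"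
    using insert.prems by simp
  also have "\<dots> = (\<Sum>\<mu>\<in>insert \<nu> I. scale (\<mu> - \<nu>) (v \<mu>))"
    using insert.prems(1)
    by (simp only: act_sum_right scale_sum_right sum_subtractf[symmetric])
       (rule sum.cong, auto simp: weight_iff scale_left_diff_distrib)
  also have "\<dots> = (\<Sum>\<mu>\<in>I. scale (\<mu> - \<nu>) (v \<mu>))" using insert.hyps by simp
  finally have sum0: "(\<Sum>\<mu>\<in>I. scale (\<mu> - \<nu>) (v \<mu>)) = 0" by simp
  have "scale (\<mu> - \<nu>) (v \<mu>) = 0" if "\<mu> \<in> I" for \<mu>
    by (rule insert.IH[OF _ sum0 that]) (use insert.prems subspace_weight in \<open>auto intro: subspace_scale\<close>)
  then have I: "v \<mu> = 0" if "\<mu> \<in> I" for \<mu> using that insert.hyps by (metis right_minus_eq scale_eq_0_iff)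
  then have "v \<nu> = 0" using insert.prems(2) insert.hyps by simp
  then show ?case using I insert.prems(3) by auto
qed simp

definition weight_part :: "complex set \<Rightarrow> 'v set" where
  "weight_part M = span (\<Union>\<mu>\<in>M. weight_space \<mu>)"

lemma weight_part_sum:
  assumes "v \<in> weight_part M"
  shows "\<exists>I g. finite I \<and> I \<subseteq> M \<and> (\<forall>\<mu>. g \<mu> \<in> weight_space \<mu>) \<and> v = (\<Sum>\<mu>\<in>I. g \<mu>)"
  using assms unfolding weight_part_def
proof (induction rule: span_induct_alt)
  case base
  show ?case using subspace_0[OF subspace_weight] by (intro exI[of _ "{}"] exI[of _ "\<lambda>_. 0"]) auto
next
  case (step c x y)
  then obtain \<mu> I g where x: "\<mu> \<in> M" "x \<in> weight_space \<mu>"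
    and g: "finite I" "I \<subseteq> M" "\<And>\<mu>. g \<mu> \<in> weight_space \<mu>" "y = (\<Sum>\<mu>\<in>I. g \<mu>)" by blast
  define h where "h = g(\<mu> := scale c x + (if \<mu> \<in> I then g \<mu> else 0))"
  have cx: "scale c x \<in> weight_space \<mu>" using x subspace_weight subspace_scale by blast
  have "h \<nu> \<in> weight_space \<nu>" for \<nu>
    using g(3) cx subspace_add[OF subspace_weight cx g(3)[of \<mu>]] by (simp add: h_def)
  moreover have "scale c x + y = (\<Sum>\<nu>\<in>insert \<mu> I. h \<nu>)"
  proof -
    have "(\<Sum>\<nu>\<in>insert \<mu> I. h \<nu>) = h \<mu> + (\<Sum>\<nu>\<in>I - {\<mu>}. h \<nu>)"
      using g(1) by (rule sum.insert_remove)
    also have "(\<Sum>\<nu>\<in>I - {\<mu>}. h \<nu>) = (\<Sum>\<nu>\<in>I - {\<mu>}. g \<nu>)" by (rule sum.cong) (auto simp: h_def)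
    also have "h \<mu> + \<dots> = scale c x + y"
      using g(1) by (cases "\<mu> \<in> I") (simp_all add: h_def g(4) sum.remove[of I \<mu> g] add.assoc)
    finally show ?thesis by simp
  qed
  ultimately show ?case using g(1,2) x(1)
    by (intro exI[of _ "insert \<mu> I"] exI[of _ h]) auto
qed

lemma weight_part_disjoint:
  assumes "v \<in> weight_part M" "v \<in> weight_part (- M)"
  shows "v = 0"
proof -
  obtain I g where g: "finite I" "I \<subseteq> M" "\<And>\<mu>. g \<mu> \<in> weight_space \<mu>" "v = (\<Sum>\<mu>\<in>I. g \<mu>)"
    using weight_part_sum[OF assms(1)] by blast
  obtain J h where h: "finite J" "J \<subseteq> - M" "\<And>\<mu>. h \<mu> \<in> weight_space \<mu>" "v = (\<Sum>\<mu>\<in>J. h \<mu>)"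
    using weight_part_sum[OF assms(2)] by blast
  define k where "k \<mu> = (if \<mu> \<in> I then g \<mu> else - h \<mu>)" for \<mu>
  have dis: "I \<inter> J = {}" using g(2) h(2) by auto
  have "(\<Sum>\<mu>\<in>I \<union> J. k \<mu>) = (\<Sum>\<mu>\<in>I. k \<mu>) + (\<Sum>\<mu>\<in>J. k \<mu>)"
    using g(1) h(1) dis by (rule sum.union_disjoint)
  also have "(\<Sum>\<mu>\<in>I. k \<mu>) = v" unfolding g(4) by (rule sum.cong) (auto simp: k_def)
  also have "(\<Sum>\<mu>\<in>J. k \<mu>) = (\<Sum>\<mu>\<in>J. - h \<mu>)" by (rule sum.cong) (use dis in \<open>auto simp: k_def\<close>)
  also have "\<dots> = - v" unfolding h(4) by (rule sum_negf)
  finally have sum0: "(\<Sum>\<mu>\<in>I \<union> J. k \<mu>) = 0" by simp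
  have "k \<mu> \<in> weight_space \<mu>" for \<mu>
    using g(3)[of \<mu>] subspace_neg[OF subspace_weight h(3)[of \<mu>]] by (simp add: k_def)
  then have "k \<mu> = 0" if "\<mu> \<in> I \<union> J" for \<mu>
    using weight_vectors_independent[OF _ _ sum0 that] g(1) h(1) by blast
  then have "g \<mu> = 0" if "\<mu> \<in> I" for \<mu> using that by (force simp: k_def)
  then show ?thesis unfolding g(4) by simp
qed

lemma weight_part_total:
  assumes weight_module
  shows "\<exists>u\<in>weight_part M. \<exists>w\<in>weight_part (- M). v = u + w"
proof -
  have "(\<Union>\<mu>. weight_space \<mu>) = (\<Union>\<mu>\<in>M. weight_space \<mu>) \<union> (\<Union>\<mu>\<in>- M. weight_space \<mu>)" by auto
  then have "v \<in> span ((\<Union>\<mu>\<in>M. weight_space \<mu>) \<union> (\<Union>\<mu>\<in>- M. weight_space \<mu>))"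
    using assms by (simp add: weight_module_def)
  then show ?thesis unfolding span_Un weight_part_def by blast
qed

lemma submodule_weight_part:
  assumes "\<And>\<mu> v m j. \<mu> \<in> M \<Longrightarrow> v \<in> weight_space \<mu> \<Longrightarrow> act (gen_d m j) v \<in> weight_part M"
  shows "submodule (weight_part M)"
proof -
  have sub: "subspace (weight_part M)" by (simp add: weight_part_def)
  have "act x v \<in> weight_part M" if "v \<in> weight_part M" for x v
    using that unfolding weight_part_def
  proof (induction rule: span_induct_alt)
    case base
    then show ?case by (simp add: span_zero)
  next
    case (step c v w)
    then obtain \<mu> where \<mu>: "\<mu> \<in> M" "v \<in> weight_space \<mu>" by blast
    have "act x v \<in> weight_part M"
    proof (induction x rule: loop_vir_basis_induct)
      case (c j)
      have "act (gen_c j) v \<in> (\<Union>\<mu>\<in>M. weight_space \<mu>)" using act_c_weight[OF \<mu>(2)] \<mu>(1) by blast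
      then show ?case unfolding weight_part_def by (rule span_base)
    qed (use assms[OF \<mu>] subspace_0[OF sub] subspace_add[OF sub] subspace_scale[OF sub]
          in \<open>auto simp: act_add_left act_scale_left\<close>)
    then show ?case using step.IH
      unfolding weight_part_def by (simp add: act_add_right act_scale_right span_add span_scale)
  qed
  then show ?thesis using sub by (simp add: submodule_def)
qed

lemma weight_part_trivial:
  assumes "indecomposable" "weight_module" "submodule (weight_part M)" "submodule (weight_part (- M))"
  shows "weight_part M = {0} \<or> weight_part (- M) = {0}"
proof -
  have "weight_part M \<inter> weight_part (- M) = {0}"
    using weight_part_disjoint[of _ M] by (auto simp: weight_part_def span_zero)
  moreover have "{u + w | u w. u \<in> weight_part M \<and> w \<in> weight_part (- M)} = UNIV"
    using weight_part_total[OF assms(2), of M] by blast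
  ultimately show ?thesis using assms(1,3,4) unfolding indecomposable_def by blast
qed

lemma weight_space_line:
  assumes intermediate_series
  shows "\<exists>w. weight_space \<mu> = span {w}"
proof (cases "weight_space \<mu> = {0}")
  case True
  then show ?thesis by (intro exI[of _ 0]) simp
next
  case False
  then have "dim (weight_space \<mu>) = 1" using assms by (simp add: intermediate_series_def)
  then obtain B where B: "B \<subseteq> weight_space \<mu>" "independent B" "weight_space \<mu> \<subseteq> span B" "card B = 1"
    using basis_exists[of "weight_space \<mu>"] by metis
  then obtain w where "B = {w}" by (auto simp: card_1_singleton_iff)
  moreover have "span B \<subseteq> weight_space \<mu>" using B(1) subspace_weight by (rule span_minimal)
  ultimately show ?thesis using B(3) by blast
qed

text \<open>The weights in one coset of the integers span a submodule, and so do the remaining ones;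
  indecomposability leaves one coset. Its representative is 0 if it contains 0, and
  \<open>w k\<close> is 0 where the weight is missing.\<close>

lemma weight_basis_exists:
  assumes int: intermediate_series
  obtains a w where "a = 0 \<or> a \<notin> \<int>" "\<And>k :: int. weight_space (a + of_int k) = span {w k}"
    "span (range w) = UNIV" "\<exists>k. w k \<noteq> 0"
proof -
  have ind: indecomposable and wm: weight_module using int by (simp_all add: intermediate_series_def)
  have "\<exists>\<mu>. weight_space \<mu> \<noteq> {0}"
  proof (rule ccontr)
    assume "\<not> (\<exists>\<mu>. weight_space \<mu> \<noteq> {0})"
    then have "(UNIV :: 'v set) = {0}" using wm by (simp add: weight_module_def)
    then show False using ind by (simp add: indecomposable_def)
  qed
  then obtain \<mu> where \<mu>: "weight_space \<mu> \<noteq> {0}" by blast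
  define a where "a = (if \<mu> \<in> \<int> then 0 else \<mu>)"
  obtain k0 :: int where k0: "\<mu> = a + of_int k0"
    by (cases "\<mu> \<in> \<int>") (auto simp: a_def elim!: Ints_cases intro: that[of 0])
  define M where "M = range (\<lambda>k :: int. a + of_int k)"
  have M: "\<nu> + of_int m \<in> M \<longleftrightarrow> \<nu> \<in> M" for \<nu> m
  proof
    assume "\<nu> + of_int m \<in> M"
    then obtain k where "\<nu> + of_int m = a + of_int k" by (auto simp: M_def)
    then have "\<nu> = a + of_int (k - m)" by (simp add: algebra_simps)
    then show "\<nu> \<in> M" unfolding M_def by (rule range_eqI)
  next
    assume "\<nu> \<in> M"
    then obtain k where "\<nu> = a + of_int k" by (auto simp: M_def)
    then have "\<nu> + of_int m = a + of_int (k + m)" by simp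
    then show "\<nu> + of_int m \<in> M" unfolding M_def by (rule range_eqI)
  qed
  have into: "act (gen_d m j) v \<in> weight_part N" if "v \<in> weight_space \<nu>" "\<nu> + of_int m \<in> N" for v \<nu> m j N
    unfolding weight_part_def using act_d_weight[OF that(1)] that(2) by (intro span_base UN_I)
  have "submodule (weight_part M)" "submodule (weight_part (- M))"
    by (rule submodule_weight_part, rule into, assumption, use M in simp)+
  from weight_part_trivial[OF ind wm this] have "weight_part (- M) = {0}"
  proof
    assume "weight_part M = {0}"
    moreover have "weight_space \<mu> \<subseteq> weight_part M"
      unfolding weight_part_def k0 by (rule order_trans[OF _ span_superset]) (auto simp: M_def)
    ultimately show ?thesis using \<mu> subspace_0[OF subspace_weight] by blast
  qed
  then have total: "v \<in> weight_part M" for v using weight_part_total[OF wm, of M] by auto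
  define w where "w k = (SOME w. weight_space (a + of_int k) = span {w})" for k :: int
  have w: "weight_space (a + of_int k) = span {w k}" for k
    unfolding w_def using weight_space_line[OF int] by (rule someI_ex)
  have "weight_space (a + of_int k) \<subseteq> span (range w)" for k unfolding w by (rule span_mono) auto
  then have "(\<Union>\<mu>\<in>M. weight_space \<mu>) \<subseteq> span (range w)" by (auto simp: M_def)
  then have 2: "span (range w) = UNIV"
    using total span_minimal[OF _ subspace_span] unfolding weight_part_def by blast
  have 1: "a = 0 \<or> a \<notin> \<int>" by (simp add: a_def)
  have "w k0 \<noteq> 0"
  proof
    assume "w k0 = 0"
    then have "weight_space \<mu> = {0}" unfolding k0 w by simp
    then show False using \<mu> by (rule notE[rotated])
  qed
  then have "\<exists>k. w k \<noteq> 0" by blast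
  from that[OF 1 w 2 this] show thesis .
qed

end

text \<open>Both modules are quotients of one space by the same kernel. This treats V'(0,0), itself
  a quotient, together with the other families, for which \<pi> is the identity.\<close>

lemma module_isomorphic_of_presentation:
  assumes V: "loop_vir_module scale act"
    and \<Psi>: "Vector_Spaces.linear s1 scale \<Psi>" "surj \<Psi>"
    and \<pi>: "Vector_Spaces.linear s1 s2 \<pi>" "surj \<pi>"
    and ker: "\<And>p. \<Psi> p = 0 \<longleftrightarrow> \<pi> p = 0"
    and act: "\<And>x p. \<Psi> (A x p) = act x (\<Psi> p)" "\<And>x p. \<pi> (A x p) = act' x (\<pi> p)"
  shows "module_isomorphic scale act s2 act'"
proof -
  interpret \<Psi>: Vector_Spaces.linear s1 scale \<Psi> by fact
  interpret \<pi>: Vector_Spaces.linear s1 s2 \<pi> by fact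
  have eq: "\<Psi> p = \<Psi> q \<longleftrightarrow> \<pi> p = \<pi> q" for p q
    using ker[of "p - q"] by (simp add: \<Psi>.diff \<pi>.diff)
  define \<phi> where "\<phi> v = \<pi> (SOME p. \<Psi> p = v)" for v
  have \<phi>: "\<phi> (\<Psi> p) = \<pi> p" for p
    unfolding \<phi>_def using someI[of "\<lambda>q. \<Psi> q = \<Psi> p" p] eq by blast
  have ex: "\<exists>p. v = \<Psi> p" for v using \<Psi>(2) by (auto simp: surj_def)
  have "\<phi> (v + w) = \<phi> v + \<phi> w" for v w
  proof -
    obtain p q where "v = \<Psi> p" "w = \<Psi> q" using ex by blast
    then show ?thesis by (simp add: \<phi> \<Psi>.add[symmetric] \<pi>.add)
  qed
  moreover have "\<phi> (scale c v) = s2 c (\<phi> v)" for c v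
  proof -
    obtain p where "v = \<Psi> p" using ex by blast
    then show ?thesis by (simp add: \<phi> \<Psi>.scale[symmetric] \<pi>.scale)
  qed
  ultimately have "Vector_Spaces.linear scale s2 \<phi>"
    unfolding Vector_Spaces.linear_def module_hom_def module_hom_axioms_def
    using \<Psi>.vs2.vector_space_axioms \<pi>.vs2.vector_space_axioms
      \<Psi>.vs2.module_axioms \<pi>.vs2.module_axioms by blast
  moreover have "bij \<phi>"
  proof (rule bijI)
    show "inj \<phi>"
    proof (rule injI)
      fix v w assume "\<phi> v = \<phi> w"
      moreover obtain p q where "v = \<Psi> p" "w = \<Psi> q" using ex by blast
      ultimately show "v = w" by (simp add: \<phi> eq)
    qed
    show "surj \<phi>" using \<pi>(2) \<phi> by (metis surj_def)
  qed
  moreover have "\<phi> (act x v) = act' x (\<phi> v)" for x v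
  proof -
    obtain p where "v = \<Psi> p" using ex by blast
    then show ?thesis by (simp add: \<phi> act(1)[symmetric] act(2))
  qed
  ultimately show ?thesis unfolding module_isomorphic_def by blast
qed

section \<open>Presentations of the module\<close>

context loop_vir_module
begin

lemma coefficients_exist:
  assumes w: "\<And>k :: int. weight_space (a + of_int k) = span {w k}"
  obtains F Z where "loop_coeffs {k. w k \<noteq> 0} a F Z"
    "\<And>m j k. act (gen_d m j) (w k) = scale (F m j k) (w (k + m))"
    "\<And>j k. act (gen_c j) (w k) = scale (Z j k) (w k)"
proof -
  have wk: "w k \<in> weight_space (a + of_int k)" for k unfolding w by (simp add: span_base)
  have "\<exists>c. act (gen_d m j) (w k) = scale c (w (k + m))" for m j k
    using act_d_weight[OF wk, of m j k] w[of "k + m"] by (auto simp: span_singleton add.assoc)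
  \<comment> \<open>If one of the two vectors is 0, the action leaves the coefficient undetermined,
    and 0 is chosen.\<close>
  then have "\<exists>c. act (gen_d m j) (w k) = scale c (w (k + m)) \<and> (w k = 0 \<or> w (k + m) = 0 \<longrightarrow> c = 0)" for m j k
    by (cases "w k = 0 \<or> w (k + m) = 0") (auto intro!: exI[of _ 0], metis scale_zero_right)
  then obtain F where F: "\<And>m j k. act (gen_d m j) (w k) = scale (F m j k) (w (k + m))"
    "\<And>m j k. w k = 0 \<or> w (k + m) = 0 \<Longrightarrow> F m j k = 0"
    by metis
  have "\<exists>c. act (gen_c j) (w k) = scale c (w k)" for j k
    using act_c_weight[OF wk, of j k] w[of k] by (auto simp: span_singleton)
  then obtain Z where Z: "\<And>j k. act (gen_c j) (w k) = scale (Z j k) (w k)" by metis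
  have cancel: "x = y" if "scale x (w k) = scale y (w k)" "w k \<noteq> 0" for x y k
    using that by simp
  have "loop_coeffs {k. w k \<noteq> 0} a F Z"
  proof
    fix k m n i j
    show "F 0 0 k = a + of_int k" if "k \<in> {k. w k \<noteq> 0}"
      using that wk[of k] F(1)[of 0 0 k] by (simp add: weight_iff)
    show "F m j k = 0" if "k \<notin> {k. w k \<noteq> 0} \<or> k + m \<notin> {k. w k \<noteq> 0}"
      using that F(2) by auto
    show "Z j (k + m) * F m i k = Z j k * F m i k"
    proof (cases "w (k + m) = 0")
      case False
      have "act (gen_c j) (act (gen_d m i) (w k)) = act (gen_d m i) (act (gen_c j) (w k))" by (rule act_c)
      then have "scale (Z j (k + m) * F m i k) (w (k + m)) = scale (Z j k * F m i k) (w (k + m))"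
        by (simp add: F Z act_scale_right mult.commute)
      then show ?thesis using False by (rule cancel)
    qed (simp add: F(2))
    show "F m i (k + n) * F n j k - F n j (k + m) * F m i k = of_int (n - m) * F (m + n) (i + j) k +
        (if m = - n then (of_int m ^ 3 - of_int m) / 12 * Z (i + j) k else 0)"
      if k: "k \<in> {k. w k \<noteq> 0}"
    proof (cases "w (k + n + m) = 0")
      case False
      have e: "k + m + n = k + n + m" "k + (m + n) = k + n + m" by simp_all
      have "scale (F m i (k + n) * F n j k - F n j (k + m) * F m i k) (w (k + n + m)) =
        act (gen_d m i) (act (gen_d n j) (w k)) - act (gen_d n j) (act (gen_d m i) (w k))"
        by (simp add: F(1) act_scale_right e scale_left_diff_distrib mult.commute)
      also have "\<dots> = scale (of_int (n - m)) (act (gen_d (m + n) (i + j)) (w k)) +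
        (if m = - n then scale ((of_int m ^ 3 - of_int m) / 12) (act (gen_c (i + j)) (w k)) else 0)"
        by (rule act_d_d)
      also have "\<dots> = scale (of_int (n - m) * F (m + n) (i + j) k +
        (if m = - n then (of_int m ^ 3 - of_int m) / 12 * Z (i + j) k else 0)) (w (k + n + m))"
        by (simp add: F(1) Z e scale_left_distrib)
      finally show ?thesis using False by (rule cancel)
    next
      case True
      then have "w (k + m + n) = 0" "w (k + (m + n)) = 0" by (simp_all add: ac_simps)
      \<comment> \<open>Otherwise \<open>k + n + m\<close> would be \<open>k\<close>, where
        \<open>w\<close> is nonzero; so no central term arises.\<close>
      moreover have "m \<noteq> - n" using True k by auto
      ultimately show ?thesis using True F(2) by simp
    qed
  qed
  then show thesis using F(1) Z by (rule that)
qed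

definition combine :: "(int \<Rightarrow> 'v) \<Rightarrow> (int \<Rightarrow>\<^sub>0 complex) \<Rightarrow> 'v" where
  "combine w p = (\<Sum>k\<in>Poly_Mapping.keys p. scale (Poly_Mapping.lookup p k) (w k))"

lemma combine_0 [simp]: "combine w 0 = 0"
  by (simp add: combine_def)

lemma combine_single [simp]: "combine w (Poly_Mapping.single k c) = scale c (w k)"
  by (cases "c = 0") (simp_all add: combine_def)

lemma combine_add: "combine w (p + q) = combine w p + combine w q"
  unfolding combine_def by (rule setsum_keys_plus_distrib) (simp_all add: scale_left_distrib)

lemma combine_scale: "combine w (fscale c p) = scale c (combine w p)"
  by (induction p rule: poly_mapping_add_induct)
     (simp_all add: combine_add fs.scale_right_distrib scale_right_distrib)

lemma linear_combine: "Vector_Spaces.linear fscale scale (combine w)"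
  by (intro Vector_Spaces.linear.intro module_hom.intro module_hom_axioms.intro
      vector_space_fscale vector_space_axioms fs.module_axioms module_axioms combine_add combine_scale)

lemma surj_combine:
  assumes "span (range w) = UNIV"
  shows "surj (combine w)"
proof -
  have "\<exists>p. v = combine w p" if "v \<in> span (range w)" for v
    using that
  proof (induction rule: span_induct_alt)
    case base
    show ?case by (intro exI[of _ 0]) simp
  next
    case (step c x y)
    then obtain k p where "x = w k" "y = combine w p" by blast
    then show ?case by (intro exI[of _ "Poly_Mapping.single k c + p"]) (simp add: combine_add)
  qed
  then show ?thesis using assms by (auto simp: surj_def)
qed

lemma combine_eq_0_iff:
  assumes w: "\<And>k. w k \<in> weight_space (a + of_int k)"
  shows "combine w p = 0 \<longleftrightarrow> (\<forall>k. w k \<noteq> 0 \<longrightarrow> Poly_Mapping.lookup p k = 0)"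
proof
  assume z: "combine w p = 0"
  let ?h = "\<lambda>k :: int. a + of_int k"
  have inj: "inj ?h" by (simp add: inj_def)
  define v where "v \<mu> = scale (Poly_Mapping.lookup p (inv ?h \<mu>)) (w (inv ?h \<mu>))" for \<mu>
  have v: "v (?h k) = scale (Poly_Mapping.lookup p k) (w k)" for k
    unfolding v_def inv_f_f[OF inj] ..
  have "(\<Sum>\<mu>\<in>?h ` Poly_Mapping.keys p. v \<mu>) = 0"
    using z unfolding combine_def by (subst sum.reindex) (simp_all add: v inj_on_def)
  then have "v (?h k) = 0" if "k \<in> Poly_Mapping.keys p" for k
    by (rule weight_vectors_independent[rotated 2])
       (use that w v subspace_scale[OF subspace_weight] in auto)
  then show "\<forall>k. w k \<noteq> 0 \<longrightarrow> Poly_Mapping.lookup p k = 0" unfolding v by (metis in_keys_iff scale_eq_0_iff)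
next
  assume "\<forall>k. w k \<noteq> 0 \<longrightarrow> Poly_Mapping.lookup p k = 0"
  then show "combine w p = 0" unfolding combine_def by (intro sum.neutral) auto
qed

lemma combine_eval_act:
  assumes h: "lie_module fscale vir_bracket fscale (bilin_ext h)" "e \<noteq> 0"
    and hD: "\<And>m k. h (D m) k = Poly_Mapping.single (k + m) (g m k)" and hC: "\<And>k. h C k = 0"
    and d: "\<And>m j k. act (gen_d m j) (w k) = scale (e powi j * g m k) (w (k + m))"
    and c: "\<And>j k. act (gen_c j) (w k) = 0"
  shows "combine w (eval_act fscale (bilin_ext h) e x p) = act x (combine w p)"
proof -
  interpret E: loop_vir_module fscale "eval_act fscale (bilin_ext h) e" by (rule lie_module_eval[OF h])
  show ?thesis
  proof (induction x rule: loop_vir_basis_induct)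
    case (d m j)
    show ?case
    proof (induction p rule: poly_mapping_add_induct)
      case (single k z)
      show ?case unfolding gen_d_def eval_act_tensor[OF h(1)]
        using assms(5)[of m j k] by (simp add: hD gen_d_def act_scale_right mult_ac)
    qed (simp_all add: E.act_add_right act_add_right combine_add)
  next
    case (c j)
    show ?case
    proof (induction p rule: poly_mapping_add_induct)
      case (single k z)
      show ?case unfolding gen_c_def eval_act_tensor[OF h(1)]
        using assms(6)[of j k] by (simp add: hC gen_c_def act_scale_right)
    qed (simp_all add: E.act_add_right act_add_right combine_add)
  qed (simp_all add: E.act_add_left act_add_left E.act_scale_left act_scale_left combine_add combine_scale)
qed

lemma module_isomorphic_bilin_ext:
  assumes h: "lie_module fscale vir_bracket fscale (bilin_ext h)" "e \<noteq> 0"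
    and hD: "\<And>m k. h (D m) k = Poly_Mapping.single (k + m) (g m k)" and hC: "\<And>k. h C k = 0"
    and d: "\<And>m j k. act (gen_d m j) (w k) = scale (e powi j * g m k) (w (k + m))"
    and c: "\<And>j k. act (gen_c j) (w k) = 0"
    and w: "\<And>k. w k \<in> weight_space (a + of_int k)" "\<And>k. w k \<noteq> 0" "span (range w) = UNIV"
  shows "module_isomorphic scale act fscale (eval_act fscale (bilin_ext h) e)"
proof (rule module_isomorphic_of_presentation)
  show "loop_vir_module scale act" by (rule loop_vir_module_axioms)
  show "Vector_Spaces.linear fscale scale (combine w)" by (rule linear_combine)
  show "surj (combine w)" by (rule surj_combine) fact
  show "Vector_Spaces.linear fscale fscale (\<lambda>p. p)" using fs.linear_id by (simp add: id_def)
  show "combine w p = 0 \<longleftrightarrow> p = 0" for p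
    unfolding combine_eq_0_iff[OF w(1)] using w(2) by (auto intro: poly_mapping_eqI)
  show "combine w (eval_act fscale (bilin_ext h) e x p) = act x (combine w p)" for x p
    by (rule combine_eval_act[OF h hD hC d c])
qed auto

end

lemma linear_abs_Vprime: "Vector_Spaces.linear fscale Vprime_scale abs_Vprime"
proof -
  interpret lie_module fscale vir_bracket Vprime_scale Vprime_act by (rule Vprime_module)
  show ?thesis
    by (intro Vector_Spaces.linear.intro module_hom.intro module_hom_axioms.intro
      vector_space_fscale vector_space_axioms fs.module_axioms module_axioms)
      (simp_all add: plus_Vprime.abs_eq Vprime_scale.abs_eq)
qed

lemma abs_Vprime_eq_0_iff: "abs_Vprime p = 0 \<longleftrightarrow> (\<forall>k. k \<noteq> 0 \<longrightarrow> Poly_Mapping.lookup p k = 0)"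
proof -
  have "abs_Vprime p = 0 \<longleftrightarrow> (\<exists>z. p = Poly_Mapping.single 0 z)"
    by (simp add: zero_Vprime_def Vprime.abs_eq_iff)
  also have "\<dots> \<longleftrightarrow> (\<forall>k. k \<noteq> 0 \<longrightarrow> Poly_Mapping.lookup p k = 0)"
  proof
    assume "\<forall>k. k \<noteq> 0 \<longrightarrow> Poly_Mapping.lookup p k = 0"
    then have "p = Poly_Mapping.single 0 (Poly_Mapping.lookup p 0)"
      by (intro poly_mapping_eqI) (auto simp: lookup_single when_def)
    then show "\<exists>z. p = Poly_Mapping.single 0 z" ..
  qed (auto simp: lookup_single)
  finally show ?thesis .
qed

lemma abs_Vprime_eval_act:
  "abs_Vprime (eval_act fscale (V_act 0 0) e x p) = eval_act Vprime_scale Vprime_act e x (abs_Vprime p)"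
proof -
  interpret Vector_Spaces.linear fscale Vprime_scale abs_Vprime by (rule linear_abs_Vprime)
  show ?thesis unfolding eval_act_def sum
    by (simp add: scale Vprime_act.abs_eq)
qed

context loop_vir_module
begin

lemma module_isomorphic_Vprime:
  assumes e: "e \<noteq> 0"
    and d: "\<And>m j k. act (gen_d m j) (w k) = scale (e powi j * V_coeff 0 0 m k) (w (k + m))"
    and c: "\<And>j k. act (gen_c j) (w k) = 0"
    and w: "\<And>k. w k \<in> weight_space (a + of_int k)" "\<And>k. w k \<noteq> 0 \<longleftrightarrow> k \<noteq> 0" "span (range w) = UNIV"
  shows "module_isomorphic scale act Vprime_scale (eval_act Vprime_scale Vprime_act e)"
proof (rule module_isomorphic_of_presentation)
  show "loop_vir_module scale act" by (rule loop_vir_module_axioms)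
  show "Vector_Spaces.linear fscale scale (combine w)" by (rule linear_combine)
  show "surj (combine w)" by (rule surj_combine) fact
  show "Vector_Spaces.linear fscale Vprime_scale abs_Vprime" by (rule linear_abs_Vprime)
  show "surj abs_Vprime" by (rule surjI) (rule Quotient3_abs_rep[OF Quotient3_Vprime])
  show "combine w p = 0 \<longleftrightarrow> abs_Vprime p = 0" for p
    unfolding combine_eq_0_iff[OF w(1)] abs_Vprime_eq_0_iff w(2) ..
  show "combine w (eval_act fscale (V_act 0 0) e x p) = act x (combine w p)" for x p
    unfolding V_act_def
    by (rule combine_eval_act[where g = "V_coeff 0 0"])
      (use V_module[of 0 0] e d c in \<open>simp_all add: V_act_def V_coeff_def\<close>)
  show "abs_Vprime (eval_act fscale (V_act 0 0) e x p) = eval_act Vprime_scale Vprime_act e x (abs_Vprime p)" for x p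
    by (rule abs_Vprime_eval_act)
qed

text \<open>No nonzero coefficient leads into or out of index 0, so the weight 0 line and the sum of
  all other weight spaces are complementary submodules.\<close>

lemma B_coeff_0_decomposable:
  assumes int: intermediate_series and w: "\<And>k :: int. weight_space (of_int k) = span {w k}" "\<And>k. w k \<noteq> 0"
    and d: "\<And>m j k. act (gen_d m j) (w k) = scale (c m j * B_coeff 0 0 m k) (w (k + m))"
    and total: "span (range w) = UNIV"
  shows False
proof -
  have ind: indecomposable and wm: weight_module using int by (simp_all add: intermediate_series_def)
  have line: "\<exists>t. v = scale t (w k)" if "v \<in> weight_space (of_int k)" for v k
    using that w(1) by (auto simp: span_singleton)
  have wk: "w k \<in> weight_space (of_int k)" for k unfolding w by (simp add: span_base)
  have 0: "submodule (weight_part {0})"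
  proof (rule submodule_weight_part)
    fix \<mu> v m j assume "\<mu> \<in> {0}" "v \<in> weight_space \<mu>"
    then obtain t where "v = scale t (w 0)" using line[of v 0] by auto
    then have "act (gen_d m j) v = 0" by (simp add: act_scale_right d B_coeff_def)
    then show "act (gen_d m j) v \<in> weight_part {0}" by (simp add: weight_part_def span_zero)
  qed
  have 1: "submodule (weight_part (- {0}))"
  proof (rule submodule_weight_part)
    fix \<mu> v m j assume \<mu>: "\<mu> \<in> - {0 :: complex}" "v \<in> weight_space \<mu>"
    show "act (gen_d m j) v \<in> weight_part (- {0})"
    proof (cases "\<mu> + of_int m = 0")
      case False
      then show ?thesis unfolding weight_part_def using act_d_weight[OF \<mu>(2), of m j] by (intro span_base) auto
    next
      case True
      then have \<mu>m: "\<mu> = of_int (- m)" by (simp add: eq_neg_iff_add_eq_0)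
      then obtain t where "v = scale t (w (- m))" using line[of v "- m"] \<mu>(2) by auto
      then have "act (gen_d m j) v = 0" by (simp add: act_scale_right d B_coeff_def)
      then show ?thesis by (simp add: weight_part_def span_zero)
    qed
  qed
  have "w 0 \<in> weight_part {0}" "w 1 \<in> weight_part (- {0})"
    unfolding weight_part_def using wk[of 0] wk[of 1]
    by (auto intro!: span_base bexI[of _ "1 :: complex"])
  then show False using weight_part_trivial[OF ind wm 0 1] w(2) by blast
qed

end

text \<open>The assumption \<open>nontrivial\<close> excludes the one-dimensional trivial module,
  which satisfies the definition of the intermediate series while all modules in the list are
  infinite-dimensional.\<close>

theorem theorem5p1:
  fixes scale :: "complex \<Rightarrow> 'v::ab_group_add \<Rightarrow> 'v"
    and act :: "loop_vir \<Rightarrow> 'v \<Rightarrow> 'v"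
  assumes module: "loop_vir_module scale act"
    and intermediate: "loop_vir_module.intermediate_series scale act"
    and nontrivial: "\<exists>x v. act x v \<noteq> 0"
  shows "\<exists>a b e :: complex. e \<noteq> 0 \<and>
    (module_isomorphic scale act fscale (eval_act fscale (V_act a b) e) \<or>
     module_isomorphic scale act fscale (eval_act fscale (A_act a) e) \<or>
     module_isomorphic scale act fscale (eval_act fscale (B_act a) e) \<or>
     module_isomorphic scale act Vprime_scale (eval_act Vprime_scale Vprime_act e))"
proof -
  interpret loop_vir_module scale act by fact
  obtain a w where a: "a = 0 \<or> a \<notin> \<int>" and w: "\<And>k :: int. weight_space (a + of_int k) = span {w k}"
    and total: "span (range w) = UNIV" and ne: "\<exists>k. w k \<noteq> 0"
    using weight_basis_exists[OF intermediate] by metis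
  obtain F Z where FZ: "loop_coeffs {k. w k \<noteq> 0} a F Z"
    and F: "\<And>m j k. act (gen_d m j) (w k) = scale (F m j k) (w (k + m))"
    and Z: "\<And>j k. act (gen_c j) (w k) = scale (Z j k) (w k)"
    using coefficients_exist[OF w] by metis
  interpret c: loop_coeffs "{k. w k \<noteq> 0}" a F Z by fact
  have "(\<exists>m j k. F m j k \<noteq> 0) \<or> (\<exists>j k. k \<in> {k. w k \<noteq> 0} \<and> Z j k \<noteq> 0)"
  proof (rule ccontr)
    assume "\<not> ?thesis"
    then have 0: "F m j k = 0" "w k = 0 \<or> Z j k = 0" for m j k by auto
    have d0: "act (gen_d m j) (w k) = 0" for m j k unfolding F 0 by simp
    have c0: "act (gen_c j) (w k) = 0" for j k unfolding Z using 0(2)[of k j] by auto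
    have w0: "act x (w k) = 0" for x k
      by (induction x rule: loop_vir_basis_induct) (simp_all add: act_add_left act_scale_left d0 c0)
    have "act x v = 0" if "v \<in> span (range w)" for x v
      using that by (induction rule: span_induct_alt) (auto simp: act_add_right act_scale_right w0)
    then show False using nontrivial total by auto
  qed
  from c.loop_normal_form[OF _ a this] ne obtain e u g where e: "e \<noteq> 0" and u: "\<And>k. u k \<noteq> 0"
    and Z0: "\<And>k j. w k \<noteq> 0 \<Longrightarrow> Z j k = 0"
    and Fg: "\<And>m j k. F m j k * u k = e powi j * g m k * u (k + m)"
    and cases: "{k. w k \<noteq> 0} = UNIV \<and> (\<exists>b. g = V_coeff a b) \<or> {k. w k \<noteq> 0} = UNIV \<and> a = 0 \<and> (\<exists>\<alpha>. g = A_coeff \<alpha> 1) \<or>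
      {k. w k \<noteq> 0} = UNIV \<and> a = 0 \<and> (\<exists>\<alpha>. g = B_coeff (- \<alpha>) (- 1)) \<or>
      ({k. w k \<noteq> 0} = UNIV \<or> {k. w k \<noteq> 0} = - {0}) \<and> a = 0 \<and> g = B_coeff 0 0"
    by (elim exE conjE) (simp, blast)
  define v where "v k = scale (u k) (w k)" for k
  have d: "act (gen_d m j) (v k) = scale (e powi j * g m k) (v (k + m))" for m j k
    using Fg[of m j k] by (simp add: v_def act_scale_right F mult.commute)
  have c: "act (gen_c j) (v k) = 0" for j k
    using Z0[of k j] by (cases "w k = 0") (simp_all add: v_def act_scale_right Z)
  have vw: "span {v k} = span {w k}" for k
    unfolding v_def using u[of k] by (rule span_image_scale[of "{w k}" "\<lambda>_. u k", simplified])
  have v: "weight_space (a + of_int k) = span {v k}" for k by (simp add: vw w)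
  have vk: "v k \<in> weight_space (a + of_int k)" for k by (simp add: v span_base)
  have v0: "v k = 0 \<longleftrightarrow> w k = 0" for k using u by (simp add: v_def)
  have "range w \<subseteq> span (range v)"
  proof clarify
    fix k
    have "w k \<in> span {v k}" by (simp add: vw span_base)
    also have "\<dots> \<subseteq> span (range v)" by (rule span_mono) auto
    finally show "w k \<in> span (range v)" .
  qed
  then have totalv: "span (range v) = UNIV" using total span_minimal[OF _ subspace_span] by blast
  note iso = module_isomorphic_bilin_ext[OF _ e _ _ d c vk _ totalv]
  from cases consider b where "\<And>k. w k \<noteq> 0" "g = V_coeff a b"
    | \<alpha> where "\<And>k. w k \<noteq> 0" "g = A_coeff \<alpha> 1" | \<alpha> where "\<And>k. w k \<noteq> 0" "g = B_coeff (- \<alpha>) (- 1)"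
    | "\<And>k. w k \<noteq> 0" "a = 0" "g = B_coeff 0 0" | "{k. w k \<noteq> 0} = - {0}" "g = B_coeff 0 0" by blast
  then show ?thesis
  proof cases
    case 1
    have "module_isomorphic scale act fscale (eval_act fscale (bilin_ext (V_basis a b)) e)"
      by (rule iso) (use 1 V_module[of a b] in \<open>auto simp: V_act_def V_coeff_def v0\<close>)
    then show ?thesis using e unfolding V_act_def by blast
  next
    case 2
    have "module_isomorphic scale act fscale (eval_act fscale (bilin_ext (A_basis \<alpha>)) e)"
      by (rule iso) (use 2 A_module[of \<alpha>] in \<open>auto simp: A_act_def A_coeff_def v0 add.commute\<close>)
    then show ?thesis using e unfolding A_act_def by blast
  next
    case 3
    have "module_isomorphic scale act fscale (eval_act fscale (bilin_ext (B_basis \<alpha>)) e)"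
      by (rule iso) (use 3 B_module[of \<alpha>] in \<open>auto simp: B_act_def B_coeff_def v0 algebra_simps\<close>)
    then show ?thesis using e unfolding B_act_def by blast
  next
    case 4
    have False
      by (rule B_coeff_0_decomposable[OF intermediate, of v "\<lambda>m j. e powi j"]) (use v 4 v0 d totalv in auto)
    then show ?thesis ..
  next
    case 5
    then have w0: "w k \<noteq> 0 \<longleftrightarrow> k \<noteq> 0" for k by (auto simp: set_eq_iff)
    \<comment> \<open>The two coefficient arrays differ only for k + m = 0, where the target vector
      is 0.\<close>
    have "scale (e powi j * g m k) (v (k + m)) = scale (e powi j * V_coeff 0 0 m k) (v (k + m))" for m j k
      using w0[of "k + m"] by (cases "k + m = 0") (simp_all add: 5(2) v_def B_coeff_def V_coeff_def)
    then have "module_isomorphic scale act Vprime_scale (eval_act Vprime_scale Vprime_act e)"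
      using d w0 v0 by (intro module_isomorphic_Vprime[OF e _ c vk _ totalv]) auto
    then show ?thesis using e by blast
  qed
qed

end
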